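(* Fix $\nu\ge 1/2$ and $b_0,\theta_0>0$. (i) For any fixed $\delta>0$, $b>0$, $\theta>0$, as $n\to\infty$, $$\frac{\mathbf y^T A_{b,\theta}(I_n-A_{b,\theta})\mathbf y}{\mathrm{tr}\,A_{b,\theta}}-1\;\longrightarrow\;\psi(\delta,b,\theta,b_0,\theta_0)\quad\text{in probability},$$ where $$\psi(\delta,b,\theta,b_0,\theta_0):=\frac{1}{\int_{-\pi}^{\pi}a^\delta_{b,\theta}(\lambda)\,d\lambda}\int_{-\pi}^{\pi}\big[a^\delta_{b,\theta}(\lambda)\big]^2\left(\frac{b_0\,g^\delta_{\nu,\theta_0}(\lambda)}{b\,g^\delta_{\nu,\theta}(\lambda)}-1\right)d\lambda .$$ (ii) For fixed $b,\theta,b_0,\theta_0>0$, $$\psi(\delta,b,\theta,b_0,\theta_0)\longrightarrow \frac{2\nu}{2\nu+1}\left(\frac{b_0\theta_0^{2\nu}}{b\,\theta^{2\nu}}-1\right)\quad\text{as }\delta\to 0 .$$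
   Context: Fix $\nu\ge1/2$. For $\alpha>0$, $\omega\in\mathbb R$ let $g^*_{\nu,\alpha}(\omega)=C_\nu\alpha^{2\nu}(\alpha^2+\omega^2)^{-(\nu+1/2)}$ with $C_\nu=\Gamma(\nu+\frac12)/(\sqrt\pi\,\Gamma(\nu))$ (so $\int_{\mathbb R}g^*_{\nu,\alpha}=1$). For $\delta,\theta>0$ and $\lambda\in[-\pi,\pi]$ let $g^\delta_{\nu,\theta}(\lambda)=\sum_{k\in\mathbb Z}g^*_{\nu,\delta\theta}(\lambda+2k\pi)$ (the spectral density of the sampled series), and for $b>0$ let $a^\delta_{b,\theta}(\lambda)=\dfrac{b\,g^\delta_{\nu,\theta}(\lambda)}{b\,g^\delta_{\nu,\theta}(\lambda)+(2\pi)^{-1}}$. Model: $Z$ is a zero-mean stationary Gaussian process on $\mathbb R$ with $\mathrm{Cov}(Z(s),Z(t))=b_0K_{\nu,\theta_0}(t-s)$, where $K_{\nu,\theta}(t)=\int_{\mathbb R}g^*_{\nu,\theta}(\omega)\cos(\omega t)\,d\omega$, $b_0,\theta_0>0$. For $\delta>0$ and $n\ge1$, $\mathbf z=(Z(\delta),Z(2\delta),\dots,Z(n\delta))^T$ and $\mathbf y=\mathbf z+\boldsymbol\varepsilon$ with $\boldsymbol\varepsilon\sim N(0,I_n)$ independent of $Z$. $R_\theta$ is the $n\times n$ Toeplitz matrix with entries $[R_\theta]_{j,k}=K_{\nu,\theta}(\delta|j-k|)$, and $A_{b,\theta}=bR_\theta(I_n+bR_\theta)^{-1}$. *)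

theory Defs
  imports "HOL-Probability.Probability" "Jordan_Normal_Form.Matrix"
begin

definition C_nu :: "real \<Rightarrow> real" where
  "C_nu \<nu> = Gamma (\<nu> + 1/2) / (sqrt pi * Gamma \<nu>)"

definition g_star :: "real \<Rightarrow> real \<Rightarrow> real \<Rightarrow> real" where
  "g_star \<nu> \<alpha> \<omega> = C_nu \<nu> * \<alpha> powr (2*\<nu>) * (\<alpha>\<^sup>2 + \<omega>\<^sup>2) powr (-(\<nu> + 1/2))"

definition K_cov :: "real \<Rightarrow> real \<Rightarrow> real \<Rightarrow> real" where
  "K_cov \<nu> \<theta> t = (\<integral>\<omega>. g_star \<nu> \<theta> \<omega> * cos (\<omega> * t) \<partial>lborel)"

definition g_delta :: "real \<Rightarrow> real \<Rightarrow> real \<Rightarrow> real \<Rightarrow> real" where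
  "g_delta \<nu> \<delta> \<theta> l = (\<Sum>\<^sub>\<infinity>k::int. g_star \<nu> (\<delta> * \<theta>) (l + 2 * of_int k * pi))"

definition a_delta :: "real \<Rightarrow> real \<Rightarrow> real \<Rightarrow> real \<Rightarrow> real \<Rightarrow> real" where
  "a_delta \<nu> \<delta> b \<theta> l =
     b * g_delta \<nu> \<delta> \<theta> l / (b * g_delta \<nu> \<delta> \<theta> l + 1 / (2 * pi))"

definition psi :: "real \<Rightarrow> real \<Rightarrow> real \<Rightarrow> real \<Rightarrow> real \<Rightarrow> real \<Rightarrow> real" where
  "psi \<nu> \<delta> b \<theta> b0 \<theta>0 =
     (1 / integral {-pi..pi} (a_delta \<nu> \<delta> b \<theta>)) *
     integral {-pi..pi} (\<lambda>l. (a_delta \<nu> \<delta> b \<theta> l)\<^sup>2 *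
        (b0 * g_delta \<nu> \<delta> \<theta>0 l / (b * g_delta \<nu> \<delta> \<theta> l) - 1))"

definition mat_trace :: "real mat \<Rightarrow> real" where
  "mat_trace A = (\<Sum>i<dim_row A. A $$ (i, i))"

text \<open>Inverse of an n x n matrix (only meaningful when it is invertible).\<close>
definition mat_inv :: "nat \<Rightarrow> real mat \<Rightarrow> real mat" where
  "mat_inv n M = (THE B. B \<in> carrier_mat n n \<and> M * B = 1\<^sub>m n \<and> B * M = 1\<^sub>m n)"

definition R_mat :: "real \<Rightarrow> real \<Rightarrow> real \<Rightarrow> nat \<Rightarrow> real mat" where
  "R_mat \<nu> \<delta> \<theta> n = mat n n (\<lambda>(j, k). K_cov \<nu> \<theta> (\<delta> * \<bar>real j - real k\<bar>))"

definition A_mat :: "real \<Rightarrow> real \<Rightarrow> real \<Rightarrow> real \<Rightarrow> nat \<Rightarrow> real mat" where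
  "A_mat \<nu> \<delta> b \<theta> n =
     (b \<cdot>\<^sub>m R_mat \<nu> \<delta> \<theta> n) * mat_inv n (1\<^sub>m n + b \<cdot>\<^sub>m R_mat \<nu> \<delta> \<theta> n)"

text \<open>A centered (jointly) Gaussian family of real random variables with covariance C:
  every finite linear combination has characteristic function of a centered normal
  with the corresponding variance.\<close>
definition centered_gaussian_family ::
  "'a measure \<Rightarrow> ('i \<Rightarrow> 'a \<Rightarrow> real) \<Rightarrow> ('i \<Rightarrow> 'i \<Rightarrow> real) \<Rightarrow> bool" where
  "centered_gaussian_family M X C \<longleftrightarrow>
     prob_space M \<and> (\<forall>i. X i \<in> borel_measurable M) \<and>
     (\<forall>I c. finite I \<longrightarrow>
        (\<integral>\<omega>. cis (\<Sum>i\<in>I. c i * X i \<omega>) \<partial>M) =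
          complex_of_real (exp (- (\<Sum>i\<in>I. \<Sum>j\<in>I. c i * c j * C i j) / 2)))"

text \<open>Index Inl t: Z(t); index Inr i: noise eps_(i+1).  Z has covariance b0 K_{nu,theta0},
  the eps are iid N(0,1), and Z and eps are independent (zero cross covariance in a
  jointly Gaussian family).\<close>
definition model_cov :: "real \<Rightarrow> real \<Rightarrow> real \<Rightarrow> real + nat \<Rightarrow> real + nat \<Rightarrow> real" where
  "model_cov \<nu> b0 \<theta>0 p q =
     (case (p, q) of
        (Inl s, Inl t) \<Rightarrow> b0 * K_cov \<nu> \<theta>0 (t - s)
      | (Inr i, Inr j) \<Rightarrow> (if i = j then 1 else 0)
      | _ \<Rightarrow> 0)"

definition y_vec :: "(real + nat \<Rightarrow> 'a \<Rightarrow> real) \<Rightarrow> real \<Rightarrow> nat \<Rightarrow> 'a \<Rightarrow> real vec" where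
  "y_vec X \<delta> n \<omega> = vec n (\<lambda>i. X (Inl (real (i + 1) * \<delta>)) \<omega> + X (Inr i) \<omega>)"

definition test_stat :: "real \<Rightarrow> (real + nat \<Rightarrow> 'a \<Rightarrow> real) \<Rightarrow> real \<Rightarrow> real \<Rightarrow> real \<Rightarrow> nat \<Rightarrow> 'a \<Rightarrow> real" where
  "test_stat \<nu> X \<delta> b \<theta> n \<omega> =
     (let A = A_mat \<nu> \<delta> b \<theta> n; y = y_vec X \<delta> n \<omega> in
       (y \<bullet> ((A * (1\<^sub>m n - A)) *\<^sub>v y)) / mat_trace A - 1)"

end

(*
For the trigonometric vector e(l) = (exp(i j l))_{j<n} and a Toeplitz matrix T with continuous symbol f,
the residual T e(l) - 2 pi f(l) e(l) has, by Bessel's inequality, squared norm at most 2 pi times the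
integral of (f(m) - f(l))^2 against the unnormalised Fejer kernel, hence is o(n) uniformly in l.  So the e(l) are asymptotic
eigenvectors, a property inherited by sums, products and resolvents, and averaging the quadratic forms
over l turns it into limits of normalised traces.  This gives the mean of the quadratic form and the
trace of A; the variance is O(n) by Isserlis' formula and a Frobenius bound, and Chebyshev's inequality
gives (i).  For (ii), on the scale l = s u with s = delta^(2 nu / (2 nu + 1)) the smoother tends to
a(u) = B / (B + |u|^(2 nu + 1)); dominated convergence applies, and the integral of a^2 is
2 nu / (2 nu + 1) times that of a.
*)
theory Submission
  imports Defs "Jordan_Normal_Form.Determinant"
begin

section \<open>Moments of Gaussian quadratic forms\<close>

text \<open>Part (i) reduces to algebra in the resolvent W = (I + bR)^(-1): A = I - W and A(I - A) =
  W - W^2. Toeplitz entries are unnormalised Fourier coefficients, so R has symbol 2 pi g, W has w =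
  1/(1 + 2 pi b g), and a = 1 - w = 2 pi b g w. With \<sigma> = 1 + 2 pi b0 g0 the symbol of the
  covariance of y, the mean of the quadratic form has density (w - w^2) \<sigma>, and (w - w^2)
  \<sigma> - a = a^2 (b0 g0 / (b g) - 1) is the integrand in the numerator of \<open>psi\<close>. No
  diagonalisation of W is required, only that W is a contraction for every n, which follows from
  positive semidefiniteness of R. In part (ii) the obstacle is that the aliases k \<noteq> 0 do not
  decay in l, while the rescaled domain grows to the whole line. They are of size \<delta>^(2\<nu>)
  = s^(2\<nu>+1), and on the window |s u| \<le> pi this is at most (pi/|u|)^(2\<nu>+1). So the
  aliases obey the same decay as the leading term, and one dominating function serves for all
  \<delta>.\<close>

lemma (in prob_space) centered_gaussian_moments:
  fixes U :: "'a \<Rightarrow> real"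
  assumes meas [measurable]: "U \<in> borel_measurable M"
    and cf: "\<And>t. (\<integral>\<omega>. cis (t * U \<omega>) \<partial>M) = complex_of_real (exp (- (t\<^sup>2 * q) / 2))"
  shows "has_bochner_integral M (\<lambda>\<omega>. U \<omega> ^ 2) q"
    and "has_bochner_integral M (\<lambda>\<omega>. U \<omega> ^ 4) (3 * q\<^sup>2)"
proof -
  interpret D: real_distribution "distr M borel U" by simp
  interpret N: real_distribution std_normal_distribution by (rule real_dist_normal_dist)
  have char_U: "char (distr M borel U) t = complex_of_real (exp (- (t\<^sup>2 * q) / 2))" for t
    unfolding char_def by (subst integral_distr) (auto simp only: cis_conv_exp[symmetric] cf intro!: meas borel_measurable_continuous_onI continuous_intros)
  \<comment> \<open>The sign of \<open>q\<close> is forced: a characteristic function has modulus at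
    most 1, here at t = 1.\<close>
  have "exp (- q / 2) \<le> 1"
    using D.cmod_char_le_1[of 1] by (simp add: char_U)
  then have q: "0 \<le> q" by simp
  define s where "s = sqrt q"
  have s2: "s\<^sup>2 = q" using q by (simp add: s_def)
  \<comment> \<open>Equal characteristic functions identify the law of \<open>U\<close> with that of
    \<open>s\<close> times a standard normal variable, whose even moments are known. The degenerate
    case q = 0 is included.\<close>
  have "distr M borel U = distr std_normal_distribution borel (\<lambda>x. s * x)"
  proof (rule Levy_uniqueness)
    show "real_distribution (distr std_normal_distribution borel (\<lambda>x. s * x))"
      by (rule N.real_distribution_distr) simp
    have "char (distr std_normal_distribution borel (\<lambda>x. s * x)) t
        = char std_normal_distribution (s * t)" for t
      unfolding char_def by (subst integral_distr) (simp_all add: mult_ac)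
    then show "char (distr M borel U) = char (distr std_normal_distribution borel (\<lambda>x. s * x))"
      by (simp add: fun_eq_iff char_U char_std_normal_distribution power_mult_distrib s2 mult.commute)
  qed simp
  then have D_eq: "distr M borel U = distr std_normal_distribution borel (\<lambda>x. s * x)" .
  have moment: "has_bochner_integral M (\<lambda>\<omega>. U \<omega> ^ (2*k)) (q ^ k * (fact (2*k) / (2^k * fact k)))" for k
  proof -
    have "has_bochner_integral std_normal_distribution (\<lambda>x. (s * x) ^ (2*k))
        (s ^ (2*k) * (fact (2*k) / (2^k * fact k)))"
      unfolding power_mult_distrib
      using std_normal_distribution_even_moments[of k]
      by (intro has_bochner_integral_mult_right) (simp add: has_bochner_integral_iff)
    then have "has_bochner_integral (distr M borel U) (\<lambda>x. x ^ (2*k))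
        (s ^ (2*k) * (fact (2*k) / (2^k * fact k)))"
      unfolding D_eq by (intro has_bochner_integral_distr) auto
    then show ?thesis
      by (simp add: has_bochner_integral_iff integrable_distr_eq integral_distr power_mult s2)
  qed
  show "has_bochner_integral M (\<lambda>\<omega>. U \<omega> ^ 2) q"
    using moment[of 1] by (simp add: fact_numeral)
  show "has_bochner_integral M (\<lambda>\<omega>. U \<omega> ^ 4) (3 * q\<^sup>2)"
    using moment[of 2] by (simp add: fact_numeral mult.commute)
qed

text \<open>The law is prescribed only through linear combinations, so all mixed moments below come
  from one-dimensional ones by polarisation. Positive semidefiniteness of \<open>S\<close> on the
  first \<open>n\<close> indices is implied by \<open>cf\<close>.\<close>

locale gaussian_vector = prob_space M for M :: "'a measure" +
  fixes n :: nat and Y :: "nat \<Rightarrow> 'a \<Rightarrow> real" and S :: "nat \<Rightarrow> nat \<Rightarrow> real"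
  assumes measurable_Y [measurable]: "Y i \<in> borel_measurable M"
    and cf: "(\<integral>\<omega>. cis (\<Sum>i<n. c i * Y i \<omega>) \<partial>M) =
          complex_of_real (exp (- (\<Sum>i<n. \<Sum>j<n. c i * c j * S i j) / 2))"
    and S_sym: "S i j = S j i"
begin

definition comb :: "(nat \<Rightarrow> real) \<Rightarrow> 'a \<Rightarrow> real" where
  "comb c \<omega> = (\<Sum>i<n. c i * Y i \<omega>)"

definition cov_form :: "(nat \<Rightarrow> real) \<Rightarrow> (nat \<Rightarrow> real) \<Rightarrow> real" where
  "cov_form c d = (\<Sum>i<n. \<Sum>j<n. c i * d j * S i j)"

lemma comb_add: "comb (\<lambda>i. c i + d i) \<omega> = comb c \<omega> + comb d \<omega>"
  and comb_diff: "comb (\<lambda>i. c i - d i) \<omega> = comb c \<omega> - comb d \<omega>"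
  by (simp_all add: comb_def algebra_simps sum.distrib sum_subtractf)

lemma cov_form_linear:
  "cov_form (\<lambda>i. c i + d i) e = cov_form c e + cov_form d e"
  "cov_form (\<lambda>i. c i - d i) e = cov_form c e - cov_form d e"
  "cov_form e (\<lambda>i. c i + d i) = cov_form e c + cov_form e d"
  "cov_form e (\<lambda>i. c i - d i) = cov_form e c - cov_form e d"
  by (simp_all add: cov_form_def algebra_simps sum.distrib sum_subtractf)

lemma cov_form_commute: "cov_form c d = cov_form d c"
  unfolding cov_form_def by (subst sum.swap) (simp add: S_sym mult_ac)

lemma comb_moments:
  shows "has_bochner_integral M (\<lambda>\<omega>. comb c \<omega> ^ 2) (cov_form c c)"
    and "has_bochner_integral M (\<lambda>\<omega>. comb c \<omega> ^ 4) (3 * (cov_form c c)\<^sup>2)"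
proof -
  have "(\<integral>\<omega>. cis (t * comb c \<omega>) \<partial>M) = complex_of_real (exp (- (t\<^sup>2 * cov_form c c) / 2))" for t
    using cf[of "\<lambda>i. t * c i"]
    by (simp add: comb_def cov_form_def sum_distrib_left mult_ac power2_eq_square)
  moreover have "comb c \<in> borel_measurable M"
    unfolding comb_def[abs_def] by measurable
  ultimately show "has_bochner_integral M (\<lambda>\<omega>. comb c \<omega> ^ 2) (cov_form c c)"
    and "has_bochner_integral M (\<lambda>\<omega>. comb c \<omega> ^ 4) (3 * (cov_form c c)\<^sup>2)"
    using centered_gaussian_moments by blast+
qed

lemma cov_form_self_add:
    "cov_form (\<lambda>i. c i + d i) (\<lambda>i. c i + d i) = cov_form c c + 2 * cov_form c d + cov_form d d"
  and cov_form_self_diff: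
    "cov_form (\<lambda>i. c i - d i) (\<lambda>i. c i - d i) = cov_form c c - 2 * cov_form c d + cov_form d d"
  by (simp_all add: cov_form_linear cov_form_commute)

text \<open>Polarisation: 4xy = (x + y)^2 - (x - y)^2 leaves only second moments of single
  combinations.\<close>

lemma comb_product: "has_bochner_integral M (\<lambda>\<omega>. comb c \<omega> * comb d \<omega>) (cov_form c d)"
proof -
  have 1: "has_bochner_integral M
      (\<lambda>\<omega>. (comb (\<lambda>i. c i + d i) \<omega> ^ 2 - comb (\<lambda>i. c i - d i) \<omega> ^ 2) / 4)
      ((cov_form (\<lambda>i. c i + d i) (\<lambda>i. c i + d i) - cov_form (\<lambda>i. c i - d i) (\<lambda>i. c i - d i)) / 4)"
    by (intro has_bochner_integral_divide has_bochner_integral_diff comb_moments)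
  have 2: "(\<lambda>\<omega>. (comb (\<lambda>i. c i + d i) \<omega> ^ 2 - comb (\<lambda>i. c i - d i) \<omega> ^ 2) / 4)
      = (\<lambda>\<omega>. comb c \<omega> * comb d \<omega>)"
    by (simp add: fun_eq_iff comb_add comb_diff power2_eq_square algebra_simps)
  have 3: "(cov_form (\<lambda>i. c i + d i) (\<lambda>i. c i + d i) - cov_form (\<lambda>i. c i - d i) (\<lambda>i. c i - d i)) / 4
      = cov_form c d"
    unfolding cov_form_self_add cov_form_self_diff by simp
  show ?thesis using 1 unfolding 2 3 .
qed

text \<open>(x + y)^4 + (x - y)^4 - 2x^4 - 2y^4 = 12 x^2 y^2, so fourth moments of single
  combinations suffice.\<close>

lemma comb_squares_product:
  "has_bochner_integral M (\<lambda>\<omega>. (comb c \<omega>)\<^sup>2 * (comb d \<omega>)\<^sup>2)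
     (cov_form c c * cov_form d d + 2 * (cov_form c d)\<^sup>2)"
proof -
  let ?p = "\<lambda>i. c i + d i" and ?m = "\<lambda>i. c i - d i"
  have 1: "has_bochner_integral M
      (\<lambda>\<omega>. (comb ?p \<omega> ^ 4 + comb ?m \<omega> ^ 4 - 2 * comb c \<omega> ^ 4 - 2 * comb d \<omega> ^ 4) / 12)
      ((3 * (cov_form ?p ?p)\<^sup>2 + 3 * (cov_form ?m ?m)\<^sup>2 - 2 * (3 * (cov_form c c)\<^sup>2)
         - 2 * (3 * (cov_form d d)\<^sup>2)) / 12)"
    by (intro has_bochner_integral_divide has_bochner_integral_diff has_bochner_integral_add
        has_bochner_integral_mult_right comb_moments)
  have 2: "(\<lambda>\<omega>. (comb ?p \<omega> ^ 4 + comb ?m \<omega> ^ 4 - 2 * comb c \<omega> ^ 4 - 2 * comb d \<omega> ^ 4) / 12)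
      = (\<lambda>\<omega>. (comb c \<omega>)\<^sup>2 * (comb d \<omega>)\<^sup>2)"
    unfolding comb_add comb_diff by (rule ext) (simp add: power4_eq_xxxx power2_eq_square field_simps)
  have 3: "(3 * (cov_form ?p ?p)\<^sup>2 + 3 * (cov_form ?m ?m)\<^sup>2 - 2 * (3 * (cov_form c c)\<^sup>2)
         - 2 * (3 * (cov_form d d)\<^sup>2)) / 12 = cov_form c c * cov_form d d + 2 * (cov_form c d)\<^sup>2"
    unfolding cov_form_self_add cov_form_self_diff by (simp add: power2_eq_square algebra_simps)
  show ?thesis using 1 unfolding 2 3 .
qed

text \<open>Isserlis' formula by polarising both products: 4ab = P^2 - Q^2 and 4cd = R^2 - T^2 leave
  four products of squares, with divisor 16.\<close>

lemma isserlis_comb: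
  "has_bochner_integral M (\<lambda>\<omega>. comb a \<omega> * comb b \<omega> * (comb c \<omega> * comb d \<omega>))
     (cov_form a b * cov_form c d + cov_form a c * cov_form b d + cov_form a d * cov_form b c)"
proof -
  let ?P = "\<lambda>i. a i + b i" and ?Q = "\<lambda>i. a i - b i"
  let ?R = "\<lambda>i. c i + d i" and ?T = "\<lambda>i. c i - d i"
  let ?e = "\<lambda>u v. cov_form u u * cov_form v v + 2 * (cov_form u v)\<^sup>2"
  have 1: "has_bochner_integral M
      (\<lambda>\<omega>. ((comb ?P \<omega>)\<^sup>2 * (comb ?R \<omega>)\<^sup>2 - (comb ?P \<omega>)\<^sup>2 * (comb ?T \<omega>)\<^sup>2
          - (comb ?Q \<omega>)\<^sup>2 * (comb ?R \<omega>)\<^sup>2 + (comb ?Q \<omega>)\<^sup>2 * (comb ?T \<omega>)\<^sup>2) / 16)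
      ((?e ?P ?R - ?e ?P ?T - ?e ?Q ?R + ?e ?Q ?T) / 16)"
    by (intro has_bochner_integral_divide has_bochner_integral_diff has_bochner_integral_add
        comb_squares_product)
  have 2: "(\<lambda>\<omega>. ((comb ?P \<omega>)\<^sup>2 * (comb ?R \<omega>)\<^sup>2 - (comb ?P \<omega>)\<^sup>2 * (comb ?T \<omega>)\<^sup>2
          - (comb ?Q \<omega>)\<^sup>2 * (comb ?R \<omega>)\<^sup>2 + (comb ?Q \<omega>)\<^sup>2 * (comb ?T \<omega>)\<^sup>2) / 16)
      = (\<lambda>\<omega>. comb a \<omega> * comb b \<omega> * (comb c \<omega> * comb d \<omega>))"
    unfolding comb_add comb_diff by (rule ext) (simp add: power4_eq_xxxx power2_eq_square field_simps)
  have 3: "(?e ?P ?R - ?e ?P ?T - ?e ?Q ?R + ?e ?Q ?T) / 16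
      = cov_form a b * cov_form c d + cov_form a c * cov_form b d + cov_form a d * cov_form b c"
    unfolding cov_form_self_add cov_form_self_diff cov_form_linear by (simp add: power2_eq_square algebra_simps)
  show ?thesis using 1 unfolding 2 3 .
qed

lemma sum_unit: "i < n \<Longrightarrow> (\<Sum>l<n. of_bool (l = i) * f l) = (f i :: real)"
  by (subst sum.remove[of _ i]) (auto intro!: sum.neutral)

lemma comb_unit: "i < n \<Longrightarrow> comb (\<lambda>l. of_bool (l = i)) \<omega> = Y i \<omega>"
  unfolding comb_def by (rule sum_unit)

lemma cov_form_unit:
  assumes "i < n" "j < n"
  shows "cov_form (\<lambda>l. of_bool (l = i)) (\<lambda>l. of_bool (l = j)) = S i j"
proof -
  have "cov_form (\<lambda>l. of_bool (l = i)) (\<lambda>l. of_bool (l = j))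
      = (\<Sum>k<n. of_bool (k = i) * (\<Sum>l<n. of_bool (l = j) * S k l))"
    unfolding cov_form_def sum_distrib_left by (simp only: mult.assoc)
  then show ?thesis using assms by (simp only: sum_unit)
qed

section \<open>Mean and variance of a quadratic form\<close>

definition quad :: "(nat \<Rightarrow> nat \<Rightarrow> real) \<Rightarrow> 'a \<Rightarrow> real" where
  "quad B \<omega> = (\<Sum>i<n. \<Sum>j<n. B i j * (Y i \<omega> * Y j \<omega>))"

lemma quad_expectation:
  "has_bochner_integral M (quad B) (\<Sum>i<n. \<Sum>j<n. B i j * S i j)"
  unfolding quad_def[abs_def]
proof (intro has_bochner_integral_sum has_bochner_integral_mult_right)
  fix i j assume "i \<in> {..<n}" "j \<in> {..<n}"
  then show "has_bochner_integral M (\<lambda>\<omega>. Y i \<omega> * Y j \<omega>) (S i j)"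
    using comb_product[of "\<lambda>l. of_bool (l = i)" "\<lambda>l. of_bool (l = j)"]
    by (simp add: comb_unit cov_form_unit)
qed

text \<open>Of Isserlis' three pairings, the one joining i with j and k with l sums to the square of
  the mean and cancels; the two cross pairings remain.\<close>

lemma quad_variance:
  shows "integrable M (\<lambda>\<omega>. (quad B \<omega>)\<^sup>2)"
    and "variance (quad B) =
      (\<Sum>i<n. \<Sum>j<n. \<Sum>k<n. \<Sum>l<n. B i j * B k l * (S i k * S j l + S i l * S j k))"
proof -
  let ?m = "\<Sum>i<n. \<Sum>j<n. B i j * S i j"
  have sq: "(\<Sum>i<n. \<Sum>j<n. f i j)\<^sup>2 = (\<Sum>i<n. \<Sum>j<n. \<Sum>k<n. \<Sum>l<n. f i j * f k l)"
    for f :: "nat \<Rightarrow> nat \<Rightarrow> real"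
    unfolding power2_eq_square sum_distrib_right sum_distrib_left by (simp only: mult.commute)
  have "has_bochner_integral M (\<lambda>\<omega>. Y i \<omega> * Y j \<omega> * (Y k \<omega> * Y l \<omega>))
      (S i j * S k l + S i k * S j l + S i l * S j k)" if "i < n" "j < n" "k < n" "l < n" for i j k l
    using isserlis_comb[of "\<lambda>l. of_bool (l = i)" "\<lambda>l. of_bool (l = j)" "\<lambda>x. of_bool (x = k)" "\<lambda>x. of_bool (x = l)"] that
    by (simp add: comb_unit cov_form_unit)
  then have "has_bochner_integral M
      (\<lambda>\<omega>. \<Sum>i<n. \<Sum>j<n. \<Sum>k<n. \<Sum>l<n. B i j * B k l * (Y i \<omega> * Y j \<omega> * (Y k \<omega> * Y l \<omega>)))
      (\<Sum>i<n. \<Sum>j<n. \<Sum>k<n. \<Sum>l<n. B i j * B k l * (S i j * S k l + S i k * S j l + S i l * S j k))"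
    by (intro has_bochner_integral_sum has_bochner_integral_mult_right) auto
  moreover have "(\<lambda>\<omega>. \<Sum>i<n. \<Sum>j<n. \<Sum>k<n. \<Sum>l<n. B i j * B k l * (Y i \<omega> * Y j \<omega> * (Y k \<omega> * Y l \<omega>)))
      = (\<lambda>\<omega>. (quad B \<omega>)\<^sup>2)"
    unfolding quad_def sq by (intro ext sum.cong refl) (simp only: mult_ac)
  ultimately have q2: "has_bochner_integral M (\<lambda>\<omega>. (quad B \<omega>)\<^sup>2)
      (\<Sum>i<n. \<Sum>j<n. \<Sum>k<n. \<Sum>l<n. B i j * B k l * (S i j * S k l + S i k * S j l + S i l * S j k))"
    by simp
  then show "integrable M (\<lambda>\<omega>. (quad B \<omega>)\<^sup>2)"
    by (simp add: has_bochner_integral_iff)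
  have "variance (quad B) = expectation (\<lambda>\<omega>. (quad B \<omega>)\<^sup>2) - (expectation (quad B))\<^sup>2"
    using q2 quad_expectation by (intro variance_eq) (auto simp: has_bochner_integral_iff)
  moreover have "(\<Sum>i<n. \<Sum>j<n. \<Sum>k<n. \<Sum>l<n. B i j * B k l * (S i j * S k l + S i k * S j l + S i l * S j k))
      - ?m\<^sup>2 = (\<Sum>i<n. \<Sum>j<n. \<Sum>k<n. \<Sum>l<n. B i j * B k l * (S i k * S j l + S i l * S j k))"
    unfolding sq sum_subtractf[symmetric] by (intro sum.cong refl) (simp add: algebra_simps)
  ultimately show "variance (quad B) =
      (\<Sum>i<n. \<Sum>j<n. \<Sum>k<n. \<Sum>l<n. B i j * B k l * (S i k * S j l + S i l * S j k))"
    using q2 quad_expectation[of B] by (simp only: has_bochner_integral_iff)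
qed

end

section \<open>Matrices with an asymptotic symbol\<close>

text \<open>Vectors are functions on all naturals of which only the first \<open>n\<close>
  coordinates count, so the dimension is a plain parameter when n tends to infinity.\<close>

definition vnorm :: "nat \<Rightarrow> (nat \<Rightarrow> complex) \<Rightarrow> real" where
  "vnorm n x = L2_set (\<lambda>i. cmod (x i)) {..<n}"

definition act :: "nat \<Rightarrow> (nat \<Rightarrow> nat \<Rightarrow> real) \<Rightarrow> (nat \<Rightarrow> complex) \<Rightarrow> nat \<Rightarrow> complex" where
  "act n P x i = (\<Sum>k<n. complex_of_real (P i k) * x k)"

definition mprod :: "nat \<Rightarrow> (nat \<Rightarrow> nat \<Rightarrow> real) \<Rightarrow> (nat \<Rightarrow> nat \<Rightarrow> real) \<Rightarrow> nat \<Rightarrow> nat \<Rightarrow> real" where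
  "mprod n P Q i j = (\<Sum>k<n. P i k * Q k j)"

definition tvec :: "real \<Rightarrow> nat \<Rightarrow> complex" where
  "tvec l i = cis (real i * l)"

lemma vnorm_nonneg [simp]: "0 \<le> vnorm n x"
  by (simp add: vnorm_def)

lemma vnorm_sq: "(vnorm n x)\<^sup>2 = (\<Sum>i<n. (cmod (x i))\<^sup>2)"
  by (simp add: vnorm_def L2_set_def sum_nonneg)

lemma vnorm_cong: "(\<And>i. i < n \<Longrightarrow> x i = y i) \<Longrightarrow> vnorm n x = vnorm n y"
  unfolding vnorm_def by (rule L2_set_cong) auto

lemma vnorm_scale: "vnorm n (\<lambda>i. c * x i) = cmod c * vnorm n x"
  by (simp add: vnorm_def norm_mult L2_set_right_distrib)

lemma vnorm_add: "vnorm n (\<lambda>i. x i + y i) \<le> vnorm n x + vnorm n y"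
proof -
  have "vnorm n (\<lambda>i. x i + y i) \<le> L2_set (\<lambda>i. cmod (x i) + cmod (y i)) {..<n}"
    unfolding vnorm_def by (rule L2_set_mono) (auto intro: norm_triangle_ineq)
  also have "\<dots> \<le> vnorm n x + vnorm n y"
    unfolding vnorm_def by (rule L2_set_triangle_ineq)
  finally show ?thesis .
qed

lemma vnorm_diff: "vnorm n (\<lambda>i. x i - y i) \<le> vnorm n x + vnorm n y"
  using vnorm_add[of n x "\<lambda>i. - y i"] by (simp add: vnorm_def)

lemma vnorm_Cauchy_Schwarz: "cmod (\<Sum>i<n. cnj (x i) * y i) \<le> vnorm n x * vnorm n y"
proof -
  have "cmod (\<Sum>i<n. cnj (x i) * y i) \<le> (\<Sum>i<n. \<bar>cmod (x i)\<bar> * \<bar>cmod (y i)\<bar>)"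
    by (rule order_trans[OF norm_sum]) (simp add: norm_mult)
  also have "\<dots> \<le> vnorm n x * vnorm n y"
    unfolding vnorm_def by (rule L2_set_mult_ineq)
  finally show ?thesis .
qed

lemma vnorm_tvec: "vnorm n (tvec l) = sqrt (real n)"
  by (simp add: vnorm_def L2_set_def tvec_def)

lemma act_cong: "(\<And>i. i < n \<Longrightarrow> x i = y i) \<Longrightarrow> act n P x = act n P y"
  by (auto simp: act_def fun_eq_iff intro!: sum.cong)

lemma act_cong_matrix:
  "(\<And>k. k < n \<Longrightarrow> P i k = Q i k) \<Longrightarrow> act n P x i = act n Q x i"
  by (simp add: act_def)

lemma act_add: "act n P (\<lambda>i. x i + y i) j = act n P x j + act n P y j"
  and act_scale: "act n P (\<lambda>i. c * x i) j = c * act n P x j"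
  by (simp_all add: act_def sum.distrib sum_subtractf sum_distrib_left algebra_simps)

lemma act_add_left: "act n (\<lambda>i j. P i j + Q i j) x j = act n P x j + act n Q x j"
  and act_diff_left: "act n (\<lambda>i j. P i j - Q i j) x j = act n P x j - act n Q x j"
  and act_scale_left: "act n (\<lambda>i j. b * P i j) x j = complex_of_real b * act n P x j"
  by (simp_all add: act_def sum.distrib sum_subtractf sum_distrib_left algebra_simps)

lemma act_ident: "j < n \<Longrightarrow> act n (\<lambda>i j. of_bool (i = j)) x j = x j"
  unfolding act_def by (subst sum.remove[of _ j]) (auto intro!: sum.neutral)

lemma act_mprod: "act n (mprod n P Q) x = act n P (act n Q x)"
proof
  fix i
  have "act n (mprod n P Q) x i
      = (\<Sum>j<n. \<Sum>k<n. complex_of_real (P i k) * (complex_of_real (Q k j) * x j))"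
    by (simp add: act_def mprod_def sum_distrib_right mult.assoc)
  also have "\<dots> = act n P (act n Q x) i"
    unfolding act_def sum_distrib_left by (rule sum.swap)
  finally show "act n (mprod n P Q) x i = act n P (act n Q x) i" .
qed

lemma mprod_assoc: "mprod n (mprod n P Q) R = mprod n P (mprod n Q R)"
proof (intro ext)
  fix i j
  have "mprod n (mprod n P Q) R i j = (\<Sum>l<n. \<Sum>k<n. P i k * Q k l * R l j)"
    by (simp add: mprod_def sum_distrib_right)
  also have "\<dots> = (\<Sum>k<n. \<Sum>l<n. P i k * Q k l * R l j)" by (rule sum.swap)
  also have "\<dots> = mprod n P (mprod n Q R) i j"
    by (simp add: mprod_def sum_distrib_left mult.assoc)
  finally show "mprod n (mprod n P Q) R i j = mprod n P (mprod n Q R) i j" .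
qed

lemma mprod_diff_left: "mprod n (\<lambda>i j. P i j - Q i j) R i j = mprod n P R i j - mprod n Q R i j"
  by (simp add: mprod_def left_diff_distrib sum_subtractf)

text \<open>Column \<open>j\<close> is the image of the \<open>j\<close>-th unit vector, so its
  squared norm is at most \<open>K\<^sup>2\<close>; there are \<open>n\<close> columns. This is the
  Frobenius bound behind the O(n) variance.\<close>

lemma sum_squares_le_of_bounded:
  assumes "\<And>x. vnorm n (act n P x) \<le> K * vnorm n x"
  shows "(\<Sum>i<n. \<Sum>j<n. (P i j)\<^sup>2) \<le> K\<^sup>2 * real n"
proof -
  have "(\<Sum>i<n. (P i j)\<^sup>2) \<le> K\<^sup>2" if j: "j < n" for j
  proof -
    let ?e = "\<lambda>i. of_bool (i = j) :: complex"
    have e: "(vnorm n ?e)\<^sup>2 = 1"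
      unfolding vnorm_sq using j by (subst sum.remove[of _ j]) (auto intro!: sum.neutral)
    have "act n P ?e i = complex_of_real (P i j)" for i
      unfolding act_def using j by (subst sum.remove[of _ j]) (auto intro!: sum.neutral)
    then have "(\<Sum>i<n. (P i j)\<^sup>2) = (vnorm n (act n P ?e))\<^sup>2"
      by (simp add: vnorm_sq)
    also have "\<dots> \<le> (K * vnorm n ?e)\<^sup>2"
      by (intro power_mono assms vnorm_nonneg)
    finally show ?thesis by (simp add: power_mult_distrib e)
  qed
  then have "(\<Sum>j<n. \<Sum>i<n. (P i j)\<^sup>2) \<le> (\<Sum>j<n. K\<^sup>2)"
    by (intro sum_mono) auto
  then show ?thesis
    by (subst sum.swap) (simp add: mult.commute)
qed

text \<open>Since \<open>tvec l\<close> has norm sqrt n, \<eta> is a relative error. Uniformity in l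
  is what allows integration over l in \<open>has_symbol_trace\<close>.\<close>

definition has_symbol :: "(nat \<Rightarrow> nat \<Rightarrow> nat \<Rightarrow> real) \<Rightarrow> (real \<Rightarrow> real) \<Rightarrow> bool" where
  "has_symbol P p \<longleftrightarrow> (\<forall>\<eta>>0. \<forall>\<^sub>F n in sequentially. \<forall>l\<in>{-pi..pi}.
     vnorm n (\<lambda>i. act n (P n) (tvec l) i - complex_of_real (p l) * tvec l i) \<le> \<eta> * sqrt (real n))"

section \<open>Sums and products of matrices with a symbol\<close>

lemma has_symbolD:
  "has_symbol P p \<Longrightarrow> 0 < \<eta> \<Longrightarrow> \<forall>\<^sub>F n in sequentially. \<forall>l\<in>{-pi..pi}.
     vnorm n (\<lambda>i. act n (P n) (tvec l) i - complex_of_real (p l) * tvec l i) \<le> \<eta> * sqrt (real n)"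
  by (simp add: has_symbol_def)

lemma has_symbol_ident: "has_symbol (\<lambda>n i j. of_bool (i = j)) (\<lambda>l. 1)"
  unfolding has_symbol_def
  by (auto simp: vnorm_def L2_set_def act_ident intro!: always_eventually)

lemma has_symbol_add_scaled:
  assumes P: "has_symbol P p" and Q: "has_symbol Q q"
  shows "has_symbol (\<lambda>n i j. P n i j + c * Q n i j) (\<lambda>l. p l + c * q l)"
  unfolding has_symbol_def
proof (intro allI impI)
  fix \<eta> :: real assume \<eta>: "0 < \<eta>"
  \<comment> \<open>The tolerance is shared between the two residuals, which enter with weights 1
    and |c|.\<close>
  define \<kappa> where "\<kappa> = \<eta> / (1 + \<bar>c\<bar>)"
  have "0 < 1 + \<bar>c\<bar>" by (simp add: add_pos_nonneg)
  then have "0 < \<kappa>" "(1 + \<bar>c\<bar>) * \<kappa> = \<eta>"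
    using \<eta> by (simp_all add: \<kappa>_def)
  then have \<kappa>: "0 < \<kappa>" "\<kappa> + \<bar>c\<bar> * \<kappa> = \<eta>"
    by (simp_all only: distrib_right mult_1)
  show "\<forall>\<^sub>F n in sequentially. \<forall>l\<in>{-pi..pi}.
     vnorm n (\<lambda>i. act n (\<lambda>i j. P n i j + c * Q n i j) (tvec l) i - complex_of_real (p l + c * q l) * tvec l i)
       \<le> \<eta> * sqrt (real n)"
    using has_symbolD[OF P \<kappa>(1)] has_symbolD[OF Q \<kappa>(1)]
  proof eventually_elim
    case (elim n)
    show ?case
    proof
      fix l assume l: "l \<in> {-pi..pi}"
      define r where "r i = act n (P n) (tvec l) i - complex_of_real (p l) * tvec l i" for i
      define s where "s i = act n (Q n) (tvec l) i - complex_of_real (q l) * tvec l i" for i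
      have r: "vnorm n r \<le> \<kappa> * sqrt n" and s: "vnorm n s \<le> \<kappa> * sqrt n"
        using elim l by (auto simp: r_def[abs_def] s_def[abs_def])
      have "vnorm n (\<lambda>i. act n (\<lambda>i j. P n i j + c * Q n i j) (tvec l) i - complex_of_real (p l + c * q l) * tvec l i)
        = vnorm n (\<lambda>i. r i + complex_of_real c * s i)"
        by (rule vnorm_cong) (simp add: act_add_left act_scale_left r_def s_def algebra_simps)
      also have "\<dots> \<le> vnorm n r + \<bar>c\<bar> * vnorm n s"
        using vnorm_add[of n r "\<lambda>i. complex_of_real c * s i"] by (simp add: vnorm_scale)
      also have "\<dots> \<le> \<kappa> * sqrt n + \<bar>c\<bar> * (\<kappa> * sqrt n)"
        by (intro add_mono mult_left_mono r s) simp
      also have "\<dots> = \<eta> * sqrt n"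
        unfolding \<kappa>(2)[symmetric] by (simp add: algebra_simps)
      finally show "vnorm n (\<lambda>i. act n (\<lambda>i j. P n i j + c * Q n i j) (tvec l) i
          - complex_of_real (p l + c * q l) * tvec l i) \<le> \<eta> * sqrt n" .
    qed
  qed
qed

lemma has_symbol_diff:
  assumes "has_symbol P p" "has_symbol Q q"
  shows "has_symbol (\<lambda>n i j. P n i j - Q n i j) (\<lambda>l. p l - q l)"
  using has_symbol_add_scaled[OF assms, of "-1"] by simp

text \<open>PQe - pqe = P(Qe - qe) + q(Pe - pe). The first residual passes through the left factor,
  hence the bound \<open>K\<close> uniform in n; the second is multiplied by the right symbol, hence
  the bound \<open>C\<close>.\<close>

lemma has_symbol_mult:
  assumes P: "has_symbol P p" and Q: "has_symbol Q q"
    and K: "\<And>n x. vnorm n (act n (P n) x) \<le> K * vnorm n x"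
    and C: "\<And>l. l \<in> {-pi..pi} \<Longrightarrow> \<bar>q l\<bar> \<le> C"
  shows "has_symbol (\<lambda>n. mprod n (P n) (Q n)) (\<lambda>l. p l * q l)"
  unfolding has_symbol_def
proof (intro allI impI)
  fix \<eta> :: real assume \<eta>: "0 < \<eta>"
  \<comment> \<open>The signs of \<open>K\<close> and \<open>C\<close> are unspecified, hence the
    absolute values; the 1 keeps the denominator positive.\<close>
  define \<kappa> where "\<kappa> = \<eta> / (\<bar>K\<bar> + \<bar>C\<bar> + 1)"
  have \<kappa>: "0 < \<kappa>" using \<eta> by (simp add: \<kappa>_def add_nonneg_pos)
  show "\<forall>\<^sub>F n in sequentially. \<forall>l\<in>{-pi..pi}.
     vnorm n (\<lambda>i. act n (mprod n (P n) (Q n)) (tvec l) i - complex_of_real (p l * q l) * tvec l i)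
       \<le> \<eta> * sqrt (real n)"
    using has_symbolD[OF P \<kappa>] has_symbolD[OF Q \<kappa>]
  proof eventually_elim
    case (elim n)
    show ?case
    proof
      fix l assume l: "l \<in> {-pi..pi}"
      define r where "r i = act n (Q n) (tvec l) i - complex_of_real (q l) * tvec l i" for i
      define s where "s i = act n (P n) (tvec l) i - complex_of_real (p l) * tvec l i" for i
      have r: "vnorm n r \<le> \<kappa> * sqrt n" and s: "vnorm n s \<le> \<kappa> * sqrt n"
        using elim l by (auto simp: r_def[abs_def] s_def[abs_def])
      have "act n (P n) (act n (Q n) (tvec l)) i
          = act n (P n) r i + complex_of_real (q l) * act n (P n) (tvec l) i" for i
      proof -
        have "act n (P n) (act n (Q n) (tvec l)) = act n (P n) (\<lambda>i. r i + complex_of_real (q l) * tvec l i)"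
          by (simp add: r_def)
        then show ?thesis by (simp add: act_add act_scale)
      qed
      then have "vnorm n (\<lambda>i. act n (mprod n (P n) (Q n)) (tvec l) i - complex_of_real (p l * q l) * tvec l i)
        = vnorm n (\<lambda>i. act n (P n) r i + complex_of_real (q l) * s i)"
        by (intro vnorm_cong) (simp add: act_mprod s_def algebra_simps)
      also have "\<dots> \<le> vnorm n (act n (P n) r) + vnorm n (\<lambda>i. complex_of_real (q l) * s i)"
        by (rule vnorm_add)
      also have "\<dots> \<le> K * vnorm n r + \<bar>q l\<bar> * vnorm n s"
        using K[of n r] by (simp add: vnorm_scale)
      also have "\<dots> \<le> \<bar>K\<bar> * (\<kappa> * sqrt n) + \<bar>C\<bar> * (\<kappa> * sqrt n)"
        using C[OF l] r s by (intro add_mono mult_mono) auto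
      also have "\<dots> \<le> (\<bar>K\<bar> + \<bar>C\<bar> + 1) * \<kappa> * sqrt n"
        using \<kappa> by (simp add: algebra_simps)
      also have "(\<bar>K\<bar> + \<bar>C\<bar> + 1) * \<kappa> = \<eta>"
        by (simp add: \<kappa>_def add_nonneg_pos)
      finally show "vnorm n (\<lambda>i. act n (mprod n (P n) (Q n)) (tvec l) i
          - complex_of_real (p l * q l) * tvec l i) \<le> \<eta> * sqrt n" .
    qed
  qed
qed

section \<open>Orthogonality of exponentials and Bessel's inequality\<close>

lemma has_integral_cis:
  "((\<lambda>t. cis ((real i - real j) * t)) has_integral (if i = j then complex_of_real (2*pi) else 0)) {-pi..pi}"
proof (cases "i = j")
  case True
  then show ?thesis
    using has_integral_const_real[of "1::complex" "-pi" pi] by (simp add: scaleR_conv_of_real)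
next
  case False
  define m where "m = real i - real j"
  have m: "m \<noteq> 0" using False by (simp add: m_def)
  define F where "F z = exp (\<i> * (complex_of_real m * z)) / (\<i> * complex_of_real m)" for z
  have "((\<lambda>t. F (complex_of_real t)) has_vector_derivative cis (m * t)) (at t within {-pi..pi})" for t
    by (rule has_vector_derivative_real_field)
       (use m in \<open>auto simp: F_def cis_conv_exp mult_ac intro!: derivative_eq_intros\<close>)
  then have "((\<lambda>t. cis (m * t)) has_integral (F (complex_of_real pi) - F (complex_of_real (-pi)))) {-pi..pi}"
    by (intro fundamental_theorem_of_calculus) auto
  moreover have F: "F (complex_of_real t) = cis (m * t) / (\<i> * complex_of_real m)" for t
    by (simp add: F_def cis_conv_exp)
  \<comment> \<open>Here \<open>m\<close> is an integer, so the antiderivative takes the same value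
    at both endpoints.\<close>
  have "sin (m * pi) = 0"
    by (simp add: m_def left_diff_distrib sin_diff)
  then have "cis (m * pi) = cis (m * (-pi))"
    by (simp add: complex_eq_iff)
  then have "F (complex_of_real pi) - F (complex_of_real (-pi)) = 0"
    by (simp only: F) simp
  ultimately show ?thesis
    using False by (simp add: m_def)
qed

text \<open>Parseval: the square expands into exponentials, of which only the diagonal survives
  integration.\<close>

lemma has_integral_trig_poly:
  "((\<lambda>t. (cmod (\<Sum>k<n. x k * cis (- (real k * t))))\<^sup>2) has_integral 2 * pi * (vnorm n x)\<^sup>2) {-pi..pi}"
proof -
  have "((\<lambda>t. \<Sum>j<n. \<Sum>k<n. (x j * cnj (x k)) * cis ((real k - real j) * t)) has_integral
     (\<Sum>j<n. \<Sum>k<n. (x j * cnj (x k)) * (if k = j then complex_of_real (2*pi) else 0))) {-pi..pi}"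
    by (intro has_integral_sum has_integral_mult_right has_integral_cis) auto
  moreover have "(\<Sum>j<n. \<Sum>k<n. (x j * cnj (x k)) * (if k = j then complex_of_real (2*pi) else 0))
     = complex_of_real (2 * pi * (vnorm n x)\<^sup>2)"
  proof -
    have "(\<Sum>k<n. (x j * cnj (x k)) * (if k = j then complex_of_real (2*pi) else 0))
       = complex_of_real (2 * pi * (cmod (x j))\<^sup>2)" if "j < n" for j
      using that by (subst sum.remove[of _ j])
        (auto intro!: sum.neutral simp: complex_norm_square mult_ac simp del: of_real_power)
    then show ?thesis
      by (simp add: vnorm_sq sum_distrib_left)
  qed
  moreover have "(\<Sum>j<n. \<Sum>k<n. (x j * cnj (x k)) * cis ((real k - real j) * t))
     = complex_of_real ((cmod (\<Sum>k<n. x k * cis (- (real k * t))))\<^sup>2)" for t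
  proof -
    have "complex_of_real ((cmod (\<Sum>k<n. x k * cis (- (real k * t))))\<^sup>2)
      = (\<Sum>j<n. x j * cis (- (real j * t))) * (\<Sum>k<n. cnj (x k) * cis (real k * t))"
      by (simp add: complex_norm_square cis_cnj del: of_real_power)
    also have "\<dots> = (\<Sum>j<n. \<Sum>k<n. x j * cis (- (real j * t)) * (cnj (x k) * cis (real k * t)))"
      by (rule sum_product)
    also have "\<dots> = (\<Sum>j<n. \<Sum>k<n. (x j * cnj (x k)) * cis ((real k - real j) * t))"
    proof (intro sum.cong refl)
      fix j k
      have "cis (- (real j * t)) * cis (real k * t) = cis ((real k - real j) * t)"
        by (simp add: cis_mult algebra_simps)
      then show "x j * cis (- (real j * t)) * (cnj (x k) * cis (real k * t))
          = (x j * cnj (x k)) * cis ((real k - real j) * t)"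
        by (metis (no_types, lifting) mult.assoc mult.left_commute)
    qed
    finally show ?thesis by simp
  qed
  ultimately have "((\<lambda>t. complex_of_real ((cmod (\<Sum>k<n. x k * cis (- (real k * t))))\<^sup>2)) has_integral
     complex_of_real (2 * pi * (vnorm n x)\<^sup>2)) {-pi..pi}"
    by simp
  from has_integral_linear[OF this bounded_linear_Re] show ?thesis
    by (simp add: o_def)
qed

lemma has_integral_product_trig_poly:
  assumes h: "continuous_on {-pi..pi} h"
  shows "((\<lambda>t. h t * cnj (\<Sum>k<n. x k * cis (- (real k * t)))) has_integral
     (\<Sum>k<n. cnj (x k) * integral {-pi..pi} (\<lambda>t. h t * cis (real k * t)))) {-pi..pi}"
proof -
  have "((\<lambda>t. \<Sum>k<n. cnj (x k) * (h t * cis (real k * t))) has_integral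
     (\<Sum>k<n. cnj (x k) * integral {-pi..pi} (\<lambda>t. h t * cis (real k * t)))) {-pi..pi}"
    by (intro has_integral_sum has_integral_mult_right integrable_integral integrable_continuous_real
        continuous_intros h) auto
  then show ?thesis
    by (simp add: cis_cnj sum_distrib_left mult_ac)
qed

text \<open>Let X be the trigonometric polynomial whose coefficients are the unnormalised Fourier
  coefficients of \<open>h\<close>, with squared norm s. Integrating |h - X/(2 pi)|^2 \<ge> 0 yields
  that the integral of |h|^2 minus s/(2 pi) is nonnegative.\<close>

lemma Bessel_inequality:
  assumes h: "continuous_on {-pi..pi} h"
  shows "(vnorm n (\<lambda>k. integral {-pi..pi} (\<lambda>t. h t * cis (real k * t))))\<^sup>2
     \<le> 2 * pi * integral {-pi..pi} (\<lambda>t. (cmod (h t))\<^sup>2)"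
proof -
  define c where "c k = integral {-pi..pi} (\<lambda>t. h t * cis (real k * t))" for k :: nat
  define X where "X t = (\<Sum>k<n. c k * cis (- (real k * t)))" for t
  define s where "s = (vnorm n c)\<^sup>2"
  have 1: "((\<lambda>t. h t * cnj (X t)) has_integral complex_of_real s) {-pi..pi}"
  proof -
    have "(\<Sum>k<n. cnj (c k) * integral {-pi..pi} (\<lambda>t. h t * cis (real k * t))) = complex_of_real s"
      unfolding c_def[symmetric] s_def vnorm_sq
      by (simp add: complex_norm_square mult.commute del: of_real_power)
    then show ?thesis
      using has_integral_product_trig_poly[OF h, where n = n and x = c] by (simp add: X_def)
  qed
  have 2: "((\<lambda>t. Re (h t * cnj (X t))) has_integral s) {-pi..pi}"
    using has_integral_linear[OF 1 bounded_linear_Re] by (simp add: o_def)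
  have 3: "((\<lambda>t. (cmod (X t))\<^sup>2) has_integral 2 * pi * s) {-pi..pi}"
    unfolding X_def s_def by (rule has_integral_trig_poly)
  have 4: "((\<lambda>t. (cmod (h t))\<^sup>2) has_integral integral {-pi..pi} (\<lambda>t. (cmod (h t))\<^sup>2)) {-pi..pi}"
    by (intro integrable_integral integrable_continuous_real continuous_intros h)
  have "((\<lambda>t. (cmod (h t))\<^sup>2 - (1/pi) * Re (h t * cnj (X t)) + (1/(2*pi))\<^sup>2 * (cmod (X t))\<^sup>2) has_integral
     integral {-pi..pi} (\<lambda>t. (cmod (h t))\<^sup>2) - (1/pi) * s + (1/(2*pi))\<^sup>2 * (2 * pi * s)) {-pi..pi}"
    by (intro has_integral_add has_integral_diff has_integral_mult_right 2 3 4)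
  moreover have "0 \<le> (cmod (h t))\<^sup>2 - (1/pi) * Re (h t * cnj (X t)) + (1/(2*pi))\<^sup>2 * (cmod (X t))\<^sup>2" for t
  proof -
    have "(cmod (h t))\<^sup>2 - (1/pi) * Re (h t * cnj (X t)) + (1/(2*pi))\<^sup>2 * (cmod (X t))\<^sup>2
      = (cmod (h t - complex_of_real (1/(2*pi)) * X t))\<^sup>2"
      unfolding cmod_power2 by (simp add: power2_eq_square algebra_simps)
    then show ?thesis by simp
  qed
  ultimately have "0 \<le> integral {-pi..pi} (\<lambda>t. (cmod (h t))\<^sup>2) - (1/pi) * s + (1/(2*pi))\<^sup>2 * (2 * pi * s)"
    by (rule has_integral_nonneg)
  then have "s \<le> 2 * pi * integral {-pi..pi} (\<lambda>t. (cmod (h t))\<^sup>2)"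
    by (simp add: field_simps power2_eq_square)
  then show ?thesis by (simp add: s_def c_def[abs_def])
qed

text \<open>For every \<open>n\<close>, the integral over l of the quadratic form of
  \<open>P n\<close> at \<open>tvec l\<close> is exactly 2 pi times the trace, since off-diagonal
  exponentials integrate to 0. The symbol property makes that form equal to n p(l) up to a small
  multiple of n, uniformly in l.\<close>

lemma has_symbol_trace:
  assumes P: "has_symbol P p" and p: "continuous_on {-pi..pi} p"
  shows "(\<lambda>n. (\<Sum>i<n. P n i i) / real n) \<longlonglongrightarrow> integral {-pi..pi} p / (2 * pi)"
proof (rule LIMSEQ_I)
  fix r :: real assume r: "0 < r"
  have "\<forall>\<^sub>F n in sequentially. norm ((\<Sum>i<n. P n i i) / real n - integral {-pi..pi} p / (2*pi)) < r"
    using has_symbolD[OF P half_gt_zero[OF r]] eventually_gt_at_top[of 0]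
  proof eventually_elim
    case (elim n)
    have n: "0 < real n" using elim by simp
    define tr where "tr = (\<Sum>i<n. P n i i)"
    have "((\<lambda>l. \<Sum>i<n. \<Sum>k<n. complex_of_real (P n i k) * cis ((real k - real i) * l)) has_integral
       (\<Sum>i<n. \<Sum>k<n. complex_of_real (P n i k) * (if k = i then complex_of_real (2*pi) else 0))) {-pi..pi}"
      by (intro has_integral_sum has_integral_mult_right has_integral_cis) auto
    moreover have "(\<Sum>i<n. \<Sum>k<n. complex_of_real (P n i k) * (if k = i then complex_of_real (2*pi) else 0))
        = complex_of_real (2*pi*tr)"
    proof -
      have "(\<Sum>k<n. complex_of_real (P n i k) * (if k = i then complex_of_real (2*pi) else 0))
         = complex_of_real (2*pi * P n i i)" if "i < n" for i
        using that by (subst sum.remove[of _ i]) (auto intro!: sum.neutral)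
      then show ?thesis by (simp add: tr_def sum_distrib_left)
    qed
    moreover have "(\<Sum>i<n. \<Sum>k<n. complex_of_real (P n i k) * cis ((real k - real i) * l))
        = (\<Sum>i<n. cnj (tvec l i) * act n (P n) (tvec l) i)" for l
      unfolding act_def sum_distrib_left
    proof (intro sum.cong refl)
      fix i k
      have "cis ((real k - real i) * l) = cnj (tvec l i) * tvec l k"
        by (simp add: tvec_def cis_cnj cis_mult left_diff_distrib)
      then show "complex_of_real (P n i k) * cis ((real k - real i) * l)
          = cnj (tvec l i) * (complex_of_real (P n i k) * tvec l k)"
        by (simp only: mult.left_commute)
    qed
    ultimately have "((\<lambda>l. \<Sum>i<n. cnj (tvec l i) * act n (P n) (tvec l) i) has_integral
       complex_of_real (2*pi*tr)) {-pi..pi}" by simp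
    moreover have "((\<lambda>l. complex_of_real (real n * p l)) has_integral
        complex_of_real (real n * integral {-pi..pi} p)) {-pi..pi}"
      by (intro has_integral_of_real has_integral_mult_right integrable_integral
          integrable_continuous_real p)
    ultimately have "((\<lambda>l. (\<Sum>i<n. cnj (tvec l i) * act n (P n) (tvec l) i) - complex_of_real (real n * p l))
       has_integral complex_of_real (2*pi*tr) - complex_of_real (real n * integral {-pi..pi} p)) {-pi..pi}"
      by (rule has_integral_diff)
    moreover have "cmod ((\<Sum>i<n. cnj (tvec l i) * act n (P n) (tvec l) i) - complex_of_real (real n * p l))
       \<le> r/2 * real n" if l: "l \<in> {-pi..pi}" for l
    proof -
      have "(\<Sum>i<n. cnj (tvec l i) * tvec l i) = of_nat n"
        by (simp add: tvec_def cis_cnj cis_mult)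
      then have "(\<Sum>i<n. cnj (tvec l i) * act n (P n) (tvec l) i) - complex_of_real (real n * p l)
         = (\<Sum>i<n. cnj (tvec l i) * act n (P n) (tvec l) i)
            - complex_of_real (p l) * (\<Sum>i<n. cnj (tvec l i) * tvec l i)" by simp
      also have "\<dots> = (\<Sum>i<n. cnj (tvec l i) * (act n (P n) (tvec l) i - complex_of_real (p l) * tvec l i))"
        unfolding sum_distrib_left sum_subtractf[symmetric]
        by (intro sum.cong refl) (simp add: algebra_simps)
      \<comment> \<open>Both factors are of order sqrt n; their product is the factor n removed by
        the normalisation.\<close>
      also have "cmod \<dots> \<le> vnorm n (tvec l) * vnorm n (\<lambda>i. act n (P n) (tvec l) i - complex_of_real (p l) * tvec l i)"
        by (rule vnorm_Cauchy_Schwarz)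
      also have "\<dots> \<le> sqrt n * (r/2 * sqrt n)"
        using elim l by (intro mult_mono) (auto simp: vnorm_tvec)
      finally show ?thesis using n by (simp add: mult_ac)
    qed
    ultimately have "cmod (complex_of_real (2*pi*tr) - complex_of_real (real n * integral {-pi..pi} p))
        \<le> r/2 * real n * measure lborel {-pi..pi}"
      using r n by (intro has_integral_bound_real) auto
    then have "\<bar>2*pi*tr - real n * integral {-pi..pi} p\<bar> \<le> r/2 * real n * (2*pi)"
      by (simp flip: of_real_mult of_real_diff del: of_real_mult of_real_diff)
    moreover have "2*pi*tr - real n * integral {-pi..pi} p
        = (tr / real n - integral {-pi..pi} p / (2*pi)) * (2 * pi * real n)"
      using n by (simp add: field_simps)
    ultimately have "\<bar>tr / real n - integral {-pi..pi} p / (2*pi)\<bar> * \<bar>2 * pi * real n\<bar>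
        \<le> r/2 * real n * (2*pi)"
      by (simp only: abs_mult)
    moreover have "\<bar>2 * pi * real n\<bar> = 2 * pi * real n" and "r/2 * real n * (2*pi) = r/2 * (2 * pi * real n)"
      by simp_all
    ultimately have "\<bar>tr / real n - integral {-pi..pi} p / (2*pi)\<bar> * (2 * pi * real n)
        \<le> r/2 * (2 * pi * real n)"
      by (simp only:)
    then have "\<bar>tr / real n - integral {-pi..pi} p / (2*pi)\<bar> \<le> r/2"
      by (rule mult_right_le_imp_le) (use n in simp)
    then show ?case using r by (simp add: tr_def)
  qed
  then show "\<exists>no. \<forall>n\<ge>no. norm ((\<Sum>i<n. P n i i) / real n - integral {-pi..pi} p / (2*pi)) < r"
    by (simp add: eventually_sequentially)
qed

section \<open>Toeplitz matrices\<close>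

text \<open>Periodicity makes \<open>f\<close> continuous across the endpoints -pi and pi of the
  circle, nonnegativity makes the Toeplitz matrices positive semidefinite, and evenness makes their
  entries real Fourier coefficients.\<close>

locale toeplitz_symbol =
  fixes f :: "real \<Rightarrow> real"
  assumes cont: "continuous_on UNIV f"
    and periodic: "f (x + 2 * pi) = f x"
    and nonneg: "0 \<le> f x"
    and even: "f (- x) = f x"
begin

text \<open>There is no factor 1/(2 pi), in accordance with the covariance as the cosine integral of
  its density; hence the symbol is 2 pi f.\<close>

definition toep :: "nat \<Rightarrow> nat \<Rightarrow> real" where
  "toep i j = integral {-pi..pi} (\<lambda>m. f m * cos ((real i - real j) * m))"

lemma cont_on [continuous_intros]: "continuous_on A g \<Longrightarrow> continuous_on A (\<lambda>x. f (g x))"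
  using continuous_on_compose2[OF cont] by blast

lemma bounded: "\<exists>B. \<forall>x\<in>{-pi..pi}. f x \<le> B"
  using compact_attains_sup[of "f ` {-pi..pi}"]
  by (auto intro!: compact_continuous_image continuous_on_subset[OF cont])

lemma toep_sym: "toep i j = toep j i"
proof -
  have "cos ((real i - real j) * m) = cos ((real j - real i) * m)" for m
    using cos_minus[of "(real i - real j) * m"] by (simp add: algebra_simps)
  then show ?thesis by (simp add: toep_def)
qed

text \<open>Evenness of \<open>f\<close> removes the sine part, so the cosine coefficient is the
  full complex Fourier coefficient.\<close>

lemma has_integral_toep:
  "((\<lambda>m. complex_of_real (f m) * cis ((real i - real j) * m)) has_integral complex_of_real (toep i j)) {-pi..pi}"
proof -
  let ?d = "real i - real j"
  have c: "((\<lambda>m. f m * cos (?d * m)) has_integral toep i j) {-pi..pi}"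
    unfolding toep_def by (intro integrable_integral integrable_continuous_real continuous_intros)
  have s: "((\<lambda>m. f m * sin (?d * m)) has_integral integral {-pi..pi} (\<lambda>m. f m * sin (?d * m))) {-pi..pi}"
    by (intro integrable_integral integrable_continuous_real continuous_intros)
  have "integral {-pi..pi} (\<lambda>m. f m * sin (?d * m)) = integral {-pi..pi} (\<lambda>m. f (-m) * sin (?d * (-m)))"
    using Henstock_Kurzweil_Integration.integral_reflect_real[of pi "-pi" "\<lambda>m. f m * sin (?d * m)"] by simp
  also have "\<dots> = - integral {-pi..pi} (\<lambda>m. f m * sin (?d * m))"
    by (simp add: even)
  finally have 0: "integral {-pi..pi} (\<lambda>m. f m * sin (?d * m)) = 0" by simp
  have "((\<lambda>m. complex_of_real (f m * cos (?d * m)) + \<i> * complex_of_real (f m * sin (?d * m)))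
     has_integral complex_of_real (toep i j) + \<i> * complex_of_real 0) {-pi..pi}"
    using s unfolding 0 by (intro has_integral_add has_integral_mult_right has_integral_of_real c)
  moreover have "complex_of_real (f m * cos (?d * m)) + \<i> * complex_of_real (f m * sin (?d * m))
      = complex_of_real (f m) * cis (?d * m)" for m
    by (simp add: complex_eq_iff)
  ultimately show ?thesis by simp
qed

text \<open>The Toeplitz matrix acts by multiplying the trigonometric polynomial of \<open>x\<close>
  with \<open>f\<close> and taking Fourier coefficients. In this form
  \<open>Bessel_inequality\<close> applies to it.\<close>

lemma has_integral_act_toep:
  "((\<lambda>m. (complex_of_real (f m) * (\<Sum>k<n. x k * cis (- (real k * m)))) * cis (real i * m))
     has_integral act n toep x i) {-pi..pi}"
proof -
  have "((\<lambda>m. \<Sum>k<n. x k * (complex_of_real (f m) * cis ((real i - real k) * m))) has_integral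
     (\<Sum>k<n. x k * complex_of_real (toep i k))) {-pi..pi}"
    by (intro has_integral_sum has_integral_mult_right has_integral_toep) auto
  moreover have "x k * (complex_of_real (f m) * cis ((real i - real k) * m))
      = (complex_of_real (f m) * (x k * cis (- (real k * m)))) * cis (real i * m)" for k m
  proof -
    have "cis ((real i - real k) * m) = cis (- (real k * m)) * cis (real i * m)"
      by (simp add: cis_mult algebra_simps)
    then show ?thesis by (simp only: mult.assoc mult.left_commute)
  qed
  ultimately show ?thesis
    by (simp add: act_def sum_distrib_left sum_distrib_right mult.commute[of "x _" "complex_of_real (toep _ _)"])
qed

text \<open>The quadratic form is the integral of f |X|^2, where X is the trigonometric polynomial
  with coefficients \<open>x\<close>.\<close>

lemma toep_psd: "0 \<le> Re (\<Sum>i<n. cnj (x i) * act n toep x i)"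
proof -
  define X where "X m = (\<Sum>k<n. x k * cis (- (real k * m)))" for m
  have "((\<lambda>m. \<Sum>i<n. cnj (x i) * ((complex_of_real (f m) * X m) * cis (real i * m)))
     has_integral (\<Sum>i<n. cnj (x i) * act n toep x i)) {-pi..pi}"
    unfolding X_def by (intro has_integral_sum has_integral_mult_right has_integral_act_toep) auto
  moreover have "(\<Sum>i<n. cnj (x i) * ((complex_of_real (f m) * X m) * cis (real i * m)))
      = complex_of_real (f m * (cmod (X m))\<^sup>2)" for m
  proof -
    have "(\<Sum>i<n. cnj (x i) * ((complex_of_real (f m) * X m) * cis (real i * m)))
       = complex_of_real (f m) * (X m * (\<Sum>i<n. cnj (x i) * cis (real i * m)))"
      unfolding sum_distrib_left by (intro sum.cong refl) (simp only: mult_ac)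
    also have "(\<Sum>i<n. cnj (x i) * cis (real i * m)) = cnj (X m)"
      by (simp add: X_def cis_cnj)
    finally show ?thesis by (simp add: complex_norm_square del: of_real_power)
  qed
  ultimately have "((\<lambda>m. complex_of_real (f m * (cmod (X m))\<^sup>2)) has_integral
     (\<Sum>i<n. cnj (x i) * act n toep x i)) {-pi..pi}" by simp
  from has_integral_linear[OF this bounded_linear_Re]
  have "((\<lambda>m. f m * (cmod (X m))\<^sup>2) has_integral Re (\<Sum>i<n. cnj (x i) * act n toep x i)) {-pi..pi}"
    by (simp add: o_def)
  then show ?thesis
    by (rule has_integral_nonneg) (simp add: nonneg)
qed

text \<open>By positive semidefiniteness, the squared norm of x is at most the real part of the
  inner product of x with x + bTx; Cauchy-Schwarz finishes. This yields both the invertibility of I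
  + bT and the contraction property of its inverse.\<close>

lemma vnorm_le_ident_plus_toep:
  assumes b: "0 \<le> b"
  shows "vnorm n x \<le> vnorm n (\<lambda>i. x i + complex_of_real b * act n toep x i)"
proof (cases "vnorm n x = 0")
  case False
  let ?y = "\<lambda>i. x i + complex_of_real b * act n toep x i"
  have "(\<Sum>i<n. cnj (x i) * ?y i) = complex_of_real ((vnorm n x)\<^sup>2)
      + complex_of_real b * (\<Sum>i<n. cnj (x i) * act n toep x i)"
    by (simp add: vnorm_sq sum.distrib distrib_left sum_distrib_left mult.left_commute
        complex_norm_square mult.commute[of "cnj _"] del: of_real_power)
  then have "(vnorm n x)\<^sup>2 \<le> Re (\<Sum>i<n. cnj (x i) * ?y i)"
    using b toep_psd[of x n] by (simp del: Re_sum)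
  also have "\<dots> \<le> vnorm n x * vnorm n ?y"
    by (rule order_trans[OF complex_Re_le_cmod vnorm_Cauchy_Schwarz])
  finally have "vnorm n x * vnorm n x \<le> vnorm n x * vnorm n ?y"
    by (simp add: power2_eq_square)
  then show ?thesis
    using False by (simp add: less_le)
qed simp

text \<open>Bessel bounds the image by the L2 norm of f X, and Parseval returns to the norm of
  \<open>x\<close>. Each contributes a factor 2 pi under the square, so K = 2 pi B with B an upper
  bound of \<open>f\<close>.\<close>

lemma toep_bounded:
  obtains K where "0 \<le> K" "\<And>n x. vnorm n (act n toep x) \<le> K * vnorm n x"
proof -
  obtain B where B: "\<And>m. m \<in> {-pi..pi} \<Longrightarrow> f m \<le> B" using bounded by blast
  have B0: "0 \<le> B" using B[of 0] nonneg[of 0] by simp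
  have "vnorm n (act n toep x) \<le> 2 * pi * B * vnorm n x" for n x
  proof -
    define X where "X m = (\<Sum>k<n. x k * cis (- (real k * m)))" for m
    have cX: "continuous_on A X" for A
      unfolding X_def by (intro continuous_intros)
    have eq: "act n toep x = (\<lambda>i. integral {-pi..pi} (\<lambda>m. (complex_of_real (f m) * X m) * cis (real i * m)))"
      unfolding X_def by (rule ext) (rule integral_unique[OF has_integral_act_toep, symmetric])
    have "(vnorm n (act n toep x))\<^sup>2 \<le> 2 * pi * integral {-pi..pi} (\<lambda>m. (cmod (complex_of_real (f m) * X m))\<^sup>2)"
      unfolding eq by (intro Bessel_inequality continuous_intros cX)
    also have "integral {-pi..pi} (\<lambda>m. (cmod (complex_of_real (f m) * X m))\<^sup>2)
        \<le> integral {-pi..pi} (\<lambda>m. B\<^sup>2 * (cmod (X m))\<^sup>2)"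
    proof (rule integral_le)
      fix m assume "m \<in> {-pi..pi}"
      then have "(f m)\<^sup>2 \<le> B\<^sup>2" using B nonneg by (intro power_mono) auto
      then show "(cmod (complex_of_real (f m) * X m))\<^sup>2 \<le> B\<^sup>2 * (cmod (X m))\<^sup>2"
        by (simp add: norm_mult power_mult_distrib mult_right_mono)
    qed (intro integrable_continuous_real continuous_intros cX)+
    also have "\<dots> = B\<^sup>2 * (2 * pi * (vnorm n x)\<^sup>2)"
      unfolding X_def by (intro integral_unique has_integral_mult_right has_integral_trig_poly)
    finally have "(vnorm n (act n toep x))\<^sup>2 \<le> (2 * pi * B * vnorm n x)\<^sup>2"
      by (simp add: power_mult_distrib power2_eq_square mult_ac)
    then show ?thesis
      by (rule power2_le_imp_le) (simp add: B0)
  qed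
  then show ?thesis using B0 by (intro that[of "2 * pi * B"]) auto
qed

text \<open>The Fejer kernel times \<open>1 - cos\<close> is bounded, so no pointwise decay of the kernel is needed.\<close>
lemma modulus:
  assumes e: "0 < e"
  obtains C where "0 \<le> C"
    "\<And>m l. m \<in> {-pi..pi} \<Longrightarrow> l \<in> {-pi..pi} \<Longrightarrow> (f m - f l)\<^sup>2 \<le> e + C * (1 - cos (l - m))"
proof -
  obtain B where B: "\<And>m. m \<in> {-pi..pi} \<Longrightarrow> f m \<le> B" using bounded by blast
  \<comment> \<open>The larger interval contains the translates of \<open>m\<close> by 2 pi in
    either direction.\<close>
  have "uniformly_continuous_on {-3*pi..3*pi} f"
    by (intro compact_uniformly_continuous continuous_on_subset[OF cont]) auto
  then obtain d where d: "0 < d"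
    "\<And>x y. x \<in> {-3*pi..3*pi} \<Longrightarrow> y \<in> {-3*pi..3*pi} \<Longrightarrow> dist y x < d \<Longrightarrow> dist (f y) (f x) < sqrt e"
    using e unfolding uniformly_continuous_on_def by (metis real_sqrt_gt_zero)
  define d' where "d' = min d pi"
  have d': "0 < d'" "d' \<le> pi" "d' \<le> d" using d by (auto simp: d'_def)
  have cd: "cos d' < 1" using cos_monotone_0_pi[of 0 d'] d' by simp
  \<comment> \<open>Makes C (1 - cos) at least \<open>B\<^sup>2\<close> once the distance on the
    circle reaches \<open>d'\<close>; and \<open>B\<^sup>2\<close> bounds the squared difference
    because f lies between 0 and B.\<close>
  define C where "C = B\<^sup>2 / (1 - cos d')"
  have C0: "0 \<le> C" using cd by (simp add: C_def)
  have "(f m - f l)\<^sup>2 \<le> e + C * (1 - cos (l - m))" if m: "m \<in> {-pi..pi}" and l: "l \<in> {-pi..pi}" for m l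
  proof -
    \<comment> \<open>\<open>x\<close> represents \<open>m\<close> modulo 2 pi within distance pi of
      \<open>l\<close>, the range in which the cosine decreases with |x - l|.\<close>
    obtain x where x: "f x = f m" "cos (x - l) = cos (l - m)" "\<bar>x - l\<bar> \<le> pi" "x \<in> {-3*pi..3*pi}"
    proof -
      consider "\<bar>m - l\<bar> \<le> pi" | "m - l > pi" | "m - l < - pi" by linarith
      then show ?thesis
      proof cases
        case 1
        then show ?thesis using m cos_minus[of "m - l"] by (intro that[of m]) auto
      next
        case 2
        have "cos (m - 2*pi - l) = cos (l - m)"
          using cos_periodic[of "m - 2*pi - l"] cos_minus[of "m - l"] by (simp add: algebra_simps)
        then show ?thesis using m l 2 periodic[of "m - 2*pi"]
          by (intro that[of "m - 2*pi"]) (auto simp: abs_le_iff)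
      next
        case 3
        have "cos (m + 2*pi - l) = cos (l - m)"
          using cos_periodic[of "m - l"] cos_minus[of "m - l"] by (simp add: algebra_simps)
        then show ?thesis using m l 3 periodic[of m]
          by (intro that[of "m + 2*pi"]) (auto simp: abs_le_iff)
      qed
    qed
    show ?thesis
    proof (cases "\<bar>x - l\<bar> < d'")
      case True
      then have "dist (f x) (f l) < sqrt e"
        using d' l x(4) by (intro d(2)) (auto simp: dist_real_def)
      then have "\<bar>f m - f l\<bar> \<le> sqrt e" by (simp add: dist_real_def x(1))
      then have "(f m - f l)\<^sup>2 \<le> (sqrt e)\<^sup>2"
        by (metis abs_ge_zero power2_abs power_mono)
      then have "(f m - f l)\<^sup>2 \<le> e" using e by simp
      moreover have "0 \<le> C * (1 - cos (l - m))" using C0 by simp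
      ultimately show ?thesis by linarith
    next
      case False
      then have "cos \<bar>x - l\<bar> \<le> cos d'"
        using d' x(3) by (intro cos_monotone_0_pi_le) auto
      then have "1 - cos d' \<le> 1 - cos (l - m)" using x(2) by simp
      then have "C * (1 - cos d') \<le> C * (1 - cos (l - m))" using C0 by (rule mult_left_mono)
      moreover have "C * (1 - cos d') = B\<^sup>2" using cd by (simp add: C_def)
      moreover have "\<bar>f m - f l\<bar> \<le> B" using B[OF m] B[OF l] nonneg[of m] nonneg[of l] by linarith
      then have "(f m - f l)\<^sup>2 \<le> B\<^sup>2" by (metis abs_ge_zero power2_abs power_mono)
      ultimately show ?thesis using e by linarith
    qed
  qed
  then show ?thesis using C0 that by blast
qed

text \<open>The Toeplitz matrix of the constant 1 is 2 pi I, so subtracting 2 pi f(l) e(l) replaces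
  \<open>f\<close> by f - f(l). The residual therefore consists of Fourier coefficients of (f -
  f(l)) D with D the Dirichlet sum centred at l.\<close>

lemma has_symbol_toep: "has_symbol (\<lambda>n. toep) (\<lambda>l. 2 * pi * f l)"
  unfolding has_symbol_def
proof (intro allI impI)
  fix \<eta> :: real assume \<eta>: "0 < \<eta>"
  \<comment> \<open>With this value 4 pi^2 e n is half of \<eta>^2 n; the other half absorbs the
    constant 8 pi^2 C for large n.\<close>
  define e where "e = \<eta>\<^sup>2 / (8 * pi\<^sup>2)"
  have e: "0 < e" using \<eta> by (simp add: e_def)
  obtain C where C: "0 \<le> C"
    "\<And>m l. m \<in> {-pi..pi} \<Longrightarrow> l \<in> {-pi..pi} \<Longrightarrow> (f m - f l)\<^sup>2 \<le> e + C * (1 - cos (l - m))"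
    using modulus[OF e] by blast
  have bound: "(vnorm n (\<lambda>i. act n toep (tvec l) i - complex_of_real (2 * pi * f l) * tvec l i))\<^sup>2
      \<le> 4 * pi\<^sup>2 * e * n + 8 * pi\<^sup>2 * C" if l: "l \<in> {-pi..pi}" for n l
  proof -
    define D where "D m = (\<Sum>k<n. tvec l k * cis (- (real k * m)))" for m
    define h where "h m = complex_of_real (f m - f l) * D m" for m
    have cD: "continuous_on A D" for A
      unfolding D_def by (intro continuous_intros)
    have ch: "continuous_on A h" for A
      unfolding h_def by (intro continuous_intros cD)
    have r: "act n toep (tvec l) i - complex_of_real (2 * pi * f l) * tvec l i
        = integral {-pi..pi} (\<lambda>m. h m * cis (real i * m))" if i: "i < n" for i
    proof -
      have "((\<lambda>m. \<Sum>k<n. tvec l k * cis ((real i - real k) * m)) has_integral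
         (\<Sum>k<n. tvec l k * (if i = k then complex_of_real (2*pi) else 0))) {-pi..pi}"
        by (intro has_integral_sum has_integral_mult_right has_integral_cis) auto
      moreover have "(\<Sum>k<n. tvec l k * (if i = k then complex_of_real (2*pi) else 0))
          = complex_of_real (2*pi) * tvec l i"
        using i by (subst sum.remove[of _ i]) (auto intro!: sum.neutral)
      moreover have "(\<Sum>k<n. tvec l k * cis ((real i - real k) * m)) = D m * cis (real i * m)" for m
        by (simp add: D_def sum_distrib_right mult.assoc cis_mult left_diff_distrib)
      ultimately have "((\<lambda>m. D m * cis (real i * m)) has_integral complex_of_real (2*pi) * tvec l i) {-pi..pi}"
        by simp
      from has_integral_diff[OF has_integral_act_toep[of "tvec l" n i] has_integral_mult_right[OF this, of "complex_of_real (f l)"]]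
      have "((\<lambda>m. h m * cis (real i * m)) has_integral
          act n toep (tvec l) i - complex_of_real (2 * pi * f l) * tvec l i) {-pi..pi}"
        unfolding D_def[symmetric] h_def by (simp add: algebra_simps)
      then show ?thesis by (rule integral_unique[symmetric])
    qed
    have D2: "((\<lambda>m. (cmod (D m))\<^sup>2) has_integral 2 * pi * n) {-pi..pi}"
      using has_integral_trig_poly[of "tvec l" n] by (simp add: D_def vnorm_tvec)
    \<comment> \<open>D is a geometric sum in z = cis(l - m), with |z - 1|^2 = 2 (1 - cos(l - m))
      and |z^n - 1| \<le> 2. The bound is free of n, so this part of the residual stays bounded
      while the target grows like n.\<close>
    have DF: "(1 - cos (l - m)) * (cmod (D m))\<^sup>2 \<le> 2" for m
    proof -
      have "D m = (\<Sum>k<n. cis (l - m) ^ k)"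
        unfolding D_def by (intro sum.cong refl) (simp add: tvec_def cis_mult Complex.DeMoivre right_diff_distrib)
      then have "cmod ((cis (l - m) - 1) * D m) = cmod (cis (l - m) ^ n - 1)"
        by (simp add: power_diff_1_eq)
      also have "\<dots> \<le> 2"
        using norm_triangle_ineq4[of "cis (l - m) ^ n" 1] by (simp add: norm_power)
      finally have "(cmod ((cis (l - m) - 1) * D m))\<^sup>2 \<le> 2\<^sup>2"
        by (intro power_mono) auto
      moreover have "(cmod (cis (l - m) - 1))\<^sup>2 = 2 * (1 - cos (l - m))"
        using sin_cos_squared_add[of "l - m"]
        unfolding cmod_power2 by (simp add: power2_eq_square algebra_simps)
      ultimately have "2 * (1 - cos (l - m)) * (cmod (D m))\<^sup>2 \<le> 4"
        unfolding norm_mult power_mult_distrib by simp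
      then show ?thesis by (simp only: mult.assoc)
    qed
    have "(vnorm n (\<lambda>i. act n toep (tvec l) i - complex_of_real (2 * pi * f l) * tvec l i))\<^sup>2
        \<le> 2 * pi * integral {-pi..pi} (\<lambda>m. (cmod (h m))\<^sup>2)"
      using Bessel_inequality[OF ch, of n] vnorm_cong[of n, OF r] by simp
    also have "integral {-pi..pi} (\<lambda>m. (cmod (h m))\<^sup>2) \<le> integral {-pi..pi} (\<lambda>m. e * (cmod (D m))\<^sup>2 + 2 * C)"
    proof (rule integral_le)
      fix m assume m: "m \<in> {-pi..pi}"
      have "(cmod (h m))\<^sup>2 = (f m - f l)\<^sup>2 * (cmod (D m))\<^sup>2"
        by (simp add: h_def norm_mult power_mult_distrib flip: of_real_diff)
      also have "\<dots> \<le> (e + C * (1 - cos (l - m))) * (cmod (D m))\<^sup>2"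
        by (intro mult_right_mono C(2) m l) simp
      also have "\<dots> = e * (cmod (D m))\<^sup>2 + C * ((1 - cos (l - m)) * (cmod (D m))\<^sup>2)"
        by (simp add: algebra_simps)
      also have "\<dots> \<le> e * (cmod (D m))\<^sup>2 + C * 2"
        by (intro add_left_mono mult_left_mono DF C(1))
      finally show "(cmod (h m))\<^sup>2 \<le> e * (cmod (D m))\<^sup>2 + 2 * C" by simp
    qed (intro integrable_continuous_real continuous_intros ch cD)+
    also have "\<dots> = e * (2 * pi * n) + 4 * pi * C"
      using has_integral_add[OF has_integral_mult_right[OF D2, of e] has_integral_const_real[of "2*C" "-pi" pi]]
      by (intro integral_unique) (simp add: mult.assoc)
    finally show ?thesis by (simp add: power2_eq_square algebra_simps)
  qed
  have "\<forall>\<^sub>F n in sequentially. 16 * pi\<^sup>2 * C / \<eta>\<^sup>2 \<le> real n"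
    using filterlim_real_sequentially by (simp add: filterlim_at_top)
  then show "\<forall>\<^sub>F n in sequentially. \<forall>l\<in>{-pi..pi}.
     vnorm n (\<lambda>i. act n toep (tvec l) i - complex_of_real (2 * pi * f l) * tvec l i) \<le> \<eta> * sqrt (real n)"
  proof eventually_elim
    case (elim n)
    then have "16 * pi\<^sup>2 * C \<le> \<eta>\<^sup>2 * n" using \<eta> by (simp add: field_simps)
    moreover have "4 * pi\<^sup>2 * e * n = \<eta>\<^sup>2 * n / 2" by (simp add: e_def)
    moreover have "(\<eta> * sqrt n)\<^sup>2 = \<eta>\<^sup>2 * n" by (simp add: power_mult_distrib)
    ultimately have *: "4 * pi\<^sup>2 * e * n + 8 * pi\<^sup>2 * C \<le> (\<eta> * sqrt n)\<^sup>2"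
      by linarith
    show ?case
    proof
      fix l assume "l \<in> {-pi..pi}"
      from order_trans[OF bound[OF this] *]
      show "vnorm n (\<lambda>i. act n toep (tvec l) i - complex_of_real (2 * pi * f l) * tvec l i) \<le> \<eta> * sqrt (real n)"
        by (rule power2_le_imp_le) (use \<eta> in simp)
    qed
  qed
qed

text \<open>Applying W to (I + bT)e = (1 + bF)e + br, with r the residual of T, gives We - we = -w b
  W r. Contraction of W bounds the right side by the residual of T.\<close>

lemma has_symbol_inverse:
  assumes b: "0 \<le> b"
    and left: "\<And>n x i. i < n \<Longrightarrow> act n (W n) (\<lambda>i. x i + complex_of_real b * act n toep x i) i = x i"
    and W: "\<And>n x. vnorm n (act n (W n) x) \<le> vnorm n x"
  shows "has_symbol W (\<lambda>l. 1 / (1 + b * (2 * pi * f l)))"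
  unfolding has_symbol_def
proof (intro allI impI)
  fix \<eta> :: real assume \<eta>: "0 < \<eta>"
  \<comment> \<open>b + 1 instead of b covers b = 0; the factor to be absorbed is w b \<le>
    b.\<close>
  have "0 < \<eta> / (b + 1)" using \<eta> b by simp
  from has_symbolD[OF has_symbol_toep this]
  show "\<forall>\<^sub>F n in sequentially. \<forall>l\<in>{-pi..pi}.
     vnorm n (\<lambda>i. act n (W n) (tvec l) i - complex_of_real (1 / (1 + b * (2 * pi * f l))) * tvec l i) \<le> \<eta> * sqrt (real n)"
  proof eventually_elim
    case (elim n)
    show ?case
    proof
      fix l assume l: "l \<in> {-pi..pi}"
      define F where "F = 2 * pi * f l"
      define w where "w = 1 / (1 + b * F)"
      have F: "0 \<le> b * F" using b nonneg by (simp add: F_def)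
      have w: "0 \<le> w" "w \<le> 1" and wF: "w * (1 + b * F) = 1" using F by (auto simp: w_def)
      define r where "r i = act n toep (tvec l) i - complex_of_real F * tvec l i" for i
      have r: "vnorm n r \<le> \<eta> / (b + 1) * sqrt n" using elim l by (simp add: r_def[abs_def] F_def)
      have step: "act n (W n) (tvec l) i - complex_of_real w * tvec l i
          = complex_of_real (- (w * b)) * act n (W n) r i" if i: "i < n" for i
      proof -
        have "tvec l i = act n (W n) (\<lambda>i. complex_of_real (1 + b * F) * tvec l i + complex_of_real b * r i) i"
          using left[OF i, of "tvec l"] by (simp add: r_def algebra_simps)
        also have "\<dots> = complex_of_real (1 + b * F) * act n (W n) (tvec l) i + complex_of_real b * act n (W n) r i"
          by (simp only: act_add act_scale)
        finally have eq: "tvec l i = \<dots>" .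
        have "complex_of_real w * tvec l i
            = complex_of_real (w * (1 + b * F)) * act n (W n) (tvec l) i + complex_of_real (w * b) * act n (W n) r i"
          by (subst eq) (simp add: algebra_simps)
        then show ?thesis unfolding wF by simp
      qed
      have "vnorm n (\<lambda>i. act n (W n) (tvec l) i - complex_of_real w * tvec l i)
          = vnorm n (\<lambda>i. complex_of_real (- (w * b)) * act n (W n) r i)"
        by (rule vnorm_cong) (rule step)
      also have "\<dots> = w * b * vnorm n (act n (W n) r)"
        using w b unfolding vnorm_scale norm_of_real by (simp add: abs_mult)
      also have "\<dots> \<le> 1 * (b + 1) * (\<eta> / (b + 1) * sqrt n)"
        using w b r W[of n r] by (intro mult_mono) auto
      also have "\<dots> = \<eta> * sqrt n" using b by simp
      finally show "vnorm n (\<lambda>i. act n (W n) (tvec l) i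
          - complex_of_real (1 / (1 + b * (2 * pi * f l))) * tvec l i) \<le> \<eta> * sqrt n"
        by (simp only: w_def F_def)
    qed
  qed
qed

end

section \<open>Spectral density of the sampled process\<close>

lemma C_nu_pos: "1/2 \<le> \<nu> \<Longrightarrow> 0 < C_nu \<nu>"
  unfolding C_nu_def by (intro divide_pos_pos mult_pos_pos Gamma_real_pos) auto

section \<open>Bounds for the unaliased spectral density\<close>

context
  fixes \<nu> :: real
  assumes \<nu>: "1/2 \<le> \<nu>"
begin

lemma g_star_pos: "0 < \<alpha> \<Longrightarrow> 0 < g_star \<nu> \<alpha> \<omega>"
  using C_nu_pos[OF \<nu>] unfolding g_star_def
  by (intro mult_pos_pos) (auto simp: add_pos_nonneg)

lemma g_star_minus: "g_star \<nu> \<alpha> (- \<omega>) = g_star \<nu> \<alpha> \<omega>"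
  by (simp add: g_star_def)

lemma continuous_g_star [continuous_intros]:
  assumes \<alpha>: "0 < \<alpha>" and h: "continuous_on A h"
  shows "continuous_on A (\<lambda>x. g_star \<nu> \<alpha> (h x))"
proof -
  have "\<alpha>\<^sup>2 + (h x)\<^sup>2 \<noteq> 0" for x
    using \<alpha> by (simp add: add_nonneg_eq_0_iff)
  then show ?thesis unfolding g_star_def by (intro continuous_intros h) auto
qed

lemma g_star_le:
  assumes \<alpha>: "0 < \<alpha>" and c: "0 < c" "c \<le> \<alpha>\<^sup>2 + \<omega>\<^sup>2"
  shows "g_star \<nu> \<alpha> \<omega> \<le> C_nu \<nu> * \<alpha> powr (2*\<nu>) * c powr (-(\<nu> + 1/2))"
  unfolding g_star_def using C_nu_pos[OF \<nu>] c \<nu>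
  by (intro mult_left_mono powr_mono2') auto

text \<open>The hypothesis on \<nu> makes the exponent \<nu> + 1/2 at least 1, so inverse squares
  dominate all densities.\<close>

lemma powr_le_inverse: "1 \<le> x \<Longrightarrow> x powr (-(\<nu> + 1/2)) \<le> 1 / x"
  using powr_mono[of "-(\<nu> + 1/2)" "-1" x] \<nu> by (simp add: powr_minus_divide)

text \<open>\<open>x\<close> and \<omega> are kept apart for two uses: x = k with \<omega> = l + 2 k
  pi gives summability over the aliases, x = \<omega> gives integrability.\<close>

lemma g_star_le_inverse_square:
  assumes \<alpha>: "0 < \<alpha>"
  obtains K where "0 < K" "\<And>x \<omega>. 1 + x\<^sup>2 \<le> D * (\<alpha>\<^sup>2 + \<omega>\<^sup>2) \<Longrightarrow> g_star \<nu> \<alpha> \<omega> \<le> K * (1 / (1 + x\<^sup>2))"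
proof (cases "0 < D")
  case D: True
  define K where "K = C_nu \<nu> * \<alpha> powr (2*\<nu>) * (1/D) powr (-(\<nu> + 1/2))"
  have K: "0 < K" using \<alpha> D C_nu_pos[OF \<nu>] by (simp add: K_def)
  have "g_star \<nu> \<alpha> \<omega> \<le> K * (1 / (1 + x\<^sup>2))" if "1 + x\<^sup>2 \<le> D * (\<alpha>\<^sup>2 + \<omega>\<^sup>2)" for x \<omega>
  proof -
    have 1: "1 \<le> 1 + x\<^sup>2" by simp
    have "g_star \<nu> \<alpha> \<omega> \<le> C_nu \<nu> * \<alpha> powr (2*\<nu>) * (1/D * (1 + x\<^sup>2)) powr (-(\<nu> + 1/2))"
      using that D by (intro g_star_le \<alpha>) (auto simp: field_simps add_pos_nonneg)
    also have "(1/D * (1 + x\<^sup>2)) powr (-(\<nu> + 1/2)) = (1/D) powr (-(\<nu> + 1/2)) * (1 + x\<^sup>2) powr (-(\<nu> + 1/2))"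
      by (rule powr_mult)
    finally have "g_star \<nu> \<alpha> \<omega> \<le> K * (1 + x\<^sup>2) powr (-(\<nu> + 1/2))"
      by (simp only: K_def mult.assoc)
    also have "\<dots> \<le> K * (1 / (1 + x\<^sup>2))"
      using K by (intro mult_left_mono powr_le_inverse 1) auto
    finally show ?thesis .
  qed
  then show ?thesis using K that by blast
next
  case False
  have "\<not> 1 + x\<^sup>2 \<le> D * (\<alpha>\<^sup>2 + \<omega>\<^sup>2)" for x \<omega> :: real
  proof -
    have "D * (\<alpha>\<^sup>2 + \<omega>\<^sup>2) \<le> 0" using False by (intro mult_nonpos_nonneg) auto
    moreover have "0 < 1 + x\<^sup>2" by (simp add: add_pos_nonneg)
    ultimately show ?thesis by linarith
  qed
  then show ?thesis using that[of 1] by auto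
qed

end

lemma summable_on_int_inverse_square: "(\<lambda>k::int. 1 / (1 + (real_of_int k)\<^sup>2)) summable_on UNIV"
proof -
  \<comment> \<open>c = 0 serves the nonnegative integers, c = 1 the negative ones written as -n -
    1.\<close>
  have nat: "(\<lambda>n::nat. 1 / (1 + (real n + c)\<^sup>2)) summable_on UNIV" if "0 \<le> c" for c :: real
  proof (rule norm_summable_imp_summable_on, rule summable_comparison_test_ev)
    show "summable (\<lambda>n. inverse (real n ^ 2))" by (rule inverse_power_summable) simp
    have "norm (norm (1 / (1 + (real n + c)\<^sup>2))) \<le> inverse (real n ^ 2)" if n: "1 \<le> n" for n
    proof -
      have "(real n)\<^sup>2 \<le> 1 + (real n + c)\<^sup>2"
        using power_mono[of "real n" "real n + c" 2] \<open>0 \<le> c\<close> by linarith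
      then have "1 / (1 + (real n + c)\<^sup>2) \<le> 1 / (real n)\<^sup>2"
        using n by (intro divide_left_mono) (auto intro!: mult_pos_pos add_pos_nonneg)
      then show ?thesis by (simp add: divide_inverse)
    qed
    then show "\<forall>\<^sub>F n in sequentially. norm (norm (1 / (1 + (real n + c)\<^sup>2))) \<le> inverse (real n ^ 2)"
      by (rule eventually_sequentiallyI)
  qed
  let ?f = "\<lambda>k::int. 1 / (1 + (real_of_int k)\<^sup>2)"
  have "?f summable_on (range int)"
    using nat[of 0] by (subst summable_on_reindex) (auto simp: o_def)
  moreover have "?f summable_on (range (\<lambda>n. - int n - 1))"
  proof (subst summable_on_reindex)
    have "?f (- int n - 1) = 1 / (1 + (real n + 1)\<^sup>2)" for n
      by (simp add: power2_eq_square algebra_simps)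
    then show "(?f \<circ> (\<lambda>n. - int n - 1)) summable_on UNIV"
      using nat[of 1] by (simp add: o_def)
  qed (auto intro!: injI)
  ultimately have "?f summable_on (range int \<union> range (\<lambda>n. - int n - 1))"
    by (rule summable_on_Un_disjoint) auto
  moreover have "range int \<union> range (\<lambda>n. - int n - 1) = UNIV"
  proof (intro equalityI subsetI UNIV_I)
    fix k :: int
    show "k \<in> range int \<union> range (\<lambda>n. - int n - 1)"
    proof (cases "0 \<le> k")
      case True
      then have "k = int (nat k)" by simp
      then show ?thesis by blast
    next
      case False
      then have "k = - int (nat (- k - 1)) - 1" by simp
      then show ?thesis by blast
    qed
  qed
  ultimately show ?thesis by simp
qed

lemma integrable_inverse_one_plus_square: "integrable lborel (\<lambda>x::real. K * (1 / (1 + x\<^sup>2)))"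
proof -
  have "integrable lborel (\<lambda>x. inverse (1 + x\<^sup>2) :: real)"
    using integrable_inverse_1_plus_square by (simp add: set_integrable_def einterval_def)
  then show ?thesis
    by (intro integrable_mult_right) (simp add: divide_inverse)
qed

text \<open>Passage from gauge integrals over growing intervals to the Lebesgue integral over the
  line, for the alias sum and for the integrated derivative of u a(u).\<close>

lemma integral_symmetric_tendsto:
  fixes F :: "real \<Rightarrow> real"
  assumes cont: "continuous_on UNIV F" and intF: "integrable lborel F"
    and b: "filterlim b at_top sequentially"
  shows "(\<lambda>N::nat. integral {- b N..b N} F) \<longlonglongrightarrow> (\<integral>\<omega>. F \<omega> \<partial>lborel)"
proof -
  have "integral {- b N..b N} F = (\<integral>\<omega>. indicator {- b N..b N} \<omega> *\<^sub>R F \<omega> \<partial>lborel)" for N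
  proof -
    have "set_integrable lborel {- b N..b N} F"
      unfolding set_integrable_def by (rule integrable_mult_indicator[OF _ intF]) simp
    from set_borel_integral_eq_integral(2)[OF this] show ?thesis
      by (simp add: set_lebesgue_integral_def)
  qed
  moreover have "(\<lambda>N. \<integral>\<omega>. indicator {- b N..b N} \<omega> *\<^sub>R F \<omega> \<partial>lborel) \<longlonglongrightarrow> (\<integral>\<omega>. F \<omega> \<partial>lborel)"
  proof (rule integral_dominated_convergence[where w = "\<lambda>\<omega>. \<bar>F \<omega>\<bar>"])
    show "AE \<omega> in lborel. (\<lambda>N. indicator {- b N..b N} \<omega> *\<^sub>R F \<omega>) \<longlonglongrightarrow> F \<omega>"
    proof (rule AE_I2)
      fix \<omega>
      have "\<forall>\<^sub>F N in sequentially. \<bar>\<omega>\<bar> \<le> b N"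
        using b by (simp add: filterlim_at_top)
      then have "\<forall>\<^sub>F N in sequentially. indicator {- b N..b N} \<omega> *\<^sub>R F \<omega> = F \<omega>"
        by eventually_elim (simp add: abs_le_iff minus_le_iff)
      then show "(\<lambda>N. indicator {- b N..b N} \<omega> *\<^sub>R F \<omega>) \<longlonglongrightarrow> F \<omega>"
        by (rule tendsto_eventually)
    qed
  qed (use intF in \<open>auto simp: indicator_def\<close>)
  ultimately show ?thesis by simp
qed

section \<open>The aliased spectral density and its Fourier coefficients\<close>

context
  fixes \<nu> \<delta> \<theta> :: real
  assumes \<nu>: "1/2 \<le> \<nu>" and \<delta>: "0 < \<delta>" and \<theta>: "0 < \<theta>"
begin

lemma scaled_rate_pos: "0 < \<delta> * \<theta>" using \<delta> \<theta> by simp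

text \<open>From 2 pi > 1 one gets |k| \<le> |l + 2 k pi| + L, so the shifted frequency grows like k
  uniformly for |l| \<le> L. This is the majorant for the Weierstrass test.\<close>

lemma g_star_shift_bound:
  obtains K where "0 < K"
    "\<And>k l. \<bar>l\<bar> \<le> L \<Longrightarrow> g_star \<nu> (\<delta>*\<theta>) (l + 2 * of_int k * pi) \<le> K * (1 / (1 + (real_of_int k)\<^sup>2))"
proof -
  let ?a = "\<delta>*\<theta>"
  \<comment> \<open>In 1 + k^2 \<le> (1 + 2L^2) + 2w^2, where w is the shifted frequency, the first
    entry of the maximum covers the factor 2 of w^2, the second the constant.\<close>
  define D where "D = max 2 ((1 + 2 * L\<^sup>2) / ?a\<^sup>2)"
  obtain K where K: "0 < K"
    "\<And>x \<omega>. 1 + x\<^sup>2 \<le> D * (?a\<^sup>2 + \<omega>\<^sup>2) \<Longrightarrow> g_star \<nu> ?a \<omega> \<le> K * (1 / (1 + x\<^sup>2))"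
    using g_star_le_inverse_square[OF \<nu> scaled_rate_pos] by blast
  have "1 + (real_of_int k)\<^sup>2 \<le> D * (?a\<^sup>2 + (l + 2 * of_int k * pi)\<^sup>2)" if l: "\<bar>l\<bar> \<le> L" for k l
  proof -
    let ?w = "l + 2 * of_int k * pi"
    have "\<bar>real_of_int k\<bar> * 1 \<le> \<bar>real_of_int k\<bar> * (2 * pi)"
      using pi_gt3 by (intro mult_left_mono) auto
    also have "\<dots> = \<bar>?w - l\<bar>" by (simp add: abs_mult mult_ac)
    also have "\<dots> \<le> \<bar>?w\<bar> + L" using l by linarith
    finally have "(real_of_int k)\<^sup>2 \<le> (\<bar>?w\<bar> + L)\<^sup>2"
      by (metis abs_ge_zero mult_1_right power2_abs power_mono)
    also have "\<dots> \<le> 2 * ?w\<^sup>2 + 2 * L\<^sup>2"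
      using zero_le_power2[of "\<bar>?w\<bar> - L"] by (simp add: power2_eq_square algebra_simps)
    finally have "1 + (real_of_int k)\<^sup>2 \<le> (1 + 2 * L\<^sup>2) + 2 * ?w\<^sup>2" by simp
    also have "\<dots> \<le> D * ?a\<^sup>2 + D * ?w\<^sup>2"
    proof (rule add_mono)
      have "(1 + 2 * L\<^sup>2) / ?a\<^sup>2 \<le> D" by (simp add: D_def)
      then show "1 + 2 * L\<^sup>2 \<le> D * ?a\<^sup>2" using scaled_rate_pos by (subst (asm) pos_divide_le_eq) auto
      show "2 * ?w\<^sup>2 \<le> D * ?w\<^sup>2" by (intro mult_right_mono) (auto simp: D_def)
    qed
    finally show ?thesis by (simp only: distrib_left)
  qed
  then show ?thesis using K that by blast
qed

lemma summable_g_star: "(\<lambda>k::int. g_star \<nu> (\<delta>*\<theta>) (l + 2 * of_int k * pi)) summable_on A"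
proof -
  obtain K where K: "0 < K"
    "\<And>k l'. \<bar>l'\<bar> \<le> \<bar>l\<bar> \<Longrightarrow> g_star \<nu> (\<delta>*\<theta>) (l' + 2 * of_int k * pi) \<le> K * (1 / (1 + (real_of_int k)\<^sup>2))"
    using g_star_shift_bound by blast
  have "(\<lambda>k::int. g_star \<nu> (\<delta>*\<theta>) (l + 2 * of_int k * pi)) summable_on UNIV"
  proof (rule summable_on_comparison_test)
    show "(\<lambda>k::int. K * (1 / (1 + (real_of_int k)\<^sup>2))) summable_on UNIV"
      by (intro summable_on_cmult_right summable_on_int_inverse_square)
  qed (use K less_imp_le[OF g_star_pos[OF \<nu> scaled_rate_pos]] in auto)
  then show ?thesis by (rule summable_on_subset) simp
qed

text \<open>The factor \<open>c\<close> lets one statement serve for continuity (c = 1) and for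
  Fourier coefficients (c a cosine).\<close>

lemma uniform_limit_g_delta:
  assumes c: "\<And>l. \<bar>c l\<bar> \<le> 1"
  shows "uniform_limit {-L..L} (\<lambda>A l. \<Sum>k\<in>A. g_star \<nu> (\<delta>*\<theta>) (l + 2 * of_int k * pi) * c l)
     (\<lambda>l. g_delta \<nu> \<delta> \<theta> l * c l) (finite_subsets_at_top UNIV)"
proof -
  obtain K where K: "0 < K"
    "\<And>k l'. \<bar>l'\<bar> \<le> L \<Longrightarrow> g_star \<nu> (\<delta>*\<theta>) (l' + 2 * of_int k * pi) \<le> K * (1 / (1 + (real_of_int k)\<^sup>2))"
    using g_star_shift_bound by blast
  show ?thesis
    unfolding g_delta_def[abs_def] infsum_cmult_left'[symmetric]
  proof (rule Weierstrass_m_test_general)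
    show "(\<lambda>k::int. K * (1 / (1 + (real_of_int k)\<^sup>2))) summable_on UNIV"
      by (intro summable_on_cmult_right summable_on_int_inverse_square)
    fix k l assume "l \<in> {-L..L}"
    then have l: "\<bar>l\<bar> \<le> L" by auto
    let ?g = "g_star \<nu> (\<delta>*\<theta>) (l + 2 * of_int k * pi)"
    have g: "0 < ?g" by (rule g_star_pos[OF \<nu> scaled_rate_pos])
    have "norm (?g * c l) = ?g * \<bar>c l\<bar>" using g by (simp add: abs_mult)
    also have "\<dots> \<le> ?g * 1" using g by (intro mult_left_mono c) simp
    also have "\<dots> \<le> K * (1 / (1 + (real_of_int k)\<^sup>2))" using K(2)[OF l, of k] by simp
    finally show "norm (?g * c l) \<le> K * (1 / (1 + (real_of_int k)\<^sup>2))" .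
  qed
qed

lemma continuous_g_delta: "continuous_on UNIV (g_delta \<nu> \<delta> \<theta>)"
proof -
  have "isCont (g_delta \<nu> \<delta> \<theta>) x" for x
  proof -
    define L where "L = \<bar>x\<bar> + 1"
    have "continuous_on {-L..L} (g_delta \<nu> \<delta> \<theta>)"
    proof (rule uniform_limit_theorem)
      show "uniform_limit {-L..L} (\<lambda>A l. \<Sum>k\<in>A. g_star \<nu> (\<delta>*\<theta>) (l + 2 * of_int k * pi))
          (g_delta \<nu> \<delta> \<theta>) (finite_subsets_at_top UNIV)"
        using uniform_limit_g_delta[of "\<lambda>_. 1" L] by simp
    qed (auto intro!: always_eventually continuous_intros \<nu> scaled_rate_pos)
    then show ?thesis
      by (rule continuous_on_interior) (auto simp: L_def)
  qed
  then show ?thesis by (simp add: continuous_at_imp_continuous_on)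
qed

lemma g_delta_periodic: "g_delta \<nu> \<delta> \<theta> (l + 2 * pi) = g_delta \<nu> \<delta> \<theta> l"
  unfolding g_delta_def
  by (rule infsum_reindex_bij_witness[of _ "\<lambda>k. k - 1" "\<lambda>k. k + 1"]) (auto simp: algebra_simps)

lemma g_delta_minus: "g_delta \<nu> \<delta> \<theta> (- l) = g_delta \<nu> \<delta> \<theta> l"
  unfolding g_delta_def
proof (rule infsum_reindex_bij_witness[of _ uminus uminus])
  fix k :: int
  show "g_star \<nu> (\<delta> * \<theta>) (l + 2 * real_of_int (- k) * pi) = g_star \<nu> (\<delta> * \<theta>) (- l + 2 * real_of_int k * pi)"
    using g_star_minus[OF \<nu>, of "\<delta> * \<theta>" "- l + 2 * real_of_int k * pi"] by simp
qed auto

lemma g_delta_ge_g_star: "g_star \<nu> (\<delta>*\<theta>) l \<le> g_delta \<nu> \<delta> \<theta> l"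
proof -
  have "infsum (\<lambda>k::int. g_star \<nu> (\<delta>*\<theta>) (l + 2 * of_int k * pi)) {0} \<le> g_delta \<nu> \<delta> \<theta> l"
    unfolding g_delta_def
    using less_imp_le[OF g_star_pos[OF \<nu> scaled_rate_pos]]
    by (intro infsum_mono_neutral summable_g_star) auto
  then show ?thesis by simp
qed

lemma g_delta_pos: "0 < g_delta \<nu> \<delta> \<theta> l"
  using g_star_pos[OF \<nu> scaled_rate_pos, of l] g_delta_ge_g_star[of l] by linarith

text \<open>On the base period each alias k \<noteq> 0 stays at distance at least |k| from the peak
  at frequency 0, so together they are O((\<delta>\<theta>)^(2\<nu>)) uniformly in l.\<close>

lemma g_delta_le:
  assumes l: "\<bar>l\<bar> \<le> pi"
  shows "g_delta \<nu> \<delta> \<theta> l \<le> g_star \<nu> (\<delta>*\<theta>) l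
     + 2 * C_nu \<nu> * (\<delta>*\<theta>) powr (2*\<nu>) * (\<Sum>\<^sub>\<infinity>k::int. 1 / (1 + (real_of_int k)\<^sup>2))"
proof -
  let ?g = "\<lambda>k::int. g_star \<nu> (\<delta>*\<theta>) (l + 2 * of_int k * pi)"
  let ?c = "2 * C_nu \<nu> * (\<delta>*\<theta>) powr (2*\<nu>)"
  have c: "0 < ?c" using C_nu_pos[OF \<nu>] \<delta> \<theta> by simp
  have "g_delta \<nu> \<delta> \<theta> l = infsum ?g ({0} \<union> - {0})"
    by (simp add: g_delta_def)
  also have "\<dots> = infsum ?g {0} + infsum ?g (- {0})"
    by (intro infsum_Un_disjoint summable_g_star) auto
  also have "infsum ?g {0} = g_star \<nu> (\<delta>*\<theta>) l" by simp
  also have "infsum ?g (- {0}) \<le> (\<Sum>\<^sub>\<infinity>k::int. ?c * (1 / (1 + (real_of_int k)\<^sup>2)))"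
  proof (rule infsum_mono_neutral)
    show "(\<lambda>k::int. ?c * (1 / (1 + (real_of_int k)\<^sup>2))) summable_on UNIV"
      by (intro summable_on_cmult_right summable_on_int_inverse_square)
    fix k :: int assume "k \<in> - {0} \<inter> UNIV"
    then have k: "1 \<le> \<bar>real_of_int k\<bar>" by auto
    let ?w = "l + 2 * of_int k * pi"
    have k2: "1 \<le> (real_of_int k)\<^sup>2" using k by (metis one_le_power power2_abs)
    \<comment> \<open>Chain |k| \<le> pi |k| \<le> 2 pi |k| - pi \<le> |l + 2 k pi|; the middle step
      uses |k| \<ge> 1, the last |l| \<le> pi.\<close>
    have "\<bar>real_of_int k\<bar> * 1 \<le> \<bar>real_of_int k\<bar> * pi"
      using pi_gt3 by (intro mult_left_mono) auto
    also have "\<dots> \<le> 2 * (\<bar>real_of_int k\<bar> * pi) - pi"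
      using mult_right_mono[OF k pi_ge_zero] by simp
    also have "\<dots> \<le> \<bar>?w\<bar>"
    proof -
      have "\<bar>?w - l\<bar> = 2 * (\<bar>real_of_int k\<bar> * pi)" by (simp add: abs_mult)
      then show ?thesis using l by linarith
    qed
    finally have "(real_of_int k)\<^sup>2 \<le> ?w\<^sup>2"
      by (metis abs_ge_zero mult_1_right power2_abs power_mono)
    then have "?g k \<le> C_nu \<nu> * (\<delta>*\<theta>) powr (2*\<nu>) * ((real_of_int k)\<^sup>2) powr (-(\<nu> + 1/2))"
      using k2 by (intro g_star_le[OF \<nu> scaled_rate_pos]) (auto intro: add_increasing)
    also have "\<dots> \<le> C_nu \<nu> * (\<delta>*\<theta>) powr (2*\<nu>) * (2 * (1 / (1 + (real_of_int k)\<^sup>2)))"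
    proof (intro mult_left_mono)
      have "((real_of_int k)\<^sup>2) powr (-(\<nu> + 1/2)) \<le> 1 / (real_of_int k)\<^sup>2"
        by (rule powr_le_inverse[OF \<nu> k2])
      also have "\<dots> \<le> 2 / (1 + (real_of_int k)\<^sup>2)"
        using k2 by (simp add: frac_le_eq divide_simps)
      finally show "((real_of_int k)\<^sup>2) powr (-(\<nu> + 1/2)) \<le> 2 * (1 / (1 + (real_of_int k)\<^sup>2))" by simp
    qed (use c in auto)
    finally show "?g k \<le> ?c * (1 / (1 + (real_of_int k)\<^sup>2))" by (simp only: mult_ac)
  next
    show "?g summable_on - {0}" by (rule summable_g_star)
  qed (use c in auto)
  also have "\<dots> = ?c * (\<Sum>\<^sub>\<infinity>k::int. 1 / (1 + (real_of_int k)\<^sup>2))"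
    by (rule infsum_cmult_right')
  finally show ?thesis by simp
qed

lemma integrable_g_star: "integrable lborel (g_star \<nu> (\<delta>*\<theta>))"
proof -
  let ?a = "\<delta>*\<theta>"
  define D where "D = max 1 (1 / ?a\<^sup>2)"
  obtain K where K: "0 < K"
    "\<And>x \<omega>. 1 + x\<^sup>2 \<le> D * (?a\<^sup>2 + \<omega>\<^sup>2) \<Longrightarrow> g_star \<nu> ?a \<omega> \<le> K * (1 / (1 + x\<^sup>2))"
    using g_star_le_inverse_square[OF \<nu> scaled_rate_pos] by blast
  have le: "g_star \<nu> ?a \<omega> \<le> K * (1 / (1 + \<omega>\<^sup>2))" for \<omega>
  proof (rule K(2))
    have "1 / ?a\<^sup>2 \<le> D" by (simp add: D_def)
    then have "1 \<le> D * ?a\<^sup>2" using scaled_rate_pos by (subst (asm) pos_divide_le_eq) auto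
    moreover have "1 * \<omega>\<^sup>2 \<le> D * \<omega>\<^sup>2" by (intro mult_right_mono) (auto simp: D_def)
    ultimately show "1 + \<omega>\<^sup>2 \<le> D * (?a\<^sup>2 + \<omega>\<^sup>2)" by (simp only: distrib_left mult_1)
  qed
  show ?thesis
  proof (rule Bochner_Integration.integrable_bound[OF integrable_inverse_one_plus_square[of K]])
    show "g_star \<nu> ?a \<in> borel_measurable lborel"
      by (auto intro!: borel_measurable_continuous_onI continuous_intros \<nu> scaled_rate_pos)
    show "AE x in lborel. norm (g_star \<nu> ?a x) \<le> norm (K * (1 / (1 + x\<^sup>2)))"
    proof (rule AE_I2)
      fix x
      show "norm (g_star \<nu> ?a x) \<le> norm (K * (1 / (1 + x\<^sup>2)))"
        using le[of x] g_star_pos[OF \<nu> scaled_rate_pos, of x] K(1) by simp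
    qed
  qed
qed

text \<open>Unfolding: for integer m the cosine has period 2 pi, so integrating the alias sum over
  one period tiles the integral of a single function over the line.\<close>

lemma integral_g_delta_cos:
  fixes m :: int
  shows "integral {-pi..pi} (\<lambda>l. g_delta \<nu> \<delta> \<theta> l * cos (of_int m * l))
     = (\<integral>\<omega>. g_star \<nu> (\<delta>*\<theta>) \<omega> * cos (of_int m * \<omega>) \<partial>lborel)"
proof -
  define F where "F \<omega> = g_star \<nu> (\<delta>*\<theta>) \<omega> * cos (of_int m * \<omega>)" for \<omega>
  \<comment> \<open>Right end of the union of the tiles with |k| \<le> N, each of length 2 pi and
    centred at 2 k pi.\<close>
  define b where "b N = (2 * real N + 1) * pi" for N
  have contF: "continuous_on A F" for A
    unfolding F_def by (intro continuous_intros \<nu> scaled_rate_pos)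
  have shift: "g_star \<nu> (\<delta>*\<theta>) (l + 2 * of_int k * pi) * cos (of_int m * l) = F (2 * of_int k * pi + l)" for k l
  proof -
    have "cos (of_int m * (2 * of_int k * pi + l)) = cos (of_int m * l + 2 * of_int (m * k) * pi)"
      by (simp add: algebra_simps)
    also have "\<dots> = cos (of_int m * l)"
      using cos_int_2pin[of "m * k"] sin_int_2pin[of "m * k"] by (simp add: cos_add mult_ac)
    finally show ?thesis by (simp add: F_def add.commute)
  qed
  have seg: "integral {-pi..pi} (\<lambda>l. F (2 * of_int k * pi + l)) = integral {(2 * of_int k - 1) * pi..(2 * of_int k + 1) * pi} F"
    for k :: int
    using integral_shift_Icc_real[of "-pi" pi F "2 * of_int k * pi"]
    by (simp add: o_def algebra_simps)
  have partial: "(\<Sum>k\<in>{- int N..int N}. integral {-pi..pi} (\<lambda>l. F (2 * of_int k * pi + l)))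
      = integral {- b N..b N} F" for N
  proof (induction N)
    case (Suc N)
    have b0: "0 \<le> b N" and bmono: "b N \<le> b (Suc N)" for N
      by (simp_all add: b_def)
    have int: "F integrable_on {u..v}" for u v
      by (intro integrable_continuous_real contF)
    have "{- int (Suc N)..int (Suc N)} = insert (int N + 1) (insert (- int N - 1) {- int N..int N})"
      by auto
    then have "(\<Sum>k\<in>{- int (Suc N)..int (Suc N)}. integral {-pi..pi} (\<lambda>l. F (2 * of_int k * pi + l)))
        = integral {-pi..pi} (\<lambda>l. F (2 * of_int (int N + 1) * pi + l))
        + (integral {-pi..pi} (\<lambda>l. F (2 * of_int (- int N - 1) * pi + l)) + integral {- b N..b N} F)"
      by (simp add: Suc)
    also have "integral {-pi..pi} (\<lambda>l. F (2 * of_int (int N + 1) * pi + l)) = integral {b N..b (Suc N)} F"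
    proof -
      have "(2 * real_of_int (int N + 1) - 1) * pi = b N" "(2 * real_of_int (int N + 1) + 1) * pi = b (Suc N)"
        by (simp_all add: b_def algebra_simps)
      then show ?thesis unfolding seg by (simp only:)
    qed
    also have "integral {-pi..pi} (\<lambda>l. F (2 * of_int (- int N - 1) * pi + l)) = integral {- b (Suc N)..- b N} F"
    proof -
      have "(2 * real_of_int (- int N - 1) - 1) * pi = - b (Suc N)" "(2 * real_of_int (- int N - 1) + 1) * pi = - b N"
        by (simp_all add: b_def algebra_simps)
      then show ?thesis unfolding seg by (simp only:)
    qed
    also have "integral {- b (Suc N)..- b N} F + integral {- b N..b N} F = integral {- b (Suc N)..b N} F"
      by (rule Henstock_Kurzweil_Integration.integral_combine) (use b0[of N] bmono[of N] int in auto)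
    also have "integral {b N..b (Suc N)} F + integral {- b (Suc N)..b N} F = integral {- b (Suc N)..b (Suc N)} F"
      by (subst add.commute, rule Henstock_Kurzweil_Integration.integral_combine) (use b0[of N] bmono[of N] int in auto)
    finally show ?case .
  qed (simp add: b_def)
  obtain I J where IJ: "\<And>A. ((\<lambda>l. \<Sum>k\<in>A. g_star \<nu> (\<delta>*\<theta>) (l + 2 * of_int k * pi) * cos (of_int m * l)) has_integral I A) {-pi..pi}"
    "((\<lambda>l. g_delta \<nu> \<delta> \<theta> l * cos (of_int m * l)) has_integral J) {-pi..pi}"
    "(I \<longlongrightarrow> J) (finite_subsets_at_top UNIV)"
  proof (rule uniform_limit_integral[OF uniform_limit_g_delta[of "\<lambda>l. cos (of_int m * l)" pi]])
    show "continuous_on {-pi..pi} (\<lambda>l. \<Sum>k\<in>A. g_star \<nu> (\<delta>*\<theta>) (l + 2 * of_int k * pi) * cos (of_int m * l))" for A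
      by (intro continuous_intros \<nu> scaled_rate_pos)
  qed (use that in auto)
  have I: "I {- int N..int N} = integral {- b N..b N} F" for N
  proof -
    have "((\<lambda>l. \<Sum>k\<in>{- int N..int N}. F (2 * of_int k * pi + l)) has_integral
        (\<Sum>k\<in>{- int N..int N}. integral {-pi..pi} (\<lambda>l. F (2 * of_int k * pi + l)))) {-pi..pi}"
      by (intro has_integral_sum integrable_integral integrable_continuous_real
          continuous_on_compose2[OF contF[of UNIV]] continuous_intros) auto
    with IJ(1)[of "{- int N..int N}"] show ?thesis
      unfolding shift partial by (rule has_integral_unique)
  qed
  \<comment> \<open>The alias series converges along finite subsets of the integers. The symmetric
    blocks are cofinal among these, which turns the limit into that of the integrals over growing
    symmetric intervals.\<close>
  have "filterlim (\<lambda>N. {- int N..int N}) (finite_subsets_at_top UNIV) sequentially"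
    unfolding filterlim_finite_subsets_at_top
  proof (intro allI impI)
    fix X :: "int set" assume X: "finite X \<and> X \<subseteq> UNIV"
    have "\<bar>x\<bar> \<le> (\<Sum>x\<in>X. \<bar>x\<bar>)" if "x \<in> X" for x
      using X that by (intro member_le_sum) auto
    then have "\<forall>N\<ge>nat (\<Sum>x\<in>X. \<bar>x\<bar>). X \<subseteq> {- int N..int N}"
      by (fastforce simp: nat_le_iff)
    then show "\<forall>\<^sub>F N in sequentially. finite {- int N..int N} \<and> X \<subseteq> {- int N..int N} \<and> {- int N..int N} \<subseteq> UNIV"
      unfolding eventually_sequentially by auto
  qed
  from filterlim_compose[OF IJ(3) this]
  have "(\<lambda>N. integral {- b N..b N} F) \<longlonglongrightarrow> J" by (simp add: I)
  moreover have "(\<lambda>N. integral {- b N..b N} F) \<longlonglongrightarrow> (\<integral>\<omega>. F \<omega> \<partial>lborel)"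
  proof -
    have intF: "integrable lborel F"
    proof (rule Bochner_Integration.integrable_bound[OF integrable_g_star])
      show "F \<in> borel_measurable lborel"
        using borel_measurable_continuous_onI[OF contF] by simp
      show "AE x in lborel. norm (F x) \<le> norm (g_star \<nu> (\<delta>*\<theta>) x)"
        by (rule AE_I2) (simp add: F_def abs_mult mult_left_le)
    qed
    have "filterlim b at_top sequentially"
    proof (rule filterlim_at_top_mono[OF filterlim_real_sequentially], rule always_eventually, rule allI)
      fix N
      have "real N \<le> (2 * real N + 1) * 1" by simp
      also have "\<dots> \<le> b N" unfolding b_def using pi_gt3 by (intro mult_left_mono) auto
      finally show "real N \<le> b N" .
    qed
    then show ?thesis
      by (rule integral_symmetric_tendsto[OF contF intF])
  qed
  ultimately have "J = (\<integral>\<omega>. F \<omega> \<partial>lborel)" by (rule LIMSEQ_unique)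
  then show ?thesis
    using IJ(2) by (simp add: integral_unique F_def)
qed

text \<open>Substituting \<delta>\<omega> for \<omega>, together with the homogeneity \<delta>
  g(\<delta>\<theta>; \<delta>\<omega>) = g(\<theta>; \<omega>) of \<open>g_star\<close>, moves the
  sampling interval from the time argument into the rate. The sampled covariances are thus Fourier
  coefficients of the aliased density.\<close>

lemma K_cov_eq_integral_g_delta:
  fixes m :: int
  shows "K_cov \<nu> \<theta> (\<delta> * of_int m) = integral {-pi..pi} (\<lambda>l. g_delta \<nu> \<delta> \<theta> l * cos (of_int m * l))"
proof -
  have scale: "\<delta> * g_star \<nu> (\<delta>*\<theta>) (\<delta> * \<omega>) = g_star \<nu> \<theta> \<omega>" for \<omega>
  proof -
    have "0 < \<theta>\<^sup>2 + \<omega>\<^sup>2" using \<theta> by (simp add: add_pos_nonneg)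
    then have 1: "((\<delta>*\<theta>)\<^sup>2 + (\<delta>*\<omega>)\<^sup>2) powr (-(\<nu> + 1/2)) = (\<delta>\<^sup>2) powr (-(\<nu> + 1/2)) * (\<theta>\<^sup>2 + \<omega>\<^sup>2) powr (-(\<nu> + 1/2))"
      by (subst powr_mult[symmetric]) (auto simp: power_mult_distrib distrib_left)
    have 2: "(\<delta>\<^sup>2) powr (-(\<nu> + 1/2)) = \<delta> powr (- (2 * \<nu>) - 1)"
      using \<delta> by (simp add: powr_powr algebra_simps flip: powr_numeral)
    have 3: "\<delta> * (\<delta> powr (2 * \<nu>) * \<delta> powr (- (2 * \<nu>) - 1)) = 1"
      using \<delta> by (simp add: powr_add[symmetric] powr_minus)
    have 4: "(\<delta>*\<theta>) powr (2*\<nu>) = \<delta> powr (2*\<nu>) * \<theta> powr (2*\<nu>)"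
      by (rule powr_mult)
    have "\<delta> * g_star \<nu> (\<delta>*\<theta>) (\<delta> * \<omega>)
        = (\<delta> * (\<delta> powr (2 * \<nu>) * \<delta> powr (- (2 * \<nu>) - 1))) * g_star \<nu> \<theta> \<omega>"
      unfolding g_star_def 1 2 4 by (simp only: mult_ac)
    then show ?thesis unfolding 3 by simp
  qed
  have "(\<integral>\<omega>. g_star \<nu> (\<delta>*\<theta>) \<omega> * cos (of_int m * \<omega>) \<partial>lborel)
      = \<delta> * (\<integral>\<omega>. g_star \<nu> (\<delta>*\<theta>) (\<delta> * \<omega>) * cos (of_int m * (\<delta> * \<omega>)) \<partial>lborel)"
    using lborel_integral_real_affine[of \<delta> "\<lambda>\<omega>. g_star \<nu> (\<delta>*\<theta>) \<omega> * cos (of_int m * \<omega>)" 0] \<delta> by simp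
  also have "\<dots> = (\<integral>\<omega>. \<delta> * (g_star \<nu> (\<delta>*\<theta>) (\<delta> * \<omega>) * cos (of_int m * (\<delta> * \<omega>))) \<partial>lborel)"
    by simp
  also have "\<dots> = K_cov \<nu> \<theta> (\<delta> * of_int m)"
    unfolding K_cov_def mult.assoc[symmetric] scale by (simp add: mult_ac)
  finally show ?thesis by (simp add: integral_g_delta_cos)
qed

end

section \<open>The limit of small sampling intervals\<close>

text \<open>Integrating the derivative of \<open>u * a u\<close> over the line yields the ratio of the two integrals
  without evaluating either.\<close>
lemma integral_square_ratio:
  fixes B q :: real
  assumes B: "0 < B" and q: "1 \<le> q"
  defines "a \<equiv> \<lambda>u. B / (B + (u\<^sup>2) powr q)"
  shows "integrable lborel a" "integrable lborel (\<lambda>u. (a u)\<^sup>2)" "0 < (\<integral>u. a u \<partial>lborel)"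
    "2 * q * (\<integral>u. (a u)\<^sup>2 \<partial>lborel) = (2 * q - 1) * (\<integral>u. a u \<partial>lborel)"
proof -
  have den: "0 < B + (u\<^sup>2) powr q" for u :: real using B by (simp add: add_pos_nonneg)
  have cont: "continuous_on UNIV a"
  proof -
    have "continuous_on UNIV (\<lambda>u::real. (u\<^sup>2) powr q)"
      using q by (intro continuous_on_powr' continuous_intros) auto
    moreover have "B + (u\<^sup>2) powr q \<noteq> 0" for u :: real using den[of u] by simp
    ultimately show ?thesis
      unfolding a_def by (intro continuous_on_divide continuous_on_add continuous_on_const) auto
  qed
  have a0: "0 < a u" and a1: "a u \<le> 1" for u
    using den[of u] B by (auto simp: a_def)
  \<comment> \<open>For |u| \<le> 1 the bound is a \<le> 1 \<le> 2/(1 + u^2); otherwise a \<le>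
    B/u^2 \<le> 2B/(1 + u^2).\<close>
  define K where "K = 2 * max 1 B"
  have le: "a u \<le> K * (1 / (1 + u\<^sup>2))" for u
  proof (cases "\<bar>u\<bar> \<le> 1")
    case True
    then have "u\<^sup>2 \<le> 1" by (simp add: abs_square_le_1)
    then have "1 \<le> 2 * (1 / (1 + u\<^sup>2))" by (simp add: field_simps add_pos_nonneg)
    also have "\<dots> \<le> K * (1 / (1 + u\<^sup>2))" by (intro mult_right_mono) (auto simp: K_def)
    finally show ?thesis using a1[of u] by linarith
  next
    case False
    then have u: "1 \<le> u\<^sup>2" using one_le_power[of "\<bar>u\<bar>" 2] by simp
    have "u\<^sup>2 \<le> (u\<^sup>2) powr q" using powr_mono[of 1 q "u\<^sup>2"] u q by simp
    then have "a u \<le> B / u\<^sup>2"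
      unfolding a_def using B u by (intro divide_left_mono mult_pos_pos den) auto
    also have "\<dots> \<le> B * (2 / (1 + u\<^sup>2))"
    proof -
      have "1 / u\<^sup>2 \<le> 2 / (1 + u\<^sup>2)" using u by (simp add: frac_le_eq divide_simps)
      from mult_left_mono[OF this, of B] B show ?thesis by simp
    qed
    also have "\<dots> \<le> K * (1 / (1 + u\<^sup>2))"
      by (simp add: K_def divide_right_mono)
    finally show ?thesis .
  qed
  have meas: "a \<in> borel_measurable lborel"
    using borel_measurable_continuous_onI[OF cont] by simp
  show int1: "integrable lborel a"
  proof (rule Bochner_Integration.integrable_bound[OF integrable_inverse_one_plus_square[of K]])
    show "AE x in lborel. norm (a x) \<le> norm (K * (1 / (1 + x\<^sup>2)))"
      using le a0 by (intro AE_I2) (smt (verit) real_norm_def)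
  qed (rule meas)
  show int2: "integrable lborel (\<lambda>u. (a u)\<^sup>2)"
  proof (rule Bochner_Integration.integrable_bound[OF int1])
    have "(a x)\<^sup>2 \<le> a x" for x
      using mult_left_mono[OF a1[of x], of "a x"] a0[of x] by (simp add: power2_eq_square)
    then show "AE x in lborel. norm ((a x)\<^sup>2) \<le> norm (a x)"
      using a0 by (intro AE_I2) (smt (verit) real_norm_def zero_le_power2)
  qed (use meas in measurable)
  show "0 < (\<integral>u. a u \<partial>lborel)"
  proof -
    have "(\<integral>u. a u \<partial>lborel) \<noteq> 0"
    proof
      assume "(\<integral>u. a u \<partial>lborel) = 0"
      then have "AE u in lborel. a u = 0"
        using int1 a0 by (subst (asm) integral_nonneg_eq_0_iff_AE) (auto intro: less_imp_le)
      then have "AE u in lborel :: real measure. False"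
      proof (rule eventually_mono)
        fix u assume "a u = 0"
        then show False using a0[of u] by simp
      qed
      then show False
        by (simp add: eventually_False ae_filter_eq_bot_iff)
    qed
    moreover have "0 \<le> (\<integral>u. a u \<partial>lborel)"
      using a0 by (intro integral_nonneg_AE AE_I2) (auto intro: less_imp_le)
    ultimately show ?thesis by simp
  qed
  \<comment> \<open>The derivative of u a(u), obtained from u a'(u) = -2q a (1 - a).\<close>
  define E where "E u = (1 - 2 * q) * a u + 2 * q * (a u)\<^sup>2" for u
  have deriv: "((\<lambda>u. u * a u) has_vector_derivative E u) (at u)" if u: "u \<noteq> 0" for u
  proof -
    have u2: "0 < u\<^sup>2" using u by simp
    have "((\<lambda>u. (u\<^sup>2) powr q) has_real_derivative q * (u\<^sup>2) powr (q - 1) * (2 * u)) (at u)"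
      using u2 by (auto intro!: derivative_eq_intros)
    from DERIV_mult[OF DERIV_ident DERIV_divide[OF DERIV_const DERIV_add[OF DERIV_const this]], of B B]
    have "((\<lambda>u. u * a u) has_real_derivative
       1 * a u + (0 * (B + (u\<^sup>2) powr q) - B * (q * (u\<^sup>2) powr (q - 1) * (2 * u))) / ((B + (u\<^sup>2) powr q) * (B + (u\<^sup>2) powr q)) * u) (at u)"
      using den[of u] unfolding a_def by simp
    moreover have "1 * a u + (0 * (B + (u\<^sup>2) powr q) - B * (q * (u\<^sup>2) powr (q - 1) * (2 * u))) / ((B + (u\<^sup>2) powr q) * (B + (u\<^sup>2) powr q)) * u = E u"
    proof -
      define P where "P = (u\<^sup>2) powr q"
      have P: "(u\<^sup>2) powr (q - 1) * u\<^sup>2 = P"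
        using u2 by (simp add: P_def powr_diff)
      have "1 * a u + (0 * (B + P) - B * (q * (u\<^sup>2) powr (q - 1) * (2 * u))) / ((B + P) * (B + P)) * u
          = a u - 2 * q * (B / (B + P)) * (((u\<^sup>2) powr (q - 1) * u\<^sup>2) / (B + P))"
        by (simp add: power2_eq_square)
      also have "\<dots> = a u - 2 * q * a u * (1 - a u)"
        using den[of u] unfolding P a_def P_def[symmetric] by (simp add: field_simps)
      also have "\<dots> = E u" by (simp add: E_def power2_eq_square algebra_simps)
      finally show ?thesis by (simp only: P_def)
    qed
    ultimately show ?thesis
      by (simp only: has_real_derivative_iff_has_vector_derivative)
  qed
  have contE: "continuous_on UNIV E"
    unfolding E_def by (intro continuous_intros cont)
  have intE: "integrable lborel E"
    unfolding E_def using int1 int2 by auto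
  have "integral {- real N..real N} E = 2 * (real N * a (real N))" for N
  proof -
    \<comment> \<open>The fundamental theorem is applied with the exceptional point 0, where the
      power rule for u^2 fails; continuity there suffices.\<close>
    have "(E has_integral real N * a (real N) - (- real N) * a (- real N)) {- real N..real N}"
      by (rule fundamental_theorem_of_calculus_interior_strong[of "{0}"])
         (auto intro!: deriv continuous_intros continuous_on_subset[OF cont])
    moreover have "a (- real N) = a (real N)" by (simp add: a_def)
    ultimately show ?thesis by (simp add: integral_unique)
  qed
  then have "(\<lambda>N. 2 * (real N * a (real N))) \<longlonglongrightarrow> (\<integral>u. E u \<partial>lborel)"
    using integral_symmetric_tendsto[OF contE intE filterlim_real_sequentially] by simp
  \<comment> \<open>The boundary terms vanish because a(N) = O(1/N^2).\<close>
  moreover have "(\<lambda>N. 2 * (real N * a (real N))) \<longlonglongrightarrow> 0"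
  proof (rule tendsto_sandwich)
    show "\<forall>\<^sub>F N in sequentially. 0 \<le> 2 * (real N * a (real N))"
      using a0 by (intro always_eventually allI) (simp add: less_imp_le)
    show "\<forall>\<^sub>F N in sequentially. 2 * (real N * a (real N)) \<le> 2 * K * (1 / real N)"
    proof (rule eventually_sequentiallyI[of 1])
      fix N :: nat assume N: "1 \<le> N"
      have "real N * a (real N) \<le> real N * (K * (1 / (1 + (real N)\<^sup>2)))"
        by (intro mult_left_mono le) simp
      also have "\<dots> \<le> real N * (K * (1 / (real N)\<^sup>2))"
        using N by (intro mult_left_mono divide_left_mono) (auto simp: K_def add_pos_nonneg)
      also have "\<dots> = K * (1 / real N)" using N by (simp add: power2_eq_square)
      finally show "2 * (real N * a (real N)) \<le> 2 * K * (1 / real N)" by simp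
    qed
    show "(\<lambda>N. 2 * K * (1 / real N)) \<longlonglongrightarrow> 0"
      using tendsto_mult_right_zero[OF lim_1_over_n] by blast
  qed simp
  ultimately have "(\<integral>u. E u \<partial>lborel) = 0"
    by (rule LIMSEQ_unique)
  also have "(\<integral>u. E u \<partial>lborel) = (1 - 2 * q) * (\<integral>u. a u \<partial>lborel) + 2 * q * (\<integral>u. (a u)\<^sup>2 \<partial>lborel)"
    unfolding E_def using int1 int2 by simp
  finally show "2 * q * (\<integral>u. (a u)\<^sup>2 \<partial>lborel) = (2 * q - 1) * (\<integral>u. a u \<partial>lborel)"
    by (simp add: algebra_simps)
qed

text \<open>Substituting l = s u gives an integral over the line with the indicator of |s u| \<le>
  pi, which tends to 1. The limit is tested along sequences so that dominated convergence applies;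
  the null point u = 0 is left out because the density bounds blow up there.\<close>

lemma rescaled_integral_tendsto:
  fixes F :: "real \<Rightarrow> real \<Rightarrow> real"
  assumes s0: "\<And>\<delta>. 0 < \<delta> \<Longrightarrow> 0 < s \<delta>" and s: "(s \<longlongrightarrow> 0) (at_right 0)"
    and cont: "\<And>\<delta>. 0 < \<delta> \<Longrightarrow> continuous_on UNIV (F \<delta>)"
    and bound: "\<And>\<delta> u. 0 < \<delta> \<Longrightarrow> u \<noteq> 0 \<Longrightarrow> \<bar>s \<delta> * u\<bar> \<le> pi \<Longrightarrow> \<bar>F \<delta> (s \<delta> * u)\<bar> \<le> K * (1 / (1 + u\<^sup>2))"
    and lim: "\<And>u. u \<noteq> 0 \<Longrightarrow> ((\<lambda>\<delta>. F \<delta> (s \<delta> * u)) \<longlongrightarrow> f u) (at_right 0)"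
    and f: "f \<in> borel_measurable lborel"
  shows "((\<lambda>\<delta>. integral {-pi..pi} (F \<delta>) / s \<delta>) \<longlongrightarrow> (\<integral>u. f u \<partial>lborel)) (at_right 0)"
  unfolding tendsto_at_iff_sequentially
proof (intro allI impI)
  fix X :: "nat \<Rightarrow> real" assume "\<forall>i. X i \<in> {0<..} - {0}" and X: "X \<longlonglongrightarrow> 0"
  then have X0: "0 < X i" for i by auto
  have flX: "filterlim X (at_right 0) sequentially"
  proof -
    have "X i \<noteq> 0" for i using X0[of i] by simp
    then show ?thesis using X X0 by (simp add: filterlim_at)
  qed
  have nonzero: "AE u in lborel. u \<noteq> (0::real)"
    by (rule AE_I[of _ _ "{0}"]) auto
  have eq: "integral {-pi..pi} (F \<delta>) / s \<delta> = (\<integral>u. indicator {-pi..pi} (s \<delta> * u) *\<^sub>R F \<delta> (s \<delta> * u) \<partial>lborel)"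
    if \<delta>: "0 < \<delta>" for \<delta>
  proof -
    have "set_integrable lborel {-pi..pi} (F \<delta>)"
      unfolding set_integrable_def
      using borel_integrable_compact[of "{-pi..pi}" "F \<delta>"] continuous_on_subset[OF cont[OF \<delta>]]
      by (auto simp: indicator_def if_distrib if_distribR cong: if_cong)
    from set_borel_integral_eq_integral(2)[OF this]
    have "integral {-pi..pi} (F \<delta>) = (\<integral>u. indicator {-pi..pi} u *\<^sub>R F \<delta> u \<partial>lborel)"
      by (simp add: set_lebesgue_integral_def)
    also have "\<dots> = s \<delta> * (\<integral>u. indicator {-pi..pi} (s \<delta> * u) *\<^sub>R F \<delta> (s \<delta> * u) \<partial>lborel)"
      using lborel_integral_real_affine[of "s \<delta>" "\<lambda>u. indicator {-pi..pi} u *\<^sub>R F \<delta> u" 0] s0[OF \<delta>] by simp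
    finally show ?thesis using s0[OF \<delta>] by simp
  qed
  have "(\<lambda>i. \<integral>u. indicator {-pi..pi} (s (X i) * u) *\<^sub>R F (X i) (s (X i) * u) \<partial>lborel)
     \<longlonglongrightarrow> (\<integral>u. f u \<partial>lborel)"
  proof (rule integral_dominated_convergence[OF f])
    show "(\<lambda>u. indicator {-pi..pi} (s (X i) * u) *\<^sub>R F (X i) (s (X i) * u)) \<in> borel_measurable lborel" for i
    proof -
      have [measurable]: "F (X i) \<in> borel_measurable borel"
        by (rule borel_measurable_continuous_onI[OF cont[OF X0]])
      show ?thesis by measurable
    qed
    show "integrable lborel (\<lambda>u. \<bar>K\<bar> * (1 / (1 + u\<^sup>2)))"
      by (rule integrable_inverse_one_plus_square)
    show "AE u in lborel. norm (indicator {-pi..pi} (s (X i) * u) *\<^sub>R F (X i) (s (X i) * u)) \<le> \<bar>K\<bar> * (1 / (1 + u\<^sup>2))" for i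
      using nonzero
    proof eventually_elim
      case (elim u)
      have nn: "0 \<le> 1 / (1 + u\<^sup>2)" by (simp add: add_nonneg_nonneg)
      show ?case
      proof (cases "\<bar>s (X i) * u\<bar> \<le> pi")
        case True
        have "\<bar>F (X i) (s (X i) * u)\<bar> \<le> K * (1 / (1 + u\<^sup>2))"
          by (rule bound[OF X0 elim True])
        also have "\<dots> \<le> \<bar>K\<bar> * (1 / (1 + u\<^sup>2))" using nn by (intro mult_right_mono) auto
        finally show ?thesis by (simp add: indicator_def)
      next
        case False
        then have "indicator {-pi..pi} (s (X i) * u) = (0::real)" by (auto simp: indicator_def abs_le_iff)
        then show ?thesis using nn by simp
      qed
    qed
    show "AE u in lborel. (\<lambda>i. indicator {-pi..pi} (s (X i) * u) *\<^sub>R F (X i) (s (X i) * u)) \<longlonglongrightarrow> f u"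
      using nonzero
    proof eventually_elim
      case (elim u)
      have "(\<lambda>i. F (X i) (s (X i) * u)) \<longlonglongrightarrow> f u"
        by (rule filterlim_compose[OF lim[OF elim] flX])
      moreover have "(\<lambda>i. s (X i) * u) \<longlonglongrightarrow> 0 * u"
        by (intro tendsto_mult tendsto_const filterlim_compose[OF s flX])
      then have "\<forall>\<^sub>F i in sequentially. dist (s (X i) * u) 0 < pi"
        using pi_gt_zero unfolding tendsto_iff by simp
      then have "\<forall>\<^sub>F i in sequentially. F (X i) (s (X i) * u)
          = indicator {-pi..pi} (s (X i) * u) *\<^sub>R F (X i) (s (X i) * u)"
        by eventually_elim (auto simp: dist_real_def indicator_def)
      ultimately show ?case
        by (rule Lim_transform_eventually)
    qed
  qed
  then show "((\<lambda>\<delta>. integral {-pi..pi} (F \<delta>) / s \<delta>) \<circ> X) \<longlonglongrightarrow> (\<integral>u. f u \<partial>lborel)"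
    by (simp add: o_def eq[OF X0])
qed

lemma powr_tendsto_0: "0 < c \<Longrightarrow> ((\<lambda>x::real. x powr c) \<longlongrightarrow> 0) (at_right 0)"
proof -
  assume c: "0 < c"
  have "\<forall>\<^sub>F x::real in at_right 0. 0 \<le> x"
    by (rule eventually_mono[OF eventually_at_right_less]) simp
  with c have "((\<lambda>x::real. x powr c) \<longlongrightarrow> 0 powr c) (at_right 0)"
    by (intro tendsto_powr' tendsto_ident_at tendsto_const) auto
  then show ?thesis by simp
qed

section \<open>The sampled density on the critical scale\<close>

context
  fixes \<nu> :: real
  assumes \<nu>: "1/2 \<le> \<nu>"
begin

lemma continuous_a_delta:
  assumes "0 < \<delta>" "0 < \<theta>" "0 < b"
  shows "continuous_on UNIV (a_delta \<nu> \<delta> b \<theta>)"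
proof -
  have "b * g_delta \<nu> \<delta> \<theta> l + 1 / (2 * pi) \<noteq> 0" for l
    using g_delta_pos[OF \<nu> assms(1,2), of l] assms(3) add_pos_pos[of "b * g_delta \<nu> \<delta> \<theta> l" "1 / (2*pi)"]
    by simp
  then show ?thesis
    unfolding a_delta_def[abs_def]
    by (intro continuous_intros continuous_g_delta \<nu> assms) blast
qed

text \<open>A termwise comparison of the alias sums. The factor is free of \<delta> since both rates
  scale with \<delta>; this bounds the ratio in \<open>psi\<close> for dominated
  convergence.\<close>

lemma g_delta_ratio_bound:
  assumes \<theta>: "0 < \<theta>" and \<theta>0: "0 < \<theta>0"
  obtains R where "0 < R" "\<And>\<delta> l. 0 < \<delta> \<Longrightarrow> g_delta \<nu> \<delta> \<theta>0 l \<le> R * g_delta \<nu> \<delta> \<theta> l"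
proof -
  \<comment> \<open>Ensures (\<delta>\<theta>)^2 + \<omega>^2 \<le> m ((\<delta>\<theta>0)^2 +
    \<omega>^2) for all \<delta> and \<omega>.\<close>
  define m where "m = max 1 ((\<theta> / \<theta>0)\<^sup>2)"
  have m: "1 \<le> m" by (simp add: m_def)
  define R where "R = (\<theta>0 / \<theta>) powr (2*\<nu>) * (1/m) powr (-(\<nu> + 1/2))"
  have R: "0 < R" using \<theta> \<theta>0 m by (simp add: R_def)
  have star: "g_star \<nu> (\<delta>*\<theta>0) \<omega> \<le> R * g_star \<nu> (\<delta>*\<theta>) \<omega>" if \<delta>: "0 < \<delta>" for \<delta> \<omega>
  proof -
    have "(\<theta> / \<theta>0)\<^sup>2 \<le> m" by (simp add: m_def)
    then have "\<theta>\<^sup>2 \<le> m * \<theta>0\<^sup>2" using \<theta>0 by (simp add: power_divide pos_divide_le_eq)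
    then have "\<delta>\<^sup>2 * \<theta>\<^sup>2 \<le> \<delta>\<^sup>2 * (m * \<theta>0\<^sup>2)" by (intro mult_left_mono) auto
    moreover have "1 * \<omega>\<^sup>2 \<le> m * \<omega>\<^sup>2" using m by (intro mult_right_mono) auto
    ultimately have "(\<delta>*\<theta>)\<^sup>2 + \<omega>\<^sup>2 \<le> m * ((\<delta>*\<theta>0)\<^sup>2 + \<omega>\<^sup>2)"
      by (simp add: power_mult_distrib algebra_simps)
    then have le: "1/m * ((\<delta>*\<theta>)\<^sup>2 + \<omega>\<^sup>2) \<le> (\<delta>*\<theta>0)\<^sup>2 + \<omega>\<^sup>2"
      using m by (simp add: pos_divide_le_eq mult.commute)
    have pos: "0 < 1/m * ((\<delta>*\<theta>)\<^sup>2 + \<omega>\<^sup>2)"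
      using m \<delta> \<theta> by (intro mult_pos_pos add_pos_nonneg) auto
    have "g_star \<nu> (\<delta>*\<theta>0) \<omega> \<le> C_nu \<nu> * (\<delta>*\<theta>0) powr (2*\<nu>) * (1/m * ((\<delta>*\<theta>)\<^sup>2 + \<omega>\<^sup>2)) powr (-(\<nu> + 1/2))"
      using \<delta> \<theta>0 by (intro g_star_le[OF \<nu>] le pos) auto
    also have "(1/m * ((\<delta>*\<theta>)\<^sup>2 + \<omega>\<^sup>2)) powr (-(\<nu> + 1/2)) = (1/m) powr (-(\<nu> + 1/2)) * ((\<delta>*\<theta>)\<^sup>2 + \<omega>\<^sup>2) powr (-(\<nu> + 1/2))"
      by (rule powr_mult)
    also have "(\<delta>*\<theta>0) powr (2*\<nu>) = (\<theta>0 / \<theta>) powr (2*\<nu>) * (\<delta>*\<theta>) powr (2*\<nu>)"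
      using \<theta> by (subst powr_mult[symmetric]) (simp add: field_simps)
    finally show ?thesis
      unfolding R_def g_star_def by (simp only: mult_ac)
  qed
  have "g_delta \<nu> \<delta> \<theta>0 l \<le> R * g_delta \<nu> \<delta> \<theta> l" if \<delta>: "0 < \<delta>" for \<delta> l
    unfolding g_delta_def infsum_cmult_right'[symmetric]
    using star[OF \<delta>] by (intro infsum_mono summable_on_cmult_right summable_g_star \<nu> \<delta> \<theta> \<theta>0)
  then show ?thesis using R that by blast
qed

text \<open>The scale on which \<open>b g\<^sup>\<delta>\<close> is comparable with the noise level.\<close>
definition scl :: "real \<Rightarrow> real" where "scl \<delta> = \<delta> powr (2*\<nu> / (2*\<nu> + 1))"

lemma scl_pos: "0 < \<delta> \<Longrightarrow> 0 < scl \<delta>"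
  by (simp add: scl_def)

lemma scl_tendsto: "(scl \<longlongrightarrow> 0) (at_right 0)"
proof -
  have "((\<lambda>\<delta>::real. \<delta> powr (2*\<nu> / (2*\<nu> + 1))) \<longlongrightarrow> 0) (at_right 0)"
    using \<nu> by (intro powr_tendsto_0) simp
  then show ?thesis by (simp add: scl_def[abs_def])
qed

text \<open>The property that fixes the exponent of \<open>scl\<close>: it cancels the factor
  \<delta>^(2\<nu>) of \<open>g_star\<close>.\<close>

lemma scl_powr: "0 < \<delta> \<Longrightarrow> ((scl \<delta>)\<^sup>2) powr (\<nu> + 1/2) = \<delta> powr (2*\<nu>)"
proof -
  assume \<delta>: "0 < \<delta>"
  have "((scl \<delta>)\<^sup>2) powr (\<nu> + 1/2) = scl \<delta> powr (2 * (\<nu> + 1/2))"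
    using scl_pos[OF \<delta>] by (simp add: powr_powr flip: powr_numeral)
  also have "\<dots> = \<delta> powr (2*\<nu> / (2*\<nu> + 1) * (2 * (\<nu> + 1/2)))"
    by (simp add: scl_def powr_powr)
  also have "2*\<nu> / (2*\<nu> + 1) * (2 * (\<nu> + 1/2)) = 2 * \<nu>"
    using \<nu> by (simp add: field_simps)
  finally show ?thesis .
qed

text \<open>The quotient is \<delta>^(1/(2\<nu> + 1)). By \<open>g_star_scl\<close> it is the only
  way in which \<delta> enters the rescaled density, whose limit is therefore a pure power of
  u.\<close>

lemma delta_over_scl_tendsto: "((\<lambda>\<delta>. \<delta> / scl \<delta>) \<longlongrightarrow> 0) (at_right 0)"
proof -
  have "((\<lambda>\<delta>::real. \<delta> powr (1 / (2*\<nu> + 1))) \<longlongrightarrow> 0) (at_right 0)"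
    using \<nu> by (intro powr_tendsto_0) simp
  moreover have "\<forall>\<^sub>F \<delta> in at_right 0. \<delta> powr (1 / (2*\<nu> + 1)) = \<delta> / scl \<delta>"
  proof (rule eventually_mono[OF eventually_at_right_less[of 0]])
    fix \<delta> :: real assume \<delta>: "0 < \<delta>"
    have "1 / (2*\<nu> + 1) = 1 - 2*\<nu> / (2*\<nu> + 1)" using \<nu> by (simp add: field_simps)
    then show "\<delta> powr (1 / (2*\<nu> + 1)) = \<delta> / scl \<delta>"
      using \<delta> by (simp add: scl_def powr_diff)
  qed
  ultimately show ?thesis
    by (simp add: Lim_transform_eventually)
qed

lemma g_star_scl:
  assumes \<delta>: "0 < \<delta>" and \<theta>: "0 < \<theta>"
  shows "g_star \<nu> (\<delta>*\<theta>) (scl \<delta> * u) = C_nu \<nu> * \<theta> powr (2*\<nu>) * ((\<delta> / scl \<delta> * \<theta>)\<^sup>2 + u\<^sup>2) powr (-(\<nu> + 1/2))"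
proof -
  have s: "0 < scl \<delta>" by (rule scl_pos[OF \<delta>])
  have "(\<delta>*\<theta>)\<^sup>2 + (scl \<delta> * u)\<^sup>2 = (scl \<delta>)\<^sup>2 * ((\<delta> / scl \<delta> * \<theta>)\<^sup>2 + u\<^sup>2)"
    using s by (simp add: power_mult_distrib power_divide field_simps)
  then have "((\<delta>*\<theta>)\<^sup>2 + (scl \<delta> * u)\<^sup>2) powr (-(\<nu> + 1/2))
      = ((scl \<delta>)\<^sup>2) powr (-(\<nu> + 1/2)) * ((\<delta> / scl \<delta> * \<theta>)\<^sup>2 + u\<^sup>2) powr (-(\<nu> + 1/2))"
    by (simp only: powr_mult)
  also have "((scl \<delta>)\<^sup>2) powr (-(\<nu> + 1/2)) = 1 / \<delta> powr (2*\<nu>)"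
    by (simp only: powr_minus_divide scl_powr[OF \<delta>])
  finally have 1: "((\<delta>*\<theta>)\<^sup>2 + (scl \<delta> * u)\<^sup>2) powr (-(\<nu> + 1/2))
      = 1 / \<delta> powr (2*\<nu>) * ((\<delta> / scl \<delta> * \<theta>)\<^sup>2 + u\<^sup>2) powr (-(\<nu> + 1/2))" .
  show ?thesis
    unfolding g_star_def 1 using \<delta> by (simp add: powr_mult)
qed

text \<open>The coefficient of (\<delta>\<theta>)^(2\<nu>) in the alias bound
  \<open>g_delta_le\<close>.\<close>

definition tail_const :: real where
  "tail_const = 2 * C_nu \<nu> * (\<Sum>\<^sub>\<infinity>k::int. 1 / (1 + (real_of_int k)\<^sup>2))"

lemma tail_const_nonneg: "0 \<le> tail_const"
  unfolding tail_const_def using C_nu_pos[OF \<nu>]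
  by (intro mult_nonneg_nonneg infsum_nonneg) (auto simp: add_nonneg_nonneg)

lemma g_delta_scl_le:
  assumes \<delta>: "0 < \<delta>" and \<theta>: "0 < \<theta>" and u: "\<bar>scl \<delta> * u\<bar> \<le> pi"
  shows "g_delta \<nu> \<delta> \<theta> (scl \<delta> * u)
    \<le> g_star \<nu> (\<delta>*\<theta>) (scl \<delta> * u) + tail_const * \<theta> powr (2*\<nu>) * \<delta> powr (2*\<nu>)"
  using g_delta_le[OF \<nu> \<delta> \<theta> u] by (simp add: tail_const_def powr_mult mult_ac)

text \<open>Squeezed between the term k = 0 and that term plus the alias tail, which vanishes like
  \<delta>^(2\<nu>).\<close>

lemma g_delta_scl_tendsto:
  assumes \<theta>: "0 < \<theta>" and u: "u \<noteq> 0"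
  shows "((\<lambda>\<delta>. g_delta \<nu> \<delta> \<theta> (scl \<delta> * u)) \<longlongrightarrow> C_nu \<nu> * \<theta> powr (2*\<nu>) * (u\<^sup>2) powr (-(\<nu> + 1/2))) (at_right 0)"
proof (rule tendsto_sandwich)
  have star: "((\<lambda>\<delta>. g_star \<nu> (\<delta>*\<theta>) (scl \<delta> * u)) \<longlongrightarrow> C_nu \<nu> * \<theta> powr (2*\<nu>) * (u\<^sup>2) powr (-(\<nu> + 1/2))) (at_right 0)"
  proof (rule Lim_transform_eventually)
    have "((\<lambda>\<delta>. C_nu \<nu> * \<theta> powr (2*\<nu>) * ((\<delta> / scl \<delta> * \<theta>)\<^sup>2 + u\<^sup>2) powr (-(\<nu> + 1/2)))
      \<longlongrightarrow> C_nu \<nu> * \<theta> powr (2*\<nu>) * ((0 * \<theta>)\<^sup>2 + u\<^sup>2) powr (-(\<nu> + 1/2))) (at_right 0)"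
      by (intro tendsto_intros delta_over_scl_tendsto) (use u in auto)
    then show "((\<lambda>\<delta>. C_nu \<nu> * \<theta> powr (2*\<nu>) * ((\<delta> / scl \<delta> * \<theta>)\<^sup>2 + u\<^sup>2) powr (-(\<nu> + 1/2)))
      \<longlongrightarrow> C_nu \<nu> * \<theta> powr (2*\<nu>) * (u\<^sup>2) powr (-(\<nu> + 1/2))) (at_right 0)" by simp
    show "\<forall>\<^sub>F \<delta> in at_right 0. C_nu \<nu> * \<theta> powr (2*\<nu>) * ((\<delta> / scl \<delta> * \<theta>)\<^sup>2 + u\<^sup>2) powr (-(\<nu> + 1/2))
        = g_star \<nu> (\<delta>*\<theta>) (scl \<delta> * u)"
      by (rule eventually_mono[OF eventually_at_right_less[of 0]]) (simp add: g_star_scl \<theta>)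
  qed
  then show "((\<lambda>\<delta>. g_star \<nu> (\<delta>*\<theta>) (scl \<delta> * u)) \<longlongrightarrow> C_nu \<nu> * \<theta> powr (2*\<nu>) * (u\<^sup>2) powr (-(\<nu> + 1/2))) (at_right 0)" .
  have "((\<lambda>\<delta>::real. \<delta> powr (2*\<nu>)) \<longlongrightarrow> 0) (at_right 0)"
    using \<nu> by (intro powr_tendsto_0) simp
  then have "((\<lambda>\<delta>. g_star \<nu> (\<delta>*\<theta>) (scl \<delta> * u) + tail_const * \<theta> powr (2*\<nu>) * \<delta> powr (2*\<nu>))
     \<longlongrightarrow> C_nu \<nu> * \<theta> powr (2*\<nu>) * (u\<^sup>2) powr (-(\<nu> + 1/2)) + tail_const * \<theta> powr (2*\<nu>) * 0) (at_right 0)"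
    by (intro tendsto_intros star)
  then show "((\<lambda>\<delta>. g_star \<nu> (\<delta>*\<theta>) (scl \<delta> * u) + tail_const * \<theta> powr (2*\<nu>) * \<delta> powr (2*\<nu>))
     \<longlongrightarrow> C_nu \<nu> * \<theta> powr (2*\<nu>) * (u\<^sup>2) powr (-(\<nu> + 1/2))) (at_right 0)" by simp
  show "\<forall>\<^sub>F \<delta> in at_right 0. g_star \<nu> (\<delta>*\<theta>) (scl \<delta> * u) \<le> g_delta \<nu> \<delta> \<theta> (scl \<delta> * u)"
    by (rule eventually_mono[OF eventually_at_right_less[of 0]]) (rule g_delta_ge_g_star[OF \<nu> _ \<theta>])
  have "((\<lambda>\<delta>. scl \<delta> * u) \<longlongrightarrow> 0 * u) (at_right 0)"
    by (intro tendsto_intros scl_tendsto)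
  then have "\<forall>\<^sub>F \<delta> in at_right 0. dist (scl \<delta> * u) 0 < pi"
    using pi_gt_zero unfolding tendsto_iff by simp
  then show "\<forall>\<^sub>F \<delta> in at_right 0. g_delta \<nu> \<delta> \<theta> (scl \<delta> * u)
      \<le> g_star \<nu> (\<delta>*\<theta>) (scl \<delta> * u) + tail_const * \<theta> powr (2*\<nu>) * \<delta> powr (2*\<nu>)"
    using eventually_at_right_less[of 0]
    by eventually_elim (auto intro!: g_delta_scl_le \<theta> simp: dist_real_def)
qed

lemma g_delta_scl_bound:
  assumes \<theta>: "0 < \<theta>"
  obtains K where "0 < K"
    "\<And>\<delta> u. 0 < \<delta> \<Longrightarrow> u \<noteq> 0 \<Longrightarrow> \<bar>scl \<delta> * u\<bar> \<le> pi \<Longrightarrow> g_delta \<nu> \<delta> \<theta> (scl \<delta> * u) \<le> K * (u\<^sup>2) powr (-(\<nu> + 1/2))"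
proof -
  define K where "K = C_nu \<nu> * \<theta> powr (2*\<nu>) + tail_const * \<theta> powr (2*\<nu>) * (pi\<^sup>2) powr (\<nu> + 1/2)"
  have K: "0 < K"
    unfolding K_def using C_nu_pos[OF \<nu>] \<theta> tail_const_nonneg by (intro add_pos_nonneg) auto
  have "g_delta \<nu> \<delta> \<theta> (scl \<delta> * u) \<le> K * (u\<^sup>2) powr (-(\<nu> + 1/2))"
    if \<delta>: "0 < \<delta>" and u: "u \<noteq> 0" and su: "\<bar>scl \<delta> * u\<bar> \<le> pi" for \<delta> u
  proof -
    have u2: "0 < u\<^sup>2" using u by simp
    have "g_star \<nu> (\<delta>*\<theta>) (scl \<delta> * u) \<le> C_nu \<nu> * \<theta> powr (2*\<nu>) * (u\<^sup>2) powr (-(\<nu> + 1/2))"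
      unfolding g_star_scl[OF \<delta> \<theta>] using C_nu_pos[OF \<nu>] \<nu> u2
      by (intro mult_left_mono powr_mono2') auto
    \<comment> \<open>The window |scl \<delta> u| \<le> pi gives scl \<delta> \<le> pi/|u|; by
      \<open>scl_powr\<close> the flat alias tail inherits the decay of the leading term.\<close>
    moreover have "\<delta> powr (2*\<nu>) \<le> (pi\<^sup>2) powr (\<nu> + 1/2) * (u\<^sup>2) powr (-(\<nu> + 1/2))"
    proof -
      have "(scl \<delta> * u)\<^sup>2 \<le> pi\<^sup>2" using su by (metis abs_ge_zero power2_abs power_mono)
      then have "(scl \<delta>)\<^sup>2 \<le> pi\<^sup>2 / u\<^sup>2" using u2 by (simp add: power_mult_distrib pos_le_divide_eq)
      then have "((scl \<delta>)\<^sup>2) powr (\<nu> + 1/2) \<le> (pi\<^sup>2 / u\<^sup>2) powr (\<nu> + 1/2)"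
        using \<nu> by (intro powr_mono2) auto
      also have "\<dots> = (pi\<^sup>2) powr (\<nu> + 1/2) * (u\<^sup>2) powr (-(\<nu> + 1/2))"
        by (simp only: powr_divide powr_minus_divide) simp
      finally show ?thesis by (simp only: scl_powr[OF \<delta>])
    qed
    then have "tail_const * \<theta> powr (2*\<nu>) * \<delta> powr (2*\<nu>)
        \<le> tail_const * \<theta> powr (2*\<nu>) * ((pi\<^sup>2) powr (\<nu> + 1/2) * (u\<^sup>2) powr (-(\<nu> + 1/2)))"
      using tail_const_nonneg by (intro mult_left_mono) auto
    ultimately have "g_delta \<nu> \<delta> \<theta> (scl \<delta> * u) \<le> C_nu \<nu> * \<theta> powr (2*\<nu>) * (u\<^sup>2) powr (-(\<nu> + 1/2))
       + tail_const * \<theta> powr (2*\<nu>) * ((pi\<^sup>2) powr (\<nu> + 1/2) * (u\<^sup>2) powr (-(\<nu> + 1/2)))"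
      using g_delta_scl_le[OF \<delta> \<theta> su] by linarith
    also have "\<dots> = K * (u\<^sup>2) powr (-(\<nu> + 1/2))"
      by (simp only: K_def distrib_right mult.assoc)
    finally show ?thesis .
  qed
  then show ?thesis using K that by blast
qed

text \<open>Near 0, where the bound on the density blows up, a \<le> 1 suffices; for |u| > 1, a
  \<le> 2 pi b g and the decay of g takes over.\<close>

lemma a_delta_scl_bound:
  assumes \<theta>: "0 < \<theta>" and b: "0 < b"
  obtains K where "0 < K"
    "\<And>\<delta> u. 0 < \<delta> \<Longrightarrow> u \<noteq> 0 \<Longrightarrow> \<bar>scl \<delta> * u\<bar> \<le> pi \<Longrightarrow> a_delta \<nu> \<delta> b \<theta> (scl \<delta> * u) \<le> K * (1 / (1 + u\<^sup>2))"
proof -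
  obtain G where G: "0 < G"
    "\<And>\<delta> u. 0 < \<delta> \<Longrightarrow> u \<noteq> 0 \<Longrightarrow> \<bar>scl \<delta> * u\<bar> \<le> pi \<Longrightarrow> g_delta \<nu> \<delta> \<theta> (scl \<delta> * u) \<le> G * (u\<^sup>2) powr (-(\<nu> + 1/2))"
    using g_delta_scl_bound[OF \<theta>] by blast
  define K where "K = 2 * max 1 (2 * pi * b * G)"
  have "a_delta \<nu> \<delta> b \<theta> (scl \<delta> * u) \<le> K * (1 / (1 + u\<^sup>2))"
    if \<delta>: "0 < \<delta>" and u: "u \<noteq> 0" and su: "\<bar>scl \<delta> * u\<bar> \<le> pi" for \<delta> u
  proof -
    let ?g = "g_delta \<nu> \<delta> \<theta> (scl \<delta> * u)"
    have g: "0 < ?g" by (rule g_delta_pos[OF \<nu> \<delta> \<theta>])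
    have den: "0 < b * ?g + 1 / (2 * pi)" using g b by (simp add: add_pos_pos)
    have pos: "0 < 1 + u\<^sup>2" by (simp add: add_pos_nonneg)
    show ?thesis
    proof (cases "\<bar>u\<bar> \<le> 1")
      case True
      then have "u\<^sup>2 \<le> 1" by (simp add: abs_square_le_1)
      then have "1 \<le> 2 * (1 / (1 + u\<^sup>2))" using pos by (simp add: field_simps)
      also have "\<dots> \<le> K * (1 / (1 + u\<^sup>2))" using pos by (intro mult_right_mono) (auto simp: K_def)
      finally have "1 \<le> K * (1 / (1 + u\<^sup>2))" .
      moreover have "a_delta \<nu> \<delta> b \<theta> (scl \<delta> * u) \<le> 1"
        unfolding a_delta_def using den by (simp add: pos_divide_le_eq)
      ultimately show ?thesis by linarith
    next
      case False
      then have u1: "1 \<le> u\<^sup>2" using one_le_power[of "\<bar>u\<bar>" 2] by simp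
      have "a_delta \<nu> \<delta> b \<theta> (scl \<delta> * u) \<le> b * ?g / (1 / (2 * pi))"
        unfolding a_delta_def using g b by (intro divide_left_mono mult_pos_pos den) auto
      also have "\<dots> = 2 * pi * b * ?g" by simp
      also have "\<dots> \<le> 2 * pi * b * (G * (u\<^sup>2) powr (-(\<nu> + 1/2)))"
        using b by (intro mult_left_mono G(2) \<delta> u su) auto
      also have "\<dots> \<le> 2 * pi * b * (G * (1 / u\<^sup>2))"
        using b G(1) by (intro mult_left_mono powr_le_inverse[OF \<nu> u1]) auto
      also have "1 / u\<^sup>2 \<le> 2 * (1 / (1 + u\<^sup>2))"
        using u1 by (simp add: frac_le_eq divide_simps)
      then have "2 * pi * b * (G * (1 / u\<^sup>2)) \<le> 2 * pi * b * (G * (2 * (1 / (1 + u\<^sup>2))))"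
        using b G(1) by (intro mult_left_mono) auto
      also have "\<dots> = 2 * (2 * pi * b * G) * (1 / (1 + u\<^sup>2))" by simp
      also have "\<dots> \<le> K * (1 / (1 + u\<^sup>2))"
        unfolding K_def using pos by (intro mult_right_mono mult_left_mono max.cobounded2) auto
      finally show ?thesis .
    qed
  qed
  moreover have "0 < K" by (simp add: K_def)
  ultimately show ?thesis using that by blast
qed

text \<open>Dividing numerator and denominator by \<open>scl\<close> leaves the quotient unchanged
  and gives both finite limits. The density ratio minus 1 tends to the constant \<rho> for every u
  \<noteq> 0, so only the ratio of the integrals of a^2 and a remains.\<close>

lemma psi_tendsto:
  assumes b: "0 < b" and \<theta>: "0 < \<theta>" and b0: "0 < b0" and \<theta>0: "0 < \<theta>0"
  shows "((\<lambda>\<delta>. psi \<nu> \<delta> b \<theta> b0 \<theta>0) \<longlongrightarrow>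
     (2 * \<nu> / (2 * \<nu> + 1)) * (b0 * \<theta>0 powr (2 * \<nu>) / (b * \<theta> powr (2 * \<nu>)) - 1)) (at_right 0)"
proof -
  define q where "q = \<nu> + 1/2"
  \<comment> \<open>The limit of 2 pi b g at scaled frequency u is B / (u^2)^q, so a tends to B / (B
    + (u^2)^q).\<close>
  define B where "B = 2 * pi * b * (C_nu \<nu> * \<theta> powr (2*\<nu>))"
  define a where "a u = B / (B + (u\<^sup>2) powr q)" for u :: real
  define \<rho> where "\<rho> = b0 * \<theta>0 powr (2 * \<nu>) / (b * \<theta> powr (2 * \<nu>)) - 1"
  have B: "0 < B" using b \<theta> C_nu_pos[OF \<nu>] by (simp add: B_def)
  have q: "1 \<le> q" using \<nu> by (simp add: q_def)
  note ratio = integral_square_ratio[OF B q, folded a_def]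
  have meas [measurable]: "a \<in> borel_measurable borel"
    using borel_measurable_integrable[OF ratio(1)] by simp
  obtain K where K: "0 < K"
    "\<And>\<delta> u. 0 < \<delta> \<Longrightarrow> u \<noteq> 0 \<Longrightarrow> \<bar>scl \<delta> * u\<bar> \<le> pi \<Longrightarrow> a_delta \<nu> \<delta> b \<theta> (scl \<delta> * u) \<le> K * (1 / (1 + u\<^sup>2))"
    using a_delta_scl_bound[OF \<theta> b] by blast
  obtain R where R: "0 < R" "\<And>\<delta> l. 0 < \<delta> \<Longrightarrow> g_delta \<nu> \<delta> \<theta>0 l \<le> R * g_delta \<nu> \<delta> \<theta> l"
    using g_delta_ratio_bound[OF \<theta> \<theta>0] by blast
  have a01: "0 < a_delta \<nu> \<delta> b \<theta> l" "a_delta \<nu> \<delta> b \<theta> l \<le> 1" if \<delta>: "0 < \<delta>" for \<delta> l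
    using g_delta_pos[OF \<nu> \<delta> \<theta>, of l] b by (auto simp: a_delta_def add_pos_pos)
  have a_lim: "((\<lambda>\<delta>. a_delta \<nu> \<delta> b \<theta> (scl \<delta> * u)) \<longlongrightarrow> a u) (at_right 0)" if u: "u \<noteq> 0" for u
  proof -
    let ?L = "C_nu \<nu> * \<theta> powr (2*\<nu>) * (u\<^sup>2) powr (-(\<nu> + 1/2))"
    have P: "0 < (u\<^sup>2) powr q" using u by simp
    have L: "0 < ?L" using C_nu_pos[OF \<nu>] \<theta> u by simp
    then have "b * ?L + 1 / (2 * pi) \<noteq> 0" using b by (smt (verit) divide_pos_pos mult_pos_pos pi_gt_zero)
    then have "((\<lambda>\<delta>. a_delta \<nu> \<delta> b \<theta> (scl \<delta> * u)) \<longlongrightarrow> b * ?L / (b * ?L + 1 / (2 * pi))) (at_right 0)"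
      unfolding a_delta_def by (intro tendsto_intros g_delta_scl_tendsto \<theta> u)
    moreover have "b * ?L / (b * ?L + 1 / (2 * pi)) = a u"
    proof -
      define X where "X = b * ?L"
      have "X = B / (2 * pi) / (u\<^sup>2) powr q"
        unfolding X_def by (simp only: powr_minus_divide B_def q_def) simp
      moreover have "B / (2 * pi) / p + 1 / (2 * pi) = (B + p) / (2 * pi * p)" if "0 < p" for p
        using that by (simp add: field_simps)
      ultimately have "X / (X + 1 / (2 * pi)) = a u"
        using P by (simp add: a_def)
      then show ?thesis by (simp only: X_def)
    qed
    ultimately show ?thesis by simp
  qed
  let ?r = "\<lambda>\<delta> l. b0 * g_delta \<nu> \<delta> \<theta>0 l / (b * g_delta \<nu> \<delta> \<theta> l) - 1"
  have r_lim: "((\<lambda>\<delta>. ?r \<delta> (scl \<delta> * u)) \<longlongrightarrow> \<rho>) (at_right 0)" if u: "u \<noteq> 0" for u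
  proof -
    let ?L = "\<lambda>\<theta>. C_nu \<nu> * \<theta> powr (2*\<nu>) * (u\<^sup>2) powr (-(\<nu> + 1/2))"
    have "b * ?L \<theta> \<noteq> 0" using b \<theta> u C_nu_pos[OF \<nu>] by simp
    then have "((\<lambda>\<delta>. ?r \<delta> (scl \<delta> * u)) \<longlongrightarrow> b0 * ?L \<theta>0 / (b * ?L \<theta>) - 1) (at_right 0)"
      by (intro tendsto_intros g_delta_scl_tendsto \<theta> \<theta>0 u)
    moreover have "b0 * ?L \<theta>0 / (b * ?L \<theta>) - 1 = \<rho>"
      using b \<theta> u C_nu_pos[OF \<nu>] by (simp add: \<rho>_def)
    ultimately show ?thesis by simp
  qed
  have r_bound: "\<bar>?r \<delta> l\<bar> \<le> b0 * R / b + 1" if \<delta>: "0 < \<delta>" for \<delta> l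
  proof -
    have g: "0 < g_delta \<nu> \<delta> \<theta> l" and g0: "0 < g_delta \<nu> \<delta> \<theta>0 l"
      using g_delta_pos[OF \<nu> \<delta>] \<theta> \<theta>0 by auto
    have "b0 * g_delta \<nu> \<delta> \<theta>0 l / (b * g_delta \<nu> \<delta> \<theta> l) \<le> b0 * (R * g_delta \<nu> \<delta> \<theta> l) / (b * g_delta \<nu> \<delta> \<theta> l)"
      using b b0 g by (intro divide_right_mono mult_left_mono R(2) \<delta>) auto
    also have "\<dots> = b0 * R / b" using g by simp
    finally have "b0 * g_delta \<nu> \<delta> \<theta>0 l / (b * g_delta \<nu> \<delta> \<theta> l) \<le> b0 * R / b" .
    moreover have "0 < b0 * g_delta \<nu> \<delta> \<theta>0 l / (b * g_delta \<nu> \<delta> \<theta> l)" using g g0 b b0 by simp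
    ultimately show ?thesis by linarith
  qed
  have den: "((\<lambda>\<delta>. integral {-pi..pi} (a_delta \<nu> \<delta> b \<theta>) / scl \<delta>) \<longlongrightarrow> (\<integral>u. a u \<partial>lborel)) (at_right 0)"
  proof (rule rescaled_integral_tendsto[OF scl_pos scl_tendsto])
    show "\<bar>a_delta \<nu> \<delta> b \<theta> (scl \<delta> * u)\<bar> \<le> K * (1 / (1 + u\<^sup>2))"
      if "0 < \<delta>" "u \<noteq> 0" "\<bar>scl \<delta> * u\<bar> \<le> pi" for \<delta> u
      using K(2)[OF that] a01(1)[OF that(1), of "scl \<delta> * u"] by simp
  qed (auto intro: continuous_a_delta \<theta> b a_lim meas)
  have num: "((\<lambda>\<delta>. integral {-pi..pi} (\<lambda>l. (a_delta \<nu> \<delta> b \<theta> l)\<^sup>2 * ?r \<delta> l) / scl \<delta>)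
      \<longlongrightarrow> (\<integral>u. (a u)\<^sup>2 * \<rho> \<partial>lborel)) (at_right 0)"
  proof (rule rescaled_integral_tendsto[OF scl_pos scl_tendsto])
    show "continuous_on UNIV (\<lambda>l. (a_delta \<nu> \<delta> b \<theta> l)\<^sup>2 * ?r \<delta> l)" if \<delta>: "0 < \<delta>" for \<delta>
    proof -
      have "b * g_delta \<nu> \<delta> \<theta> l \<noteq> 0" for l using g_delta_pos[OF \<nu> \<delta> \<theta>, of l] b by simp
      then show ?thesis
        by (intro continuous_intros continuous_a_delta continuous_g_delta \<nu> \<delta> \<theta> \<theta>0 b) auto
    qed
    show "\<bar>(a_delta \<nu> \<delta> b \<theta> (scl \<delta> * u))\<^sup>2 * ?r \<delta> (scl \<delta> * u)\<bar> \<le> (K * (b0 * R / b + 1)) * (1 / (1 + u\<^sup>2))"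
      if \<delta>: "0 < \<delta>" and u: "u \<noteq> 0" and su: "\<bar>scl \<delta> * u\<bar> \<le> pi" for \<delta> u
    proof -
      let ?a = "a_delta \<nu> \<delta> b \<theta> (scl \<delta> * u)"
      \<comment> \<open>As a \<le> 1, the dominating function of the denominator also serves the
        numerator.\<close>
      have "?a\<^sup>2 \<le> ?a * 1"
        unfolding power2_eq_square using a01[OF \<delta>] by (intro mult_left_mono) (auto intro: less_imp_le)
      also have "\<dots> \<le> K * (1 / (1 + u\<^sup>2))" using K(2)[OF \<delta> u su] by simp
      finally have "?a\<^sup>2 * \<bar>?r \<delta> (scl \<delta> * u)\<bar> \<le> K * (1 / (1 + u\<^sup>2)) * (b0 * R / b + 1)"
        using K(1) by (intro mult_mono r_bound[OF \<delta>]) (auto simp: add_nonneg_nonneg)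
      then show ?thesis by (simp only: abs_mult abs_power2 mult_ac)
    qed
    show "((\<lambda>\<delta>. (a_delta \<nu> \<delta> b \<theta> (scl \<delta> * u))\<^sup>2 * ?r \<delta> (scl \<delta> * u)) \<longlongrightarrow> (a u)\<^sup>2 * \<rho>) (at_right 0)"
      if "u \<noteq> 0" for u
      by (intro tendsto_mult tendsto_power a_lim r_lim that)
    show "(\<lambda>u. (a u)\<^sup>2 * \<rho>) \<in> borel_measurable lborel"
      by measurable
  qed
  have "((\<lambda>\<delta>. integral {-pi..pi} (\<lambda>l. (a_delta \<nu> \<delta> b \<theta> l)\<^sup>2 * ?r \<delta> l) / scl \<delta>
      / (integral {-pi..pi} (a_delta \<nu> \<delta> b \<theta>) / scl \<delta>))
      \<longlongrightarrow> (\<integral>u. (a u)\<^sup>2 * \<rho> \<partial>lborel) / (\<integral>u. a u \<partial>lborel)) (at_right 0)"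
    using ratio(3) by (intro tendsto_divide num den) simp
  moreover have "(\<integral>u. (a u)\<^sup>2 * \<rho> \<partial>lborel) / (\<integral>u. a u \<partial>lborel) = 2 * \<nu> / (2 * \<nu> + 1) * \<rho>"
  proof -
    have "(2 * \<nu> + 1) * (\<integral>u. (a u)\<^sup>2 \<partial>lborel) = 2 * \<nu> * (\<integral>u. a u \<partial>lborel)"
      using ratio(4) by (simp add: q_def)
    then have "(\<integral>u. (a u)\<^sup>2 \<partial>lborel) = 2 * \<nu> / (2 * \<nu> + 1) * (\<integral>u. a u \<partial>lborel)"
      using \<nu> by (simp add: field_simps)
    then show ?thesis using ratio(3) by simp
  qed
  moreover have "\<forall>\<^sub>F \<delta> in at_right 0. integral {-pi..pi} (\<lambda>l. (a_delta \<nu> \<delta> b \<theta> l)\<^sup>2 * ?r \<delta> l) / scl \<delta>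
      / (integral {-pi..pi} (a_delta \<nu> \<delta> b \<theta>) / scl \<delta>) = psi \<nu> \<delta> b \<theta> b0 \<theta>0"
  proof (rule eventually_mono[OF eventually_at_right_less[of 0]])
    fix \<delta> :: real assume "0 < \<delta>"
    then have "scl \<delta> \<noteq> 0" using scl_pos[of \<delta>] by simp
    then show "integral {-pi..pi} (\<lambda>l. (a_delta \<nu> \<delta> b \<theta> l)\<^sup>2 * ?r \<delta> l) / scl \<delta>
      / (integral {-pi..pi} (a_delta \<nu> \<delta> b \<theta>) / scl \<delta>) = psi \<nu> \<delta> b \<theta> b0 \<theta>0"
      by (simp add: psi_def)
  qed
  ultimately show ?thesis
    by (simp add: Lim_transform_eventually \<rho>_def)
qed

end

section \<open>The smoother matrix and the observations\<close>

text \<open>Two-sided inverses are unique, so the definite description in \<open>mat_inv\<close>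
  selects any inverse that is exhibited.\<close>

lemma mat_inv_eqI:
  assumes "B \<in> carrier_mat n n" "M \<in> carrier_mat n n" "M * B = 1\<^sub>m n" "B * M = 1\<^sub>m n"
  shows "mat_inv n M = B"
  unfolding mat_inv_def
proof (rule the_equality)
  fix B' assume "B' \<in> carrier_mat n n \<and> M * B' = 1\<^sub>m n \<and> B' * M = 1\<^sub>m n"
  then have B': "B' \<in> carrier_mat n n" "M * B' = 1\<^sub>m n" by auto
  have "B' = (B * M) * B'" unfolding assms(4) by (rule left_mult_one_mat[OF B'(1), symmetric])
  also have "\<dots> = B * (M * B')" using B' assms by (intro assoc_mult_mat[of _ n n _ n _ n]) auto
  also have "\<dots> = B" using B' assms by simp
  finally show "B' = B" .
qed (use assms in auto)

section \<open>The inverse matrix inside the symbol calculus\<close>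

context toeplitz_symbol
begin

definition toep_mat :: "nat \<Rightarrow> real mat" where
  "toep_mat n = mat n n (\<lambda>(i, j). toep i j)"

definition shifted_mat :: "real \<Rightarrow> nat \<Rightarrow> real mat" where
  "shifted_mat b n = 1\<^sub>m n + b \<cdot>\<^sub>m toep_mat n"

text \<open>The inverse as a function of two indices, the format of \<open>has_symbol\<close>; only
  indices below \<open>n\<close> are meaningful.\<close>

definition resolvent :: "real \<Rightarrow> nat \<Rightarrow> nat \<Rightarrow> nat \<Rightarrow> real" where
  "resolvent b n i j = mat_inv n (shifted_mat b n) $$ (i, j)"

lemma toep_mat_carrier [simp]: "toep_mat n \<in> carrier_mat n n"
  by (simp add: toep_mat_def)

lemma shifted_mat_carrier [simp]: "shifted_mat b n \<in> carrier_mat n n"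
  by (simp add: shifted_mat_def)

lemma shifted_mat_dim [simp]: "dim_row (shifted_mat b n) = n" "dim_col (shifted_mat b n) = n"
  by (simp_all add: shifted_mat_def toep_mat_def)

lemma shifted_mat_index: "i < n \<Longrightarrow> j < n \<Longrightarrow> shifted_mat b n $$ (i, j) = of_bool (i = j) + b * toep i j"
  by (simp add: shifted_mat_def toep_mat_def)

text \<open>A vanishing determinant would provide a nonzero kernel vector, which
  \<open>vnorm_le_ident_plus_toep\<close> excludes.\<close>

lemma shifted_mat_inverse:
  assumes b: "0 \<le> b"
  shows "mat_inv n (shifted_mat b n) \<in> carrier_mat n n"
    "shifted_mat b n * mat_inv n (shifted_mat b n) = 1\<^sub>m n"
    "mat_inv n (shifted_mat b n) * shifted_mat b n = 1\<^sub>m n"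
proof -
  have "det (shifted_mat b n) \<noteq> 0"
  proof
    assume "det (shifted_mat b n) = 0"
    then obtain v where v: "v \<in> carrier_vec n" "v \<noteq> 0\<^sub>v n" "shifted_mat b n *\<^sub>v v = 0\<^sub>v n"
      using det_0_iff_vec_prod_zero_field[OF shifted_mat_carrier] by blast
    define x where "x i = complex_of_real (v $ i)" for i
    have zero: "x i + complex_of_real b * act n toep x i = 0" if i: "i < n" for i
    proof -
      have "(shifted_mat b n *\<^sub>v v) $ i = (\<Sum>k<n. (of_bool (i = k) + b * toep i k) * v $ k)"
        using i v(1) by (simp add: scalar_prod_def shifted_mat_index lessThan_atLeast0)
      also have "\<dots> = v $ i + b * (\<Sum>k<n. toep i k * v $ k)"
      proof -
        have "(\<Sum>k<n. of_bool (i = k) * v $ k) = v $ i"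
          using i by (subst sum.remove[of _ i]) (auto intro!: sum.neutral)
        then show ?thesis by (simp add: distrib_right sum.distrib sum_distrib_left mult.assoc)
      qed
      finally have "v $ i + b * (\<Sum>k<n. toep i k * v $ k) = 0"
        using v(3) i by simp
      then have "complex_of_real (v $ i + b * (\<Sum>k<n. toep i k * v $ k)) = 0" by (simp only: of_real_0)
      then show ?thesis by (simp add: act_def x_def)
    qed
    have "vnorm n x \<le> vnorm n (\<lambda>i. x i + complex_of_real b * act n toep x i)"
      by (rule vnorm_le_ident_plus_toep[OF b])
    also have "\<dots> = vnorm n (\<lambda>i. 0)" by (rule vnorm_cong) (rule zero)
    also have "\<dots> = 0" by (simp add: vnorm_def L2_set_def)
    finally have "(vnorm n x)\<^sup>2 = 0" using vnorm_nonneg[of n x] by simp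
    then have "\<forall>i<n. x i = 0" unfolding vnorm_sq by (subst (asm) sum_nonneg_eq_0_iff) auto
    then have "v = 0\<^sub>v n" using v(1) by (intro eq_vecI) (auto simp: x_def)
    with v(2) show False by simp
  qed
  from det_non_zero_imp_unit[OF shifted_mat_carrier this, of "()"]
  obtain B where B: "B \<in> carrier_mat n n" "shifted_mat b n * B = 1\<^sub>m n" "B * shifted_mat b n = 1\<^sub>m n"
    by (auto simp: Units_def ring_mat_def)
  have "mat_inv n (shifted_mat b n) = B"
    by (rule mat_inv_eqI[OF B(1) shifted_mat_carrier B(2,3)])
  with B show "mat_inv n (shifted_mat b n) \<in> carrier_mat n n"
    "shifted_mat b n * mat_inv n (shifted_mat b n) = 1\<^sub>m n"
    "mat_inv n (shifted_mat b n) * shifted_mat b n = 1\<^sub>m n"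
    by simp_all
qed

lemma act_shifted: "i < n \<Longrightarrow> act n (\<lambda>i j. of_bool (i = j) + b * toep i j) x i = x i + complex_of_real b * act n toep x i"
  by (simp add: act_add_left act_scale_left act_ident)

lemma resolvent_mprod:
  assumes b: "0 \<le> b" and ij: "i < n" "j < n"
  shows "mprod n (\<lambda>i j. of_bool (i = j) + b * toep i j) (resolvent b n) i j = of_bool (i = j)"
    "mprod n (resolvent b n) (\<lambda>i j. of_bool (i = j) + b * toep i j) i j = of_bool (i = j)"
proof -
  note inv = shifted_mat_inverse[OF b, of n]
  note dims = carrier_matD[OF inv(1)]
  have "(shifted_mat b n * mat_inv n (shifted_mat b n)) $$ (i, j) = of_bool (i = j)"
    using ij by (simp add: inv)
  then show "mprod n (\<lambda>i j. of_bool (i = j) + b * toep i j) (resolvent b n) i j = of_bool (i = j)"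
    using ij dims by (simp add: mprod_def resolvent_def scalar_prod_def shifted_mat_index lessThan_atLeast0)
  have "(mat_inv n (shifted_mat b n) * shifted_mat b n) $$ (i, j) = of_bool (i = j)"
    using ij by (simp add: inv)
  then show "mprod n (resolvent b n) (\<lambda>i j. of_bool (i = j) + b * toep i j) i j = of_bool (i = j)"
    using ij dims by (simp add: mprod_def resolvent_def scalar_prod_def shifted_mat_index lessThan_atLeast0)
qed

lemma resolvent_left:
  assumes b: "0 \<le> b" and i: "i < n"
  shows "act n (resolvent b n) (\<lambda>i. x i + complex_of_real b * act n toep x i) i = x i"
proof -
  have "act n (resolvent b n) (\<lambda>i. x i + complex_of_real b * act n toep x i)
      = act n (mprod n (resolvent b n) (\<lambda>i j. of_bool (i = j) + b * toep i j)) x"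
    unfolding act_mprod by (rule act_cong) (simp add: act_shifted)
  then have "act n (resolvent b n) (\<lambda>i. x i + complex_of_real b * act n toep x i) i
      = act n (mprod n (resolvent b n) (\<lambda>i j. of_bool (i = j) + b * toep i j)) x i"
    by simp
  also have "\<dots> = act n (\<lambda>i j. of_bool (i = j)) x i"
    by (rule act_cong_matrix) (rule resolvent_mprod[OF b i])
  finally show ?thesis using i by (simp add: act_ident)
qed

lemma resolvent_right:
  assumes b: "0 \<le> b" and i: "i < n"
  shows "act n (resolvent b n) x i + complex_of_real b * act n toep (act n (resolvent b n) x) i = x i"
proof -
  have "act n (resolvent b n) x i + complex_of_real b * act n toep (act n (resolvent b n) x) i
      = act n (mprod n (\<lambda>i j. of_bool (i = j) + b * toep i j) (resolvent b n)) x i"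
    unfolding act_mprod by (rule act_shifted[OF i, symmetric])
  also have "\<dots> = act n (\<lambda>i j. of_bool (i = j)) x i"
    by (rule act_cong_matrix) (rule resolvent_mprod[OF b i])
  finally show ?thesis using i by (simp add: act_ident)
qed

lemma resolvent_contraction:
  assumes b: "0 \<le> b"
  shows "vnorm n (act n (resolvent b n) x) \<le> vnorm n x"
proof -
  have "vnorm n (act n (resolvent b n) x)
      \<le> vnorm n (\<lambda>i. act n (resolvent b n) x i + complex_of_real b * act n toep (act n (resolvent b n) x) i)"
    by (rule vnorm_le_ident_plus_toep[OF b])
  also have "\<dots> = vnorm n x"
    by (rule vnorm_cong) (rule resolvent_right[OF b])
  finally show ?thesis .
qed

lemma has_symbol_resolvent: "0 \<le> b \<Longrightarrow> has_symbol (resolvent b) (\<lambda>l. 1 / (1 + b * (2 * pi * f l)))"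
  using has_symbol_inverse[of b "resolvent b"] resolvent_left resolvent_contraction by blast

text \<open>The transposed inverse is again an inverse of the symmetric matrix, hence the same
  one.\<close>

lemma resolvent_sym:
  assumes b: "0 \<le> b" and ij: "i < n" "j < n"
  shows "resolvent b n i j = resolvent b n j i"
proof -
  let ?M = "shifted_mat b n" and ?W = "mat_inv n (shifted_mat b n)"
  note inv = shifted_mat_inverse[OF b, of n]
  have Mt: "transpose_mat ?M = ?M"
    by (rule eq_matI) (auto simp: shifted_mat_index toep_sym)
  have "?W = transpose_mat ?W"
  proof (rule mat_inv_eqI)
    have "transpose_mat (?W * ?M) = transpose_mat ?M * transpose_mat ?W"
      by (rule transpose_mult[OF inv(1) shifted_mat_carrier])
    then show "?M * transpose_mat ?W = 1\<^sub>m n" by (simp add: inv Mt)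
    have "transpose_mat (?M * ?W) = transpose_mat ?W * transpose_mat ?M"
      by (rule transpose_mult[OF shifted_mat_carrier inv(1)])
    then show "transpose_mat ?W * ?M = 1\<^sub>m n" by (simp add: inv Mt)
  qed (use inv(1) in auto)
  then have "?W $$ (i, j) = transpose_mat ?W $$ (i, j)" by simp
  also have "\<dots> = ?W $$ (j, i)" using ij carrier_matD[OF inv(1)] by simp
  finally show ?thesis by (simp add: resolvent_def)
qed

end

text \<open>By symmetry both pairings sum to the trace of (BS)^2. As BS need not be symmetric, this
  trace is only bounded by the squared Frobenius norm, through xy \<le> (x^2 + y^2)/2.\<close>

lemma quadratic_variance_bound:
  fixes B S :: "nat \<Rightarrow> nat \<Rightarrow> real"
  assumes B: "\<And>i j. i < n \<Longrightarrow> j < n \<Longrightarrow> B i j = B j i" and S: "\<And>i j. S i j = S j i"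
  shows "(\<Sum>i<n. \<Sum>j<n. \<Sum>k<n. \<Sum>l<n. B i j * B k l * (S i k * S j l + S i l * S j k))
    \<le> 2 * (\<Sum>i<n. \<Sum>j<n. (mprod n B S i j)\<^sup>2)"
proof -
  define G where "G = mprod n B S"
  define F where "F i j = (\<Sum>k<n. \<Sum>l<n. B i j * B k l * (S i k * S j l))" for i j
  have "(\<Sum>i<n. \<Sum>j<n. F i j) = (\<Sum>j<n. \<Sum>i<n. \<Sum>k<n. \<Sum>l<n. (B j i * S i k) * (B k l * S l j))"
    unfolding F_def by (subst sum.swap) (intro sum.cong refl, simp add: B S mult_ac)
  also have "\<dots> = (\<Sum>j<n. \<Sum>k<n. \<Sum>i<n. \<Sum>l<n. (B j i * S i k) * (B k l * S l j))"
    by (intro sum.cong refl sum.swap)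
  also have "\<dots> = (\<Sum>j<n. \<Sum>k<n. G j k * G k j)"
    by (simp add: G_def mprod_def sum_product)
  also have "\<dots> \<le> (\<Sum>j<n. \<Sum>k<n. ((G j k)\<^sup>2 + (G k j)\<^sup>2) / 2)"
  proof (intro sum_mono)
    fix j k
    show "G j k * G k j \<le> ((G j k)\<^sup>2 + (G k j)\<^sup>2) / 2"
      using sum_squares_bound[of "G j k" "G k j"] by simp
  qed
  also have "\<dots> = ((\<Sum>j<n. \<Sum>k<n. (G j k)\<^sup>2) + (\<Sum>j<n. \<Sum>k<n. (G k j)\<^sup>2)) / 2"
    by (simp add: sum.distrib sum_divide_distrib add_divide_distrib)
  also have "(\<Sum>j<n. \<Sum>k<n. (G k j)\<^sup>2) = (\<Sum>j<n. \<Sum>k<n. (G j k)\<^sup>2)" by (rule sum.swap)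
  finally have F: "(\<Sum>i<n. \<Sum>j<n. F i j) \<le> (\<Sum>j<n. \<Sum>k<n. (G j k)\<^sup>2)" by simp
  have "(\<Sum>i<n. \<Sum>j<n. \<Sum>k<n. \<Sum>l<n. B i j * B k l * (S i k * S j l + S i l * S j k))
      = (\<Sum>i<n. \<Sum>j<n. F i j + F j i)"
  proof (intro sum.cong refl)
    fix i j assume "i \<in> {..<n}" "j \<in> {..<n}"
    then have "B i j = B j i" using B by simp
    then show "(\<Sum>k<n. \<Sum>l<n. B i j * B k l * (S i k * S j l + S i l * S j k)) = F i j + F j i"
      unfolding F_def sum.distrib[symmetric] by (intro sum.cong refl) (simp add: algebra_simps)
  qed
  also have "\<dots> = (\<Sum>i<n. \<Sum>j<n. F i j) + (\<Sum>i<n. \<Sum>j<n. F j i)"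
    by (simp add: sum.distrib)
  also have "(\<Sum>i<n. \<Sum>j<n. F j i) = (\<Sum>i<n. \<Sum>j<n. F i j)" by (rule sum.swap)
  finally show ?thesis using F by (simp add: G_def)
qed

section \<open>The Gaussian model in Toeplitz form\<close>

lemma toeplitz_symbol_g_delta:
  assumes "1/2 \<le> \<nu>" "0 < \<delta>" "0 < \<theta>"
  shows "toeplitz_symbol (g_delta \<nu> \<delta> \<theta>)"
  by standard (use assms in \<open>auto intro: continuous_g_delta g_delta_periodic g_delta_minus less_imp_le[OF g_delta_pos]\<close>)

text \<open>Two forms, since the model covariance uses the signed lag and \<open>R_mat\<close> its
  absolute value.\<close>

lemma K_cov_eq_toep:
  assumes "1/2 \<le> \<nu>" "0 < \<delta>" "0 < \<theta>"
  shows "K_cov \<nu> \<theta> (\<delta> * (real i - real j)) = toeplitz_symbol.toep (g_delta \<nu> \<delta> \<theta>) i j"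
    "K_cov \<nu> \<theta> (\<delta> * \<bar>real i - real j\<bar>) = toeplitz_symbol.toep (g_delta \<nu> \<delta> \<theta>) i j"
proof -
  interpret toeplitz_symbol "g_delta \<nu> \<delta> \<theta>" by (rule toeplitz_symbol_g_delta[OF assms])
  show "K_cov \<nu> \<theta> (\<delta> * (real i - real j)) = toep i j" for i j
    using K_cov_eq_integral_g_delta[OF assms, of "int i - int j"] by (simp add: toep_def)
  from this[of i j] this[of j i]
  show "K_cov \<nu> \<theta> (\<delta> * \<bar>real i - real j\<bar>) = toep i j"
    by (cases "real i \<ge> real j") (simp_all add: toep_sym abs_if)
qed

text \<open>A combination of the y's is a combination of the whole family over the sampling times
  and noise indices, each coefficient occurring twice. The cross covariances vanish, leaving the
  identity plus b0 times a Toeplitz matrix.\<close>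

lemma gaussian_vector_observations:
  assumes gauss: "centered_gaussian_family M X (model_cov \<nu> b0 \<theta>0)"
    and \<nu>: "1/2 \<le> \<nu>" and \<delta>: "0 < \<delta>" and \<theta>0: "0 < \<theta>0"
  shows "gaussian_vector M n (\<lambda>i \<omega>. X (Inl (real (i + 1) * \<delta>)) \<omega> + X (Inr i) \<omega>)
    (\<lambda>i j. of_bool (i = j) + b0 * toeplitz_symbol.toep (g_delta \<nu> \<delta> \<theta>0) i j)"
proof -
  interpret T0: toeplitz_symbol "g_delta \<nu> \<delta> \<theta>0" by (rule toeplitz_symbol_g_delta[OF \<nu> \<delta> \<theta>0])
  have meas [measurable]: "X p \<in> borel_measurable M" for p
    using gauss by (simp add: centered_gaussian_family_def)
  show ?thesis
  proof (intro gaussian_vector.intro gaussian_vector_axioms.intro)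
    show "prob_space M" using gauss by (simp add: centered_gaussian_family_def)
    show "(\<lambda>\<omega>. X (Inl (real (i + 1) * \<delta>)) \<omega> + X (Inr i) \<omega>) \<in> borel_measurable M" for i by measurable
    show "of_bool (i = j) + b0 * T0.toep i j = of_bool (j = i) + b0 * T0.toep j i" for i j
      using T0.toep_sym[of i j] by auto
    fix c :: "nat \<Rightarrow> real"
    define t where "t i = (Inl (real (i + 1) * \<delta>) :: real + nat)" for i
    define I where "I = t ` {..<n} \<union> Inr ` {..<n}"
    \<comment> \<open>Coefficients must be attached to times: rounding t/\<delta> recovers i + 1
      from the time (i + 1) \<delta>, and the subtraction undoes the shift.\<close>
    define d where "d p = (case p of Inl t \<Rightarrow> c (nat (round (t / \<delta>)) - 1) | Inr i \<Rightarrow> c i)" for p :: "real + nat"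
    have d: "d (t i) = c i" "d (Inr i) = c i" for i
      using \<delta> by (simp_all add: d_def t_def del: of_nat_Suc of_nat_add)
    have inj: "inj_on t {..<n}" using \<delta> by (auto simp: inj_on_def t_def)
    have sum_I: "(\<Sum>p\<in>I. h p) = (\<Sum>i<n. h (t i)) + (\<Sum>i<n. h (Inr i))" for h :: "real + nat \<Rightarrow> real"
    proof -
      have "(\<Sum>p\<in>I. h p) = (\<Sum>p\<in>t ` {..<n}. h p) + (\<Sum>p\<in>Inr ` {..<n}. h p)"
        unfolding I_def by (rule sum.union_disjoint) (auto simp: t_def)
      then show ?thesis
        by (simp add: sum.reindex[OF inj] sum.reindex)
    qed
    have cov: "model_cov \<nu> b0 \<theta>0 (t i) (t j) = b0 * T0.toep i j"
      "model_cov \<nu> b0 \<theta>0 (t i) (Inr k) = 0" "model_cov \<nu> b0 \<theta>0 (Inr k) (t i) = 0"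
      "model_cov \<nu> b0 \<theta>0 (Inr k) (Inr j) = of_bool (k = j)" for i j k
    proof -
      have "real (j + 1) * \<delta> - real (i + 1) * \<delta> = \<delta> * (real j - real i)" by (simp add: algebra_simps)
      then show "model_cov \<nu> b0 \<theta>0 (t i) (t j) = b0 * T0.toep i j"
        using K_cov_eq_toep(1)[OF \<nu> \<delta> \<theta>0, of j i] T0.toep_sym[of i j]
        by (simp add: model_cov_def t_def del: of_nat_Suc of_nat_add)
    qed (simp_all add: model_cov_def t_def)
    have fin: "finite I" by (simp add: I_def)
    have "(\<integral>\<omega>. cis (\<Sum>p\<in>I. d p * X p \<omega>) \<partial>M)
        = complex_of_real (exp (- (\<Sum>p\<in>I. \<Sum>p'\<in>I. d p * d p' * model_cov \<nu> b0 \<theta>0 p p') / 2))"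
      using gauss[unfolded centered_gaussian_family_def, THEN conjunct2, THEN conjunct2, rule_format, OF fin] .
    moreover have "(\<Sum>p\<in>I. d p * X p \<omega>) = (\<Sum>i<n. c i * (X (Inl (real (i + 1) * \<delta>)) \<omega> + X (Inr i) \<omega>))" for \<omega>
      unfolding sum_I d by (simp add: t_def distrib_left sum.distrib)
    moreover have "(\<Sum>p\<in>I. \<Sum>p'\<in>I. d p * d p' * model_cov \<nu> b0 \<theta>0 p p')
        = (\<Sum>i<n. \<Sum>j<n. c i * c j * (of_bool (i = j) + b0 * T0.toep i j))"
      unfolding sum_I d cov by (simp add: distrib_left sum.distrib)
    ultimately show "(\<integral>\<omega>. cis (\<Sum>i<n. c i * (X (Inl (real (i + 1) * \<delta>)) \<omega> + X (Inr i) \<omega>)) \<partial>M)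
        = complex_of_real (exp (- (\<Sum>i<n. \<Sum>j<n. c i * c j * (of_bool (i = j) + b0 * T0.toep i j)) / 2))"
      by simp
  qed
qed

text \<open>W + A = (I + bT) W = I gives A = I - W, hence A (I - A) = (I - W) W = W - W^2.\<close>

lemma (in toeplitz_symbol) smoother_mat:
  assumes b: "0 \<le> b"
  defines "A \<equiv> \<lambda>n. (b \<cdot>\<^sub>m toep_mat n) * mat_inv n (shifted_mat b n)"
  shows "A n \<in> carrier_mat n n"
    "i < n \<Longrightarrow> j < n \<Longrightarrow> A n $$ (i, j) = of_bool (i = j) - resolvent b n i j"
    "i < n \<Longrightarrow> j < n \<Longrightarrow> (A n * (1\<^sub>m n - A n)) $$ (i, j)
      = resolvent b n i j - mprod n (resolvent b n) (resolvent b n) i j"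
proof -
  let ?W = "mat_inv n (shifted_mat b n)"
  note inv = shifted_mat_inverse[OF b, of n]
  have bT: "b \<cdot>\<^sub>m toep_mat n \<in> carrier_mat n n" by simp
  show A: "A n \<in> carrier_mat n n" unfolding A_def by (rule mult_carrier_mat[OF bT inv(1)])
  have "?W + A n = (1\<^sub>m n + b \<cdot>\<^sub>m toep_mat n) * ?W"
    unfolding A_def using add_mult_distrib_mat[OF one_carrier_mat bT inv(1)] left_mult_one_mat[OF inv(1)] by simp
  also have "\<dots> = 1\<^sub>m n" using inv(2) by (simp add: shifted_mat_def)
  finally have sum: "?W + A n = 1\<^sub>m n" .
  have entry: "A n $$ (i, j) = of_bool (i = j) - resolvent b n i j" if "i < n" "j < n" for i j
  proof -
    have "(?W + A n) $$ (i, j) = of_bool (i = j)" using that by (simp add: sum)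
    then show ?thesis using that carrier_matD[OF A] by (simp add: resolvent_def)
  qed
  then show "i < n \<Longrightarrow> j < n \<Longrightarrow> A n $$ (i, j) = of_bool (i = j) - resolvent b n i j" .
  show "(A n * (1\<^sub>m n - A n)) $$ (i, j) = resolvent b n i j - mprod n (resolvent b n) (resolvent b n) i j"
    if ij: "i < n" "j < n"
  proof -
    have "(A n * (1\<^sub>m n - A n)) $$ (i, j) = (\<Sum>k<n. A n $$ (i, k) * (of_bool (k = j) - A n $$ (k, j)))"
      using ij carrier_matD[OF A] by (simp add: scalar_prod_def lessThan_atLeast0 of_bool_def)
    also have "\<dots> = (\<Sum>k<n. of_bool (i = k) * resolvent b n k j - resolvent b n i k * resolvent b n k j)"
      using ij by (intro sum.cong refl) (simp add: entry left_diff_distrib)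
    also have "\<dots> = (\<Sum>k<n. of_bool (i = k) * resolvent b n k j) - mprod n (resolvent b n) (resolvent b n) i j"
      by (simp add: sum_subtractf mprod_def)
    also have "(\<Sum>k<n. of_bool (i = k) * resolvent b n k j) = resolvent b n i j"
      using ij by (subst sum.remove[of _ i]) (auto intro!: sum.neutral)
    finally show ?thesis .
  qed
qed

section \<open>Convergence in probability of the statistic\<close>

lemma test_stat_tendsto_psi:
  fixes M :: "'a measure"
  assumes \<nu>: "1/2 \<le> \<nu>" and b0: "0 < b0" and \<theta>0: "0 < \<theta>0"
    and gauss: "centered_gaussian_family M X (model_cov \<nu> b0 \<theta>0)"
    and \<delta>: "0 < \<delta>" and b: "0 < b" and \<theta>: "0 < \<theta>" and e: "0 < e"
  shows "(\<lambda>n. measure M {\<omega> \<in> space M. \<bar>test_stat \<nu> X \<delta> b \<theta> n \<omega> - psi \<nu> \<delta> b \<theta> b0 \<theta>0\<bar> > e}) \<longlonglongrightarrow> 0"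
proof -
  let ?g = "g_delta \<nu> \<delta> \<theta>" and ?h = "g_delta \<nu> \<delta> \<theta>0"
  have symb: "toeplitz_symbol ?g" "toeplitz_symbol ?h"
    using toeplitz_symbol_g_delta[OF \<nu> \<delta>] \<theta> \<theta>0 by blast+
  interpret T: toeplitz_symbol ?g by (rule symb)
  interpret T0: toeplitz_symbol ?h by (rule symb)
  interpret prob_space M using gauss by (simp add: centered_gaussian_family_def)
  have b': "0 \<le> b" using b by simp
  have g: "0 < ?g l" for l by (rule g_delta_pos[OF \<nu> \<delta> \<theta>])
  have g0: "0 < ?h l" for l by (rule g_delta_pos[OF \<nu> \<delta> \<theta>0])
  define Y where "Y i \<omega> = X (Inl (real (i + 1) * \<delta>)) \<omega> + X (Inr i) \<omega>" for i \<omega>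
  define S where "S i j = of_bool (i = j) + b0 * T0.toep i j" for i j
  define W where "W = T.resolvent b"
  define B where "B n i j = W n i j - mprod n (W n) (W n) i j" for n i j
  \<comment> \<open>\<open>of_bool (i = i)\<close> is 1; the spelling matches the diagonal of the
    identity minus \<open>W\<close> in the symbol calculus.\<close>
  define tr where "tr n = (\<Sum>i<n. of_bool (i = i) - W n i i)" for n
  define mean where "mean n = (\<Sum>i<n. \<Sum>j<n. B n i j * S i j)" for n
  have gv: "gaussian_vector M n Y S" for n
    using gaussian_vector_observations[OF gauss \<nu> \<delta> \<theta>0, of n]
    by (simp add: Y_def[abs_def] S_def[abs_def])
  have S_sym: "S i j = S j i" for i j by (rule gaussian_vector.S_sym[OF gv])
  have W_contr: "vnorm n (act n (W n) x) \<le> vnorm n x" for n x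
    unfolding W_def by (rule T.resolvent_contraction[OF b'])

  have stat: "test_stat \<nu> X \<delta> b \<theta> n \<omega> = gaussian_vector.quad n Y (B n) \<omega> / tr n - 1" for n \<omega>
  proof -
    let ?A = "(b \<cdot>\<^sub>m T.toep_mat n) * mat_inv n (T.shifted_mat b n)"
    note sm = T.smoother_mat[OF b', where n = n]
    have "R_mat \<nu> \<delta> \<theta> n = T.toep_mat n"
      unfolding R_mat_def T.toep_mat_def by (rule eq_matI) (simp_all add: K_cov_eq_toep(2)[OF \<nu> \<delta> \<theta>])
    then have A: "A_mat \<nu> \<delta> b \<theta> n = ?A"
      by (simp add: A_mat_def T.shifted_mat_def)
    have "mat_trace ?A = tr n"
      unfolding mat_trace_def carrier_matD(1)[OF sm(1)] tr_def W_def
      by (intro sum.cong refl sm(2)) auto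
    moreover have "y_vec X \<delta> n \<omega> \<bullet> ((?A * (1\<^sub>m n - ?A)) *\<^sub>v y_vec X \<delta> n \<omega>) = gaussian_vector.quad n Y (B n) \<omega>"
    proof -
      let ?Q = "?A * (1\<^sub>m n - ?A)"
      have dim: "dim_row ?Q = n" "dim_col ?Q = n" using carrier_matD[OF sm(1)] by simp_all
      have "y_vec X \<delta> n \<omega> \<bullet> (?Q *\<^sub>v y_vec X \<delta> n \<omega>) = (\<Sum>i<n. Y i \<omega> * (\<Sum>j<n. ?Q $$ (i, j) * Y j \<omega>))"
        using dim by (simp add: scalar_prod_def y_vec_def Y_def lessThan_atLeast0 del: index_mult_mat(1))
      also have "\<dots> = (\<Sum>i<n. \<Sum>j<n. B n i j * (Y i \<omega> * Y j \<omega>))"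
        unfolding sum_distrib_left
      proof (intro sum.cong refl)
        fix i j assume "i \<in> {..<n}" "j \<in> {..<n}"
        then have "?Q $$ (i, j) = B n i j" unfolding B_def W_def by (intro sm(3)) auto
        then show "Y i \<omega> * (?Q $$ (i, j) * Y j \<omega>) = B n i j * (Y i \<omega> * Y j \<omega>)"
          by (simp only: mult.left_commute)
      qed
      finally show ?thesis by (simp add: gaussian_vector.quad_def[OF gv])
    qed
    ultimately show ?thesis by (simp add: test_stat_def A Let_def)
  qed

  define w where "w l = 1 / (1 + b * (2 * pi * ?g l))" for l
  define \<sigma> where "\<sigma> l = 1 + b0 * (2 * pi * ?h l)" for l
  have w_den: "0 < 1 + b * (2 * pi * ?g l)" for l using b g[of l] by (simp add: add_pos_pos)
  have w01: "0 < w l" "w l \<le> 1" for l using b g[of l] w_den[of l] by (auto simp: w_def)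
  have cont_a: "continuous_on A (a_delta \<nu> \<delta> b \<theta>)" for A
    using continuous_a_delta[OF \<nu> \<delta> \<theta> b] continuous_on_subset by blast
  have a_eq: "a_delta \<nu> \<delta> b \<theta> l = 1 - w l" for l
  proof -
    have "b * ?g l + 1 / (2 * pi) = (1 + b * (2 * pi * ?g l)) / (2 * pi)" by (simp add: field_simps)
    then show ?thesis using w_den[of l] by (simp add: a_delta_def w_def field_simps)
  qed
  have cont_w: "continuous_on A w" for A
  proof -
    have "w = (\<lambda>l. 1 - a_delta \<nu> \<delta> b \<theta> l)" by (simp add: a_eq)
    then show ?thesis by (simp add: continuous_on_diff cont_a)
  qed
  have cont_\<sigma>: "continuous_on A \<sigma>" for A
    unfolding \<sigma>_def by (intro continuous_intros)
  have hW: "has_symbol W w"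
    unfolding W_def w_def[abs_def] by (rule T.has_symbol_resolvent[OF b'])
  have hS: "has_symbol (\<lambda>n. S) \<sigma>"
    using has_symbol_add_scaled[OF has_symbol_ident T0.has_symbol_toep, of b0]
    by (simp add: S_def[abs_def] \<sigma>_def[abs_def])
  obtain C where C: "\<And>l. l \<in> {-pi..pi} \<Longrightarrow> ?h l \<le> C" using T0.bounded by blast
  have \<sigma>_bound: "\<bar>\<sigma> l\<bar> \<le> 1 + b0 * (2 * pi * C)" if "l \<in> {-pi..pi}" for l
  proof -
    have "0 < \<sigma> l" unfolding \<sigma>_def using b0 g0[of l] by (simp add: add_pos_pos)
    moreover have "\<sigma> l \<le> 1 + b0 * (2 * pi * C)"
      unfolding \<sigma>_def using b0 C[OF that] by (intro add_left_mono mult_left_mono) auto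
    ultimately show ?thesis by simp
  qed
  have w\<sigma>_bound: "\<bar>w l * \<sigma> l\<bar> \<le> 1 + b0 * (2 * pi * C)" if "l \<in> {-pi..pi}" for l
  proof -
    have "\<bar>w l * \<sigma> l\<bar> \<le> 1 * \<bar>\<sigma> l\<bar>"
      unfolding abs_mult using w01[of l] by (intro mult_right_mono) auto
    then show ?thesis using \<sigma>_bound[OF that] by simp
  qed
  have hWS: "has_symbol (\<lambda>n. mprod n (W n) S) (\<lambda>l. w l * \<sigma> l)"
    by (rule has_symbol_mult[OF hW hS, where K = 1]) (use W_contr in simp, rule \<sigma>_bound)
  \<comment> \<open>Grouping as W (WS) keeps the contraction \<open>W\<close> as the left factor, as
    \<open>has_symbol_mult\<close> demands.\<close>
  have hWWS: "has_symbol (\<lambda>n. mprod n (W n) (mprod n (W n) S)) (\<lambda>l. w l * (w l * \<sigma> l))"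
    by (rule has_symbol_mult[OF hW hWS, where K = 1]) (use W_contr in simp, rule w\<sigma>_bound)

  define \<beta> where "\<beta> l = w l * \<sigma> l - w l * (w l * \<sigma> l)" for l
  have cont_\<beta>: "continuous_on A \<beta>" for A
    unfolding \<beta>_def by (intro continuous_intros cont_w cont_\<sigma>)
  have BS: "mprod n (B n) S i j = mprod n (W n) S i j - mprod n (W n) (mprod n (W n) S) i j" for n i j
    unfolding B_def[abs_def] mprod_diff_left mprod_assoc ..
  \<comment> \<open>Symmetry of \<open>S\<close> turns the entrywise sum into the trace of BS, whose
    symbol is \<beta>.\<close>
  have mean_eq: "mean n = (\<Sum>i<n. mprod n (W n) S i i - mprod n (W n) (mprod n (W n) S) i i)" for n
  proof -
    have "mean n = (\<Sum>i<n. mprod n (B n) S i i)"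
      unfolding mean_def mprod_def by (intro sum.cong refl arg_cong2[where f = "(*)"] S_sym)
    then show ?thesis by (simp only: BS)
  qed
  have mean_lim: "(\<lambda>n. mean n / real n) \<longlonglongrightarrow> integral {-pi..pi} \<beta> / (2 * pi)"
    unfolding mean_eq \<beta>_def[abs_def]
    by (rule has_symbol_trace[OF has_symbol_diff[OF hWS hWWS]]) (intro continuous_intros cont_w cont_\<sigma>)
  have tr_lim: "(\<lambda>n. tr n / real n) \<longlonglongrightarrow> integral {-pi..pi} (a_delta \<nu> \<delta> b \<theta>) / (2 * pi)"
  proof -
    have "(\<lambda>n. tr n / real n) \<longlonglongrightarrow> integral {-pi..pi} (\<lambda>l. 1 - w l) / (2 * pi)"
      unfolding tr_def
      by (rule has_symbol_trace[OF has_symbol_diff[OF has_symbol_ident hW]]) (intro continuous_intros cont_w)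
    then show ?thesis by (simp add: a_eq[abs_def])
  qed
  let ?Ia = "integral {-pi..pi} (a_delta \<nu> \<delta> b \<theta>)"
  have Ia: "0 < ?Ia"
  proof -
    \<comment> \<open>A minimum over the compact interval bounds the integral of a below by a
      positive number, which justifies dividing by the trace.\<close>
    obtain x where x: "\<And>l. l \<in> {-pi..pi} \<Longrightarrow> a_delta \<nu> \<delta> b \<theta> x \<le> a_delta \<nu> \<delta> b \<theta> l"
    proof -
      have "\<exists>x\<in>{-pi..pi}. \<forall>l\<in>{-pi..pi}. a_delta \<nu> \<delta> b \<theta> x \<le> a_delta \<nu> \<delta> b \<theta> l"
        by (intro continuous_attains_inf cont_a) auto
      then show ?thesis using that by blast
    qed
    have "0 < a_delta \<nu> \<delta> b \<theta> x" using b g[of x] by (simp add: a_delta_def add_pos_pos)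
    then have "0 < integral {-pi..pi} (\<lambda>l. a_delta \<nu> \<delta> b \<theta> x)" by simp
    also have "\<dots> \<le> ?Ia"
      by (intro integral_le integrable_continuous_real cont_a continuous_on_const x)
    finally show ?thesis .
  qed
  have psi_eq: "integral {-pi..pi} \<beta> / ?Ia = 1 + psi \<nu> \<delta> b \<theta> b0 \<theta>0"
  proof -
    have "(a_delta \<nu> \<delta> b \<theta> l)\<^sup>2 * (b0 * ?h l / (b * ?g l) - 1) = \<beta> l - a_delta \<nu> \<delta> b \<theta> l" for l
    proof -
      \<comment> \<open>This is 2 pi b g w = a: one factor a cancels the b g of the density ratio
        and leaves 2 pi w b0 g0.\<close>
      have wF: "b * ?g l * (2 * pi * w l) = 1 - w l"
        using w_den[of l] by (simp add: w_def field_simps)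
      have bg: "b * ?g l \<noteq> 0" using b g[of l] by simp
      have "(1 - w l)\<^sup>2 * (b0 * ?h l / (b * ?g l)) = (1 - w l) * (2 * pi * w l) * (b0 * ?h l)"
        unfolding power2_eq_square wF[symmetric] using bg by simp
      then show ?thesis
        unfolding a_eq \<beta>_def \<sigma>_def by (simp add: power2_eq_square algebra_simps)
    qed
    then have "psi \<nu> \<delta> b \<theta> b0 \<theta>0 = 1 / ?Ia * integral {-pi..pi} (\<lambda>l. \<beta> l - a_delta \<nu> \<delta> b \<theta> l)"
      by (simp add: psi_def)
    also have "integral {-pi..pi} (\<lambda>l. \<beta> l - a_delta \<nu> \<delta> b \<theta> l) = integral {-pi..pi} \<beta> - ?Ia"
      by (intro Henstock_Kurzweil_Integration.integral_diff integrable_continuous_real cont_\<beta> cont_a)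
    finally show ?thesis using Ia by (simp add: field_simps)
  qed
  have ratio_lim: "(\<lambda>n. mean n / tr n) \<longlonglongrightarrow> 1 + psi \<nu> \<delta> b \<theta> b0 \<theta>0"
  proof -
    have "(\<lambda>n. (mean n / real n) / (tr n / real n)) \<longlonglongrightarrow> (integral {-pi..pi} \<beta> / (2*pi)) / (?Ia / (2*pi))"
      using Ia by (intro tendsto_divide mean_lim tr_lim) simp
    then have "(\<lambda>n. (mean n / real n) / (tr n / real n)) \<longlonglongrightarrow> 1 + psi \<nu> \<delta> b \<theta> b0 \<theta>0"
      by (simp add: psi_eq)
    moreover have "\<forall>\<^sub>F n in sequentially. (mean n / real n) / (tr n / real n) = mean n / tr n"
      using eventually_gt_at_top[of 0] by eventually_elim simp
    ultimately show ?thesis by (rule Lim_transform_eventually)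
  qed

  obtain K0 where K0: "0 \<le> K0" "\<And>n x. vnorm n (act n T0.toep x) \<le> K0 * vnorm n x"
    using T0.toep_bounded by blast
  \<comment> \<open>1 + b0 K0 bounds \<open>S\<close>; the 2 comes from W - W^2 with W a
    contraction.\<close>
  define K where "K = 2 * (1 + b0 * K0)"
  have BS_bound: "vnorm n (act n (mprod n (B n) S) x) \<le> K * vnorm n x" for n x
  proof -
    have S_act: "vnorm n (act n S x) \<le> (1 + b0 * K0) * vnorm n x"
    proof -
      have "vnorm n (act n S x) = vnorm n (\<lambda>i. x i + complex_of_real b0 * act n T0.toep x i)"
        unfolding S_def[abs_def] by (rule vnorm_cong) (rule T0.act_shifted)
      also have "\<dots> \<le> vnorm n x + b0 * vnorm n (act n T0.toep x)"
        using vnorm_add[of n x "\<lambda>i. complex_of_real b0 * act n T0.toep x i"] b0 by (simp add: vnorm_scale)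
      also have "\<dots> \<le> vnorm n x + b0 * (K0 * vnorm n x)"
        using b0 K0(2) by (intro add_left_mono mult_left_mono) auto
      finally show ?thesis by (simp add: algebra_simps)
    qed
    let ?y = "act n S x"
    have "vnorm n (act n (mprod n (B n) S) x) = vnorm n (\<lambda>i. act n (W n) ?y i - act n (W n) (act n (W n) ?y) i)"
      unfolding act_mprod by (rule vnorm_cong) (simp add: B_def[abs_def] act_diff_left act_mprod)
    also have "\<dots> \<le> vnorm n ?y + vnorm n ?y"
      by (intro order_trans[OF vnorm_diff] add_mono W_contr order_trans[OF W_contr W_contr])
    also have "\<dots> \<le> K * vnorm n x" unfolding K_def mult.assoc using S_act by linarith
    finally show ?thesis .
  qed
  define V where "V = 2 * K\<^sup>2"
  have B_sym: "B n i j = B n j i" if "i < n" "j < n" for n i j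
  proof -
    have W_sym: "W n i j = W n j i" if "i < n" "j < n" for i j
      unfolding W_def by (rule T.resolvent_sym[OF b' that])
    have "mprod n (W n) (W n) i j = mprod n (W n) (W n) j i"
      unfolding mprod_def using that by (intro sum.cong refl) (simp add: W_sym mult.commute)
    then show ?thesis using that by (simp add: B_def W_sym)
  qed

  have cheb: "prob {\<omega> \<in> space M. a \<le> \<bar>gaussian_vector.quad n Y (B n) \<omega> - mean n\<bar>} \<le> V * real n / a\<^sup>2"
    if a: "0 < a" for a n
  proof -
    interpret G: gaussian_vector M n Y S by (rule gv)
    have E: "expectation (G.quad (B n)) = mean n"
      using G.quad_expectation[of "B n"] by (simp add: has_bochner_integral_iff mean_def)
    have "variance (G.quad (B n)) \<le> 2 * (\<Sum>i<n. \<Sum>j<n. (mprod n (B n) S i j)\<^sup>2)"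
      unfolding G.quad_variance(2) by (rule quadratic_variance_bound) (simp_all add: B_sym S_sym)
    also have "\<dots> \<le> V * real n"
      using sum_squares_le_of_bounded[of n "mprod n (B n) S" K] BS_bound by (simp add: V_def)
    finally have var: "variance (G.quad (B n)) \<le> V * real n" .
    have "prob {\<omega> \<in> space M. a \<le> \<bar>G.quad (B n) \<omega> - mean n\<bar>} \<le> variance (G.quad (B n)) / a\<^sup>2"
      using Chebyshev_inequality[of "G.quad (B n)" a] G.quad_expectation[of "B n"] G.quad_variance(1)[of "B n"] a
      unfolding E by (simp add: has_bochner_integral_iff borel_measurable_integrable)
    also have "\<dots> \<le> V * real n / a\<^sup>2"
      by (rule divide_right_mono[OF var]) simp
    finally show ?thesis .
  qed

  have tr_pos: "\<forall>\<^sub>F n in sequentially. 0 < tr n"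
  proof -
    have "\<forall>\<^sub>F n in sequentially. 0 < tr n / real n"
      using Ia by (intro order_tendstoD(1)[OF tr_lim]) simp
    then show ?thesis by eventually_elim (auto simp: zero_less_divide_iff)
  qed
  have close: "\<forall>\<^sub>F n in sequentially. \<bar>mean n / tr n - (1 + psi \<nu> \<delta> b \<theta> b0 \<theta>0)\<bar> < e / 2"
    using tendstoD[OF ratio_lim half_gt_zero[OF e]] by (simp add: dist_real_def)
  let ?P = "\<lambda>n. measure M {\<omega> \<in> space M. \<bar>test_stat \<nu> X \<delta> b \<theta> n \<omega> - psi \<nu> \<delta> b \<theta> b0 \<theta>0\<bar> > e}"
  show ?thesis
  proof (rule tendsto_sandwich)
    show "\<forall>\<^sub>F n in sequentially. 0 \<le> ?P n" by simp
    show "\<forall>\<^sub>F n in sequentially. ?P n \<le> 4 * V / e\<^sup>2 * (1 / real n) / (tr n / real n)\<^sup>2"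
      using tr_pos close eventually_gt_at_top[of 0]
    proof eventually_elim
      case (elim n)
      interpret G: gaussian_vector M n Y S by (rule gv)
      let ?Q = "G.quad (B n)"
      \<comment> \<open>Half of \<open>e\<close> is left for the fluctuation, the other half covers
        the bias by \<open>close\<close>. Chebyshev at this level gives 4 V n / (e tr n)^2, which is
        O(1/n) since the trace grows like n.\<close>
      define a where "a = tr n * (e / 2)"
      have a: "0 < a" using elim e by (simp add: a_def)
      have "{\<omega> \<in> space M. \<bar>test_stat \<nu> X \<delta> b \<theta> n \<omega> - psi \<nu> \<delta> b \<theta> b0 \<theta>0\<bar> > e}
          \<subseteq> {\<omega> \<in> space M. a \<le> \<bar>?Q \<omega> - mean n\<bar>}"
      proof safe
        fix \<omega> assume "e < \<bar>test_stat \<nu> X \<delta> b \<theta> n \<omega> - psi \<nu> \<delta> b \<theta> b0 \<theta>0\<bar>"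
        then have "e < \<bar>(?Q \<omega> - mean n) / tr n + (mean n / tr n - (1 + psi \<nu> \<delta> b \<theta> b0 \<theta>0))\<bar>"
          by (simp add: stat diff_divide_distrib)
        then have "e / 2 \<le> \<bar>(?Q \<omega> - mean n) / tr n\<bar>"
          using elim(2) by linarith
        then show "a \<le> \<bar>?Q \<omega> - mean n\<bar>"
          using elim(1) by (simp add: a_def abs_divide pos_le_divide_eq mult.commute)
      qed
      moreover have "{\<omega> \<in> space M. a \<le> \<bar>?Q \<omega> - mean n\<bar>} \<in> sets M"
      proof -
        have [measurable]: "?Q \<in> borel_measurable M"
          using G.quad_expectation[of "B n"] by (simp add: has_bochner_integral_iff borel_measurable_integrable)
        show ?thesis by measurable
      qed
      ultimately have "?P n \<le> prob {\<omega> \<in> space M. a \<le> \<bar>?Q \<omega> - mean n\<bar>}"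
        by (rule finite_measure_mono)
      also have "\<dots> \<le> V * real n / a\<^sup>2" by (rule cheb[OF a])
      also have "\<dots> = 4 * V / e\<^sup>2 * (1 / real n) / (tr n / real n)\<^sup>2"
        using elim e by (simp add: a_def power2_eq_square field_simps)
      finally show ?case .
    qed
    have "(\<lambda>n. 4 * V / e\<^sup>2 * (1 / real n) / (tr n / real n)\<^sup>2) \<longlonglongrightarrow> 4 * V / e\<^sup>2 * 0 / (?Ia / (2 * pi))\<^sup>2"
      using Ia by (intro tendsto_divide tendsto_mult tendsto_const tendsto_power tr_lim lim_1_over_n) simp
    then show "(\<lambda>n. 4 * V / e\<^sup>2 * (1 / real n) / (tr n / real n)\<^sup>2) \<longlonglongrightarrow> 0" by simp
  qed simp
qed

theorem theorem3p1:
  fixes \<nu> b0 \<theta>0 :: real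
  assumes "\<nu> \<ge> 1/2" and "b0 > 0" and "\<theta>0 > 0"
  shows "(\<forall>(M :: 'a measure) X \<delta> b \<theta>.
            centered_gaussian_family M X (model_cov \<nu> b0 \<theta>0) \<and> \<delta> > 0 \<and> b > 0 \<and> \<theta> > 0 \<longrightarrow>
            (\<forall>e > 0. (\<lambda>n. measure M {\<omega> \<in> space M.
                 \<bar>test_stat \<nu> X \<delta> b \<theta> n \<omega> - psi \<nu> \<delta> b \<theta> b0 \<theta>0\<bar> > e}) \<longlonglongrightarrow> 0))
       \<and> (\<forall>b \<theta>. b > 0 \<and> \<theta> > 0 \<longrightarrow>
            ((\<lambda>\<delta>. psi \<nu> \<delta> b \<theta> b0 \<theta>0) \<longlongrightarrow>
               (2 * \<nu> / (2 * \<nu> + 1)) * (b0 * \<theta>0 powr (2 * \<nu>) / (b * \<theta> powr (2 * \<nu>)) - 1))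
              (at_right 0))"
  using assms by (blast intro: test_stat_tendsto_psi psi_tendsto)

end
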